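(* 1. Let $K,\varepsilon>0$, let $(M,g)$ be a compact Riemannian $n$-manifold with $\mathrm{Ric}_{(M,g)}\ge n-1$, and let $p\in M$. Then there is a Riemannian metric $\tilde g$ on $M$ with $$\mathrm{Ric}_{(M,\tilde g)}\ge n-1-\varepsilon\quad\text{and}\quad \sec_{(M,\tilde g)}|_p\ge K.$$ 2. Let $K>0$, let $\{(M,g_\alpha)\}_{\alpha=1}^\infty$ be a family of almost non-negatively curved compact Riemannian $n$-manifolds, and let $p\in M$. Then there is a sequence of almost non-negatively curved metrics $\tilde g_\alpha$ on $M$ with $$\sec_{(M,\tilde g_\alpha)}|_p>K .$$ 3. If $\{(M,g_\alpha)\}_{\alpha=1}^\infty$ satisfies the hypotheses of Parts 1 and 2 (that is, it is almost non-negatively curved and $\mathrm{Ric}_{(M,g_\alpha)}\ge n-1$ for each $\alpha$), then there is a sequence of metrics $\tilde g_\alpha$ on $M$ that satisfies the conclusions of Parts 1 and 2. 4. If, in addition, $p$ is a fixed point of an isometric $G$-action for $g$ (respectively, for the metrics $g_\alpha$), where $G$ is a compact connected Lie group, then the metric $\tilde g$ (respectively, the metrics $\tilde g_\alpha$) can be chosen to be $G$-invariant.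
   Context: $\sec_{(M,g)}|_p\ge K$ means that all sectional curvatures of $(M,g)$ of planes in $T_pM$ are $\ge K$ (similarly for $>K$). A family of Riemannian metrics $\{g_\alpha\}_{\alpha=1}^\infty$ on a fixed manifold $M$ is almost non-negatively curved if there is $D>0$ such that $\mathrm{Diam}(M,g_\alpha)\le D$ and $\sec_{(M,g_\alpha)}\ge-\frac1\alpha$ for all $\alpha$. *)

theory Defs
  imports "HOL-Analysis.Analysis" "HOL-Algebra.Group_Action"
begin

section \<open>Smooth functions\<close>

primrec Ck_on :: "nat \<Rightarrow> 'a::real_normed_vector set \<Rightarrow> ('a \<Rightarrow> 'b::real_normed_vector) \<Rightarrow> bool" where
  "Ck_on 0 S f \<longleftrightarrow> continuous_on S f"
| "Ck_on (Suc k) S f \<longleftrightarrow> (\<forall>x\<in>S. f differentiable (at x)) \<and>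
     (\<forall>v. Ck_on k S (\<lambda>x. frechet_derivative f (at x) v))"

text \<open>Only used for open sets in finite-dimensional spaces, where it is the usual
  \<open>C\<^sup>\<infinity>\<close> condition.\<close>

definition smooth_on :: "'a::real_normed_vector set \<Rightarrow> ('a \<Rightarrow> 'b::real_normed_vector) \<Rightarrow> bool" where
  "smooth_on S f \<longleftrightarrow> (\<forall>k. Ck_on k S f)"


section \<open>Smooth manifolds\<close>

text \<open>A chart is a pair of its domain and its coordinate map. A smooth manifold (without boundary,
  not necessarily connected) is a topology together with a smooth atlas, which is not required to be
  maximal.\<close>

type_synonym ('m, 'e) chart = "'m set \<times> ('m \<Rightarrow> 'e)"

definition topological_chart :: "'m topology \<Rightarrow> ('m, 'e::real_normed_vector) chart \<Rightarrow> bool" where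
  "topological_chart X c \<longleftrightarrow> openin X (fst c) \<and> open (snd c ` fst c) \<and>
     homeomorphic_map (subtopology X (fst c)) (top_of_set (snd c ` fst c)) (snd c)"

definition coord_rep :: "('m, 'e) chart \<Rightarrow> ('n, 'f) chart \<Rightarrow> ('m \<Rightarrow> 'n) \<Rightarrow> 'e \<Rightarrow> 'f" where
  "coord_rep c d f = snd d \<circ> f \<circ> inv_into (fst c) (snd c)"

text \<open>The model space is a finite-dimensional normed space rather than a Euclidean space type so that
  dimension \<open>0\<close> is not excluded (the latter types have positive dimension); this matters for Lie
  groups.\<close>

definition smooth_manifold :: "'m topology \<Rightarrow> ('m, 'e::real_normed_vector) chart set \<Rightarrow> bool" where
  "smooth_manifold X A \<longleftrightarrow>
     Hausdorff_space X \<and> second_countable X \<and>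
     (\<exists>B::'e set. finite B \<and> span B = UNIV) \<and>
     (\<forall>c\<in>A. topological_chart X c) \<and> (\<Union>c\<in>A. fst c) = topspace X \<and>
     (\<forall>c\<in>A. \<forall>d\<in>A. smooth_on (snd c ` (fst c \<inter> fst d)) (coord_rep c d (\<lambda>x. x)))"

definition smooth_map ::
  "'m topology \<Rightarrow> ('m, 'e::real_normed_vector) chart set \<Rightarrow>
   'n topology \<Rightarrow> ('n, 'f::real_normed_vector) chart set \<Rightarrow> ('m \<Rightarrow> 'n) \<Rightarrow> bool" where
  "smooth_map X A Y B f \<longleftrightarrow> continuous_map X Y f \<and>
     (\<forall>c\<in>A. \<forall>d\<in>B. smooth_on (snd c ` {x \<in> fst c. f x \<in> fst d}) (coord_rep c d f))"

definition prod_atlas ::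
  "('m, 'e) chart set \<Rightarrow> ('n, 'f) chart set \<Rightarrow> ('m \<times> 'n, 'e \<times> 'f) chart set" where
  "prod_atlas A B = (\<lambda>(c, d). (fst c \<times> fst d, map_prod (snd c) (snd d))) ` (A \<times> B)"


section \<open>Riemannian metrics\<close>

text \<open>A symmetric 2-tensor field is given by its matrix of coefficients in each chart of the atlas,
  as a function of the coordinates. \<open>preserves_tensor A g f\<close> says \<open>f\<^sup>* g = g\<close>; for \<open>f = id\<close> this is
  the transformation law under changes of coordinates.\<close>

type_synonym ('m, 'n) tensor2 = "('m, real^'n) chart \<Rightarrow> real^'n \<Rightarrow> real^'n^'n"

definition preserves_tensor ::
  "('m, real^'n) chart set \<Rightarrow> ('m, 'n) tensor2 \<Rightarrow> ('m \<Rightarrow> 'm) \<Rightarrow> bool" where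
  "preserves_tensor A g f \<longleftrightarrow>
     (\<forall>c\<in>A. \<forall>d\<in>A. \<forall>p\<in>fst c. f p \<in> fst d \<longrightarrow>
        (let J = jacobian (coord_rep c d f) (at (snd c p))
         in g c (snd c p) = transpose J ** g d (snd d (f p)) ** J))"

definition riemannian_metric :: "('m, real^'n) chart set \<Rightarrow> ('m, 'n) tensor2 \<Rightarrow> bool" where
  "riemannian_metric A g \<longleftrightarrow>
     (\<forall>c\<in>A. smooth_on (snd c ` fst c) (g c)) \<and>
     (\<forall>c\<in>A. \<forall>x\<in>snd c ` fst c. transpose (g c x) = g c x \<and> (\<forall>v. v \<noteq> 0 \<longrightarrow> v \<bullet> (g c x *v v) > 0)) \<and>
     preserves_tensor A g (\<lambda>p. p)"


section \<open>Curvature\<close>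

text \<open>Here \<open>h\<close> is the coefficient matrix of a metric in one chart.\<close>

definition partial_deriv :: "'n \<Rightarrow> (real^'n \<Rightarrow> real) \<Rightarrow> real^'n \<Rightarrow> real" where
  "partial_deriv i f x = frechet_derivative f (at x) (axis i 1)"

text \<open>The coefficients \<open>\<Gamma>\<close> with \<open>\<nabla>\<^bsub>\<partial>i\<^esub> \<partial>\<^sub>j = (\<Sum>k. \<Gamma> k i j * \<partial>\<^sub>k)\<close>.\<close>

definition christoffel :: "(real^'n \<Rightarrow> real^'n^'n) \<Rightarrow> 'n \<Rightarrow> 'n \<Rightarrow> 'n \<Rightarrow> real^'n \<Rightarrow> real" where
  "christoffel h k i j x = (1/2) * (\<Sum>l\<in>UNIV. matrix_inv (h x) $ k $ l *
     (partial_deriv i (\<lambda>y. h y $ j $ l) x + partial_deriv j (\<lambda>y. h y $ i $ l) x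
      - partial_deriv l (\<lambda>y. h y $ i $ j) x))"

text \<open>The \<open>\<partial>\<^sub>l\<close>-component of \<open>R(\<partial>\<^sub>i, \<partial>\<^sub>j) \<partial>\<^sub>k\<close>, where
  \<open>R(U, V) W = \<nabla>\<^sub>U \<nabla>\<^sub>V W - \<nabla>\<^sub>V \<nabla>\<^sub>U W - \<nabla>\<^bsub>[U,V]\<^esub> W\<close>.\<close>

definition curvature_coeff ::
  "(real^'n \<Rightarrow> real^'n^'n) \<Rightarrow> 'n \<Rightarrow> 'n \<Rightarrow> 'n \<Rightarrow> 'n \<Rightarrow> real^'n \<Rightarrow> real" where
  "curvature_coeff h l i j k x =
     partial_deriv i (christoffel h l j k) x - partial_deriv j (christoffel h l i k) x
     + (\<Sum>m\<in>UNIV. christoffel h m j k x * christoffel h l i m x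
                 - christoffel h m i k x * christoffel h l j m x)"

definition curvature ::
  "(real^'n \<Rightarrow> real^'n^'n) \<Rightarrow> real^'n \<Rightarrow> real^'n \<Rightarrow> real^'n \<Rightarrow> real^'n \<Rightarrow> real^'n" where
  "curvature h x u v w =
     (\<chi> l. \<Sum>i\<in>UNIV. \<Sum>j\<in>UNIV. \<Sum>k\<in>UNIV. curvature_coeff h l i j k x * u $ i * v $ j * w $ k)"

definition metric_inner :: "(real^'n \<Rightarrow> real^'n^'n) \<Rightarrow> real^'n \<Rightarrow> real^'n \<Rightarrow> real^'n \<Rightarrow> real" where
  "metric_inner h x v w = v \<bullet> (h x *v w)"

definition sectional_curvature ::
  "(real^'n \<Rightarrow> real^'n^'n) \<Rightarrow> real^'n \<Rightarrow> real^'n \<Rightarrow> real^'n \<Rightarrow> real" where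
  "sectional_curvature h x v w =
     metric_inner h x (curvature h x v w w) v /
     (metric_inner h x v v * metric_inner h x w w - (metric_inner h x v w)\<^sup>2)"

text \<open>\<open>Ric(v, w)\<close> is the trace of \<open>u \<mapsto> R(u, v) w\<close>.\<close>

definition ricci :: "(real^'n \<Rightarrow> real^'n^'n) \<Rightarrow> real^'n \<Rightarrow> real^'n \<Rightarrow> real^'n \<Rightarrow> real" where
  "ricci h x v w = (\<Sum>i\<in>UNIV. curvature h x (axis i 1) v w $ i)"

definition ricci_ge :: "('m, real^'n) chart set \<Rightarrow> ('m, 'n) tensor2 \<Rightarrow> real \<Rightarrow> bool" where
  "ricci_ge A g k \<longleftrightarrow>
     (\<forall>c\<in>A. \<forall>x\<in>snd c ` fst c. \<forall>v. ricci (g c) x v v \<ge> k * metric_inner (g c) x v v)"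

definition sec_at_ge :: "('m, real^'n) chart set \<Rightarrow> ('m, 'n) tensor2 \<Rightarrow> 'm \<Rightarrow> real \<Rightarrow> bool" where
  "sec_at_ge A g p k \<longleftrightarrow>
     (\<forall>c\<in>A. p \<in> fst c \<longrightarrow> (\<forall>v w. v \<noteq> w \<and> independent {v, w} \<longrightarrow>
        sectional_curvature (g c) (snd c p) v w \<ge> k))"

definition sec_at_gt :: "('m, real^'n) chart set \<Rightarrow> ('m, 'n) tensor2 \<Rightarrow> 'm \<Rightarrow> real \<Rightarrow> bool" where
  "sec_at_gt A g p k \<longleftrightarrow>
     (\<forall>c\<in>A. p \<in> fst c \<longrightarrow> (\<forall>v w. v \<noteq> w \<and> independent {v, w} \<longrightarrow>
        sectional_curvature (g c) (snd c p) v w > k))"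


section \<open>Distance and diameter\<close>

text \<open>Piecewise \<open>C\<^sup>1\<close> curves on \<open>{0..1}\<close>: \<open>S\<close> is the set of break points, and one-sided derivatives
  are required to exist and be continuous up to the ends of each piece \<open>{a..b}\<close>.\<close>

definition piecewise_C1_curve ::
  "'m topology \<Rightarrow> ('m, real^'n) chart set \<Rightarrow> (real \<Rightarrow> 'm) \<Rightarrow> bool" where
  "piecewise_C1_curve X A \<gamma> \<longleftrightarrow> continuous_map (top_of_set {0..1}) X \<gamma> \<and>
     (\<exists>S. finite S \<and> {0, 1} \<subseteq> S \<and> S \<subseteq> {0..1} \<and>
        (\<forall>a\<in>S. \<forall>b\<in>S. a < b \<and> {a<..<b} \<inter> S = {} \<longrightarrow>
           (\<forall>c\<in>A. \<exists>D. continuous_on {t \<in> {a..b}. \<gamma> t \<in> fst c} D \<and>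
              (\<forall>t\<in>{a..b}. \<gamma> t \<in> fst c \<longrightarrow>
                 ((snd c \<circ> \<gamma>) has_vector_derivative D t) (at t within {a..b})))))"

text \<open>The value does not depend on the chosen chart when \<open>\<gamma>\<close> is differentiable at \<open>t\<close>; the finitely
  many other parameters do not affect the length.\<close>

definition speed ::
  "('m, real^'n) chart set \<Rightarrow> ('m, 'n) tensor2 \<Rightarrow> (real \<Rightarrow> 'm) \<Rightarrow> real \<Rightarrow> real" where
  "speed A g \<gamma> t =
     (let c = (SOME c. c \<in> A \<and> \<gamma> t \<in> fst c);
          v = vector_derivative (snd c \<circ> \<gamma>) (at t)
      in sqrt (metric_inner (g c) (snd c (\<gamma> t)) v v))"

definition curve_length ::
  "('m, real^'n) chart set \<Rightarrow> ('m, 'n) tensor2 \<Rightarrow> (real \<Rightarrow> 'm) \<Rightarrow> ennreal" where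
  "curve_length A g \<gamma> = (\<integral>\<^sup>+ t\<in>{0..1}. ennreal (speed A g \<gamma> t) \<partial>lborel)"

text \<open>Points in different components have distance \<open>\<infinity>\<close>.\<close>

definition riemannian_dist ::
  "'m topology \<Rightarrow> ('m, real^'n) chart set \<Rightarrow> ('m, 'n) tensor2 \<Rightarrow> 'm \<Rightarrow> 'm \<Rightarrow> ennreal" where
  "riemannian_dist X A g p q =
     (INF \<gamma>\<in>{\<gamma>. piecewise_C1_curve X A \<gamma> \<and> \<gamma> 0 = p \<and> \<gamma> 1 = q}. curve_length A g \<gamma>)"

definition riemannian_diam ::
  "'m topology \<Rightarrow> ('m, real^'n) chart set \<Rightarrow> ('m, 'n) tensor2 \<Rightarrow> ennreal" where
  "riemannian_diam X A g = (SUP p\<in>topspace X. SUP q\<in>topspace X. riemannian_dist X A g p q)"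

text \<open>Families are indexed by \<open>\<alpha> \<ge> 1\<close>; the value at \<open>0\<close> is irrelevant.\<close>

definition almost_nonneg_curved ::
  "'m topology \<Rightarrow> ('m, real^'n) chart set \<Rightarrow> (nat \<Rightarrow> ('m, 'n) tensor2) \<Rightarrow> bool" where
  "almost_nonneg_curved X A g \<longleftrightarrow>
     (\<forall>\<alpha>\<ge>1. riemannian_metric A (g \<alpha>)) \<and>
     (\<exists>D>0. \<forall>\<alpha>\<ge>1. riemannian_diam X A (g \<alpha>) \<le> ennreal D \<and>
        (\<forall>p\<in>topspace X. sec_at_ge A (g \<alpha>) p (- 1 / real \<alpha>)))"


section \<open>Lie groups and their actions\<close>

definition lie_group ::
  "('g, 'z) monoid_scheme \<Rightarrow> 'g topology \<Rightarrow> ('g, 'e::real_normed_vector) chart set \<Rightarrow> bool" where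
  "lie_group G Y B \<longleftrightarrow> Group.group G \<and> smooth_manifold Y B \<and> topspace Y = carrier G \<and>
     smooth_map (prod_topology Y Y) (prod_atlas B B) Y B (\<lambda>(a, b). a \<otimes>\<^bsub>G\<^esub> b) \<and>
     smooth_map Y B Y B (\<lambda>a. inv\<^bsub>G\<^esub> a)"

definition smooth_action ::
  "('g, 'z) monoid_scheme \<Rightarrow> 'g topology \<Rightarrow> ('g, 'e::real_normed_vector) chart set \<Rightarrow>
   'm topology \<Rightarrow> ('m, 'f::real_normed_vector) chart set \<Rightarrow> ('g \<Rightarrow> 'm \<Rightarrow> 'm) \<Rightarrow> bool" where
  "smooth_action G Y B X A \<phi> \<longleftrightarrow> group_action G (topspace X) \<phi> \<and>
     smooth_map (prod_topology Y X) (prod_atlas B A) X A (\<lambda>(a, x). \<phi> a x)"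

definition invariant_metric ::
  "('g, 'z) monoid_scheme \<Rightarrow> ('g \<Rightarrow> 'm \<Rightarrow> 'm) \<Rightarrow> ('m, real^'n) chart set \<Rightarrow> ('m, 'n) tensor2 \<Rightarrow> bool"
  where "invariant_metric G \<phi> A g \<longleftrightarrow> (\<forall>a\<in>carrier G. preserves_tensor A g (\<phi> a))"

end

theory Submission
  imports Defs "HOL-Real_Asymp.Real_Asymp"
begin

text \<open>The metric is changed conformally near \<open>p\<close>, to \<open>exp (2 * f) g\<close> with \<open>f = F \<circ> Q\<close>, where \<open>Q\<close> behaves
  like the squared distance from \<open>p\<close>. Up to terms of first order, the curvature of the new metric
  is that of \<open>g\<close> minus the Kulkarni-Nomizu product of \<open>g\<close> with the Hessian of \<open>f\<close>. The profile \<open>F\<close>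
  is a small multiple of a truncated logarithm: then \<open>f\<close> and its gradient are small and its Hessian is
  almost nonpositive everywhere, so that lower curvature bounds and the diameter are almost preserved,
  while the Hessian at \<open>p\<close> is as negative as desired. If a compact group \<open>G\<close> of isometries fixes \<open>p\<close>,
  averaging a bump function over \<open>G\<close> makes \<open>Q\<close> invariant; its Hessian at \<open>p\<close> remains \<open>2 g\<close>, as \<open>G\<close>
  acts on the tangent space at \<open>p\<close> by isometries.\<close>

section \<open>Smooth calculus\<close>

text \<open>The obstacle is the second-order term. With \<open>y = - F'\<close> the Hessian of
  \<open>F \<circ> Q\<close> is \<open>- y' dQ dQ - y Hess Q\<close>. The second summand has the
  good sign near \<open>p\<close>, where the Hessian of \<open>Q\<close> is positive, but
  \<open>y\<close> has to fall from a large value at 0 to 0 on a small interval, so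
  \<open>- y'\<close> is large somewhere. Since the squared length of the gradient of
  \<open>Q\<close> is at most \<open>C * Q\<close>, only \<open>- s * y' s\<close> must be small,
  and a drop spread evenly over the scale of \<open>ln s\<close> achieves this for every prescribed
  starting value; the logarithm thus enters through \<open>y\<close>. The neighbourhood where these
  estimates hold is chosen before the profile, so the support can be shrunk into it afterwards. The
  constants may depend on the metric: each member of a family is deformed separately, and no
  estimate uniform in the family is required. The average over the group is a limit of averages over
  finitely many translates, for which sup-norm estimates suffice to differentiate under the
  mean.\<close>

abbreviation fd :: "('a::real_normed_vector \<Rightarrow> 'b::real_normed_vector) \<Rightarrow> 'a \<Rightarrow> 'a \<Rightarrow> 'b" where
  "fd f x v \<equiv> frechet_derivative f (at x) v"

lemma fd_eq: "(f has_derivative f') (at x) \<Longrightarrow> fd f x v = f' v"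
  using frechet_derivative_at by metis

lemma differentiable_fd:
  "f differentiable (at x) \<Longrightarrow> (f has_derivative (\<lambda>v. fd f x v)) (at x)"
  using frechet_derivative_works by fastforce

lemma Ck_on_cong:
  assumes "open S" "\<And>x. x \<in> S \<Longrightarrow> f x = g x" "Ck_on k S f"
  shows "Ck_on k S g"
  using assms(2,3)
proof (induction k arbitrary: f g)
  case 0
  then show ?case by (metis (no_types, lifting) Ck_on.simps(1) continuous_on_cong)
next
  case (Suc k)
  have *: "(g has_derivative (\<lambda>v. fd f x v)) (at x)" if "x \<in> S" for x
    using has_derivative_transform_within_open[OF differentiable_fd \<open>open S\<close> that Suc.prems(1)] that Suc.prems(2)
    by auto
  have "Ck_on k S (\<lambda>x. fd g x v)" for v
    by (rule Suc.IH[of "\<lambda>x. fd f x v"]) (use Suc.prems fd_eq[OF *] in auto)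
  then show ?case using * by (auto simp: differentiable_def)
qed

lemma Ck_on_Suc_has_derivativeI:
  assumes "open S" "\<And>x. x \<in> S \<Longrightarrow> (f has_derivative f' x) (at x)" "\<And>v. Ck_on k S (\<lambda>x. f' x v)"
  shows "Ck_on (Suc k) S f"
proof -
  have "Ck_on k S (\<lambda>x. fd f x v)" for v
    by (rule Ck_on_cong[OF assms(1) _ assms(3)[of v]]) (simp add: fd_eq[OF assms(2)])
  then show ?thesis using assms(2) by (auto simp: differentiable_def)
qed

lemma Ck_on_SucD: "Ck_on (Suc k) S f \<Longrightarrow> Ck_on k S f"
proof (induction k arbitrary: f)
  case 0
  then show ?case
    by (auto intro!: continuous_at_imp_continuous_on differentiable_imp_continuous_within)
next
  case (Suc k)
  then show ?case by (metis Ck_on.simps(2))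
qed

lemma Ck_on_le: "Ck_on k S f \<Longrightarrow> j \<le> k \<Longrightarrow> Ck_on j S f"
  by (induction k) (use Ck_on_SucD le_Suc_eq in blast)+

lemma Ck_on_subset: "Ck_on k S f \<Longrightarrow> T \<subseteq> S \<Longrightarrow> Ck_on k T f"
  by (induction k arbitrary: f) (auto intro: continuous_on_subset)

lemma Ck_on_local:
  assumes "\<And>x. x \<in> S \<Longrightarrow> \<exists>T. open T \<and> x \<in> T \<and> Ck_on k T f"
  shows "Ck_on k S f"
  using assms
proof (induction k arbitrary: f)
  case 0
  show ?case
    unfolding Ck_on.simps
    by (rule continuous_at_imp_continuous_on) (metis "0" Ck_on.simps(1) continuous_on_eq_continuous_at)
next
  case (Suc k)
  have "f differentiable (at x)" if "x \<in> S" for x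
    using Suc.prems[OF that] by auto
  moreover have "Ck_on k S (\<lambda>x. fd f x v)" for v
    by (rule Suc.IH) (use Suc.prems in fastforce)
  ultimately show ?case by simp
qed

lemma Ck_on_const [simp]: "Ck_on k S (\<lambda>x. c)"
  by (induction k arbitrary: c) auto

lemma Ck_on_bounded_linear:
  assumes "bounded_linear L" shows "Ck_on k S L"
proof (cases k)
  case 0
  then show ?thesis using assms linear_continuous_on by auto
next
  case (Suc j)
  have "(L has_derivative L) (at x)" for x
    using assms bounded_linear_imp_has_derivative by blast
  then have "fd L x v = L v" for x v by (simp add: fd_eq)
  then show ?thesis using Suc \<open>\<And>x. (L has_derivative L) (at x)\<close> by (auto simp: differentiable_def)
qed

lemma Ck_on_linear_compose:
  assumes "bounded_linear L" "open S" "Ck_on k S f"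
  shows "Ck_on k S (\<lambda>x. L (f x))"
  using assms(3)
proof (induction k arbitrary: f)
  case 0
  then show ?case using assms(1) bounded_linear.continuous_on by fastforce
next
  case (Suc k)
  show ?case
    by (rule Ck_on_Suc_has_derivativeI[where f'="\<lambda>x v. L (fd f x v)"])
      (use Suc assms in \<open>auto intro!: bounded_linear.has_derivative[OF assms(1)] differentiable_fd\<close>)
qed

lemma Ck_on_add:
  assumes "open S" "Ck_on k S f" "Ck_on k S g"
  shows "Ck_on k S (\<lambda>x. f x + g x)"
  using assms(2,3)
proof (induction k arbitrary: f g)
  case 0
  then show ?case by (simp add: continuous_on_add)
next
  case (Suc k)
  show ?case
    by (rule Ck_on_Suc_has_derivativeI[where f'="\<lambda>x v. fd f x v + fd g x v"])
      (use Suc assms in \<open>auto intro!: has_derivative_add differentiable_fd\<close>)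
qed

lemma Ck_on_sum:
  assumes "open S" "\<And>i. i \<in> I \<Longrightarrow> Ck_on k S (f i)"
  shows "Ck_on k S (\<lambda>x. \<Sum>i\<in>I. f i x)"
  using assms(2) by (induction I rule: infinite_finite_induct) (auto intro!: Ck_on_add assms(1))

lemma Ck_on_bilinear:
  assumes "bounded_bilinear B" "open S" "Ck_on k S f" "Ck_on k S g"
  shows "Ck_on k S (\<lambda>x. B (f x) (g x))"
  using assms(3,4)
proof (induction k arbitrary: f g)
  case 0
  then show ?case using bounded_bilinear.continuous_on[OF assms(1)] by auto
next
  case (Suc k)
  show ?case
  proof (rule Ck_on_Suc_has_derivativeI[where f'="\<lambda>x v. B (f x) (fd g x v) + B (fd f x v) (g x)"])
    show "((\<lambda>x. B (f x) (g x)) has_derivative (\<lambda>v. B (f x) (fd g x v) + B (fd f x v) (g x))) (at x)"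
      if "x \<in> S" for x
      using Suc.prems that by (auto intro!: bounded_bilinear.FDERIV[OF assms(1)] differentiable_fd)
    show "Ck_on k S (\<lambda>x. B (f x) (fd g x v) + B (fd f x v) (g x))" for v
      using Suc.prems Ck_on_SucD[OF Suc.prems(1)] Ck_on_SucD[OF Suc.prems(2)]
      by (intro Ck_on_add Suc.IH assms) auto
  qed (fact assms)
qed

text \<open>\<open>Ck_on\<close> records derivatives along fixed directions, whereas the chain rule
  differentiates \<open>g\<close> along \<open>fd f x v\<close>, which varies with \<open>x\<close>.
  Expanding that direction over \<open>Basis\<close> leaves only products of functions covered by
  the induction.\<close>

lemma Ck_on_compose:
  fixes g :: "'b::euclidean_space \<Rightarrow> 'c::real_normed_vector"
  assumes "open S" "open T" "f ` S \<subseteq> T" "Ck_on k T g" "Ck_on k S f"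
  shows "Ck_on k S (\<lambda>x. g (f x))"
  using assms(4,5)
proof (induction k arbitrary: g)
  case 0
  then show ?case using assms(3) continuous_on_compose2 by auto
next
  case (Suc k)
  show ?case
  proof (rule Ck_on_Suc_has_derivativeI
      [where f'="\<lambda>x v. \<Sum>b\<in>Basis. (fd f x v \<bullet> b) *\<^sub>R fd g (f x) b"])
    fix x assume x: "x \<in> S"
    have g: "(g has_derivative (\<lambda>v. fd g (f x) v)) (at (f x))"
      using Suc.prems assms(3) x by (intro differentiable_fd) auto
    have "((\<lambda>x. g (f x)) has_derivative (\<lambda>v. fd g (f x) (fd f x v))) (at x)"
      using Suc.prems x by (intro has_derivative_compose[where f=f and g=g, OF _ g] differentiable_fd) auto
    moreover have "fd g (f x) w = (\<Sum>b\<in>Basis. (w \<bullet> b) *\<^sub>R fd g (f x) b)" for w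
      using linear_sum[OF has_derivative_linear[OF g], of "\<lambda>b. (w \<bullet> b) *\<^sub>R b" Basis]
      by (simp add: euclidean_representation linear_scale[OF has_derivative_linear[OF g]])
    then have "(\<lambda>v. fd g (f x) (fd f x v)) = (\<lambda>v. \<Sum>b\<in>Basis. (fd f x v \<bullet> b) *\<^sub>R fd g (f x) b)"
      by (intro ext)
    ultimately show "((\<lambda>x. g (f x)) has_derivative
        (\<lambda>v. \<Sum>b\<in>Basis. (fd f x v \<bullet> b) *\<^sub>R fd g (f x) b)) (at x)"
      by (rule subst[rotated])
  next
    fix v
    have "Ck_on k S (\<lambda>x. fd f x v \<bullet> b)" for b
      using Suc.prems by (intro Ck_on_linear_compose[OF bounded_linear_inner_left] assms) auto
    moreover have "Ck_on k S (\<lambda>x. fd g (f x) b)" for b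
      using Suc.prems Ck_on_SucD by (intro Suc.IH) auto
    ultimately show "Ck_on k S (\<lambda>x. \<Sum>b\<in>Basis. (fd f x v \<bullet> b) *\<^sub>R fd g (f x) b)"
      by (intro Ck_on_sum Ck_on_bilinear[OF bounded_bilinear_scaleR] assms)
  qed (fact assms)
qed

lemma smooth_onD: "smooth_on S f \<Longrightarrow> Ck_on k S f"
  by (simp add: smooth_on_def)

lemma smooth_on_differentiable: "smooth_on S f \<Longrightarrow> x \<in> S \<Longrightarrow> f differentiable (at x)"
  using smooth_onD[of S f 1] by simp

lemma smooth_on_has_derivative:
  "smooth_on S f \<Longrightarrow> x \<in> S \<Longrightarrow> (f has_derivative (\<lambda>v. fd f x v)) (at x)"
  using differentiable_fd smooth_on_differentiable by blast

lemma smooth_on_fd: "smooth_on S f \<Longrightarrow> smooth_on S (\<lambda>x. fd f x v)"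
  unfolding smooth_on_def using Ck_on.simps(2) by blast

lemma smooth_on_continuous: "smooth_on S f \<Longrightarrow> continuous_on S f"
  using smooth_onD[of S f 0] by simp

lemma smooth_on_cong:
  "open S \<Longrightarrow> (\<And>x. x \<in> S \<Longrightarrow> f x = g x) \<Longrightarrow> smooth_on S f \<Longrightarrow> smooth_on S g"
  unfolding smooth_on_def using Ck_on_cong by blast

lemma smooth_on_subset: "smooth_on S f \<Longrightarrow> T \<subseteq> S \<Longrightarrow> smooth_on T f"
  unfolding smooth_on_def using Ck_on_subset by blast

lemma smooth_on_local:
  "(\<And>x. x \<in> S \<Longrightarrow> \<exists>T. open T \<and> x \<in> T \<and> smooth_on T f) \<Longrightarrow> smooth_on S f"
  unfolding smooth_on_def by (intro allI Ck_on_local) blast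

lemma smooth_on_const [simp]: "smooth_on S (\<lambda>x. c)"
  by (simp add: smooth_on_def)

lemma smooth_on_bounded_linear: "bounded_linear L \<Longrightarrow> smooth_on S L"
  by (simp add: smooth_on_def Ck_on_bounded_linear)

lemma smooth_on_ident [simp]: "smooth_on S (\<lambda>x. x)"
  by (simp add: smooth_on_bounded_linear bounded_linear_ident)

lemma smooth_on_linear_compose:
  "bounded_linear L \<Longrightarrow> open S \<Longrightarrow> smooth_on S f \<Longrightarrow> smooth_on S (\<lambda>x. L (f x))"
  by (simp add: smooth_on_def Ck_on_linear_compose)

lemma smooth_on_add:
  "open S \<Longrightarrow> smooth_on S f \<Longrightarrow> smooth_on S g \<Longrightarrow> smooth_on S (\<lambda>x. f x + g x)"
  by (simp add: smooth_on_def Ck_on_add)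

lemma smooth_on_uminus: "open S \<Longrightarrow> smooth_on S f \<Longrightarrow> smooth_on S (\<lambda>x. - f x)"
  by (rule smooth_on_linear_compose[OF bounded_linear_minus[OF bounded_linear_ident]])

lemma smooth_on_diff:
  "open S \<Longrightarrow> smooth_on S f \<Longrightarrow> smooth_on S g \<Longrightarrow> smooth_on S (\<lambda>x. f x - g x)"
  using smooth_on_add[OF _ _ smooth_on_uminus, of S f g] by simp

lemma smooth_on_sum:
  "open S \<Longrightarrow> (\<And>i. i \<in> I \<Longrightarrow> smooth_on S (f i)) \<Longrightarrow> smooth_on S (\<lambda>x. \<Sum>i\<in>I. f i x)"
  by (simp add: smooth_on_def Ck_on_sum)

lemma smooth_on_bilinear:
  "bounded_bilinear B \<Longrightarrow> open S \<Longrightarrow> smooth_on S f \<Longrightarrow> smooth_on S g \<Longrightarrow>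
    smooth_on S (\<lambda>x. B (f x) (g x))"
  by (simp add: smooth_on_def Ck_on_bilinear)

lemmas smooth_on_mult = smooth_on_bilinear[OF bounded_bilinear_mult]
  and smooth_on_scaleR = smooth_on_bilinear[OF bounded_bilinear_scaleR]
  and smooth_on_inner = smooth_on_bilinear[OF bounded_bilinear_inner]

lemma smooth_on_prod:
  fixes f :: "'i \<Rightarrow> 'a::real_normed_vector \<Rightarrow> real"
  shows "open S \<Longrightarrow> (\<And>i. i \<in> I \<Longrightarrow> smooth_on S (f i)) \<Longrightarrow> smooth_on S (\<lambda>x. \<Prod>i\<in>I. f i x)"
  by (induction I rule: infinite_finite_induct) (auto intro!: smooth_on_mult)

lemma smooth_on_compose:
  fixes g :: "'b::euclidean_space \<Rightarrow> 'c::real_normed_vector"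
  shows "open S \<Longrightarrow> open T \<Longrightarrow> f ` S \<subseteq> T \<Longrightarrow> smooth_on T g \<Longrightarrow> smooth_on S f \<Longrightarrow>
    smooth_on S (\<lambda>x. g (f x))"
  unfolding smooth_on_def using Ck_on_compose by blast

lemma smooth_on_nth:
  fixes f :: "'a::real_normed_vector \<Rightarrow> 'b::real_normed_vector^'n"
  shows "open S \<Longrightarrow> smooth_on S f \<Longrightarrow> smooth_on S (\<lambda>x. f x $ i)"
  by (rule smooth_on_linear_compose[OF bounded_linear_vec_nth])

lemma smooth_on_vecI:
  fixes f :: "'a::real_normed_vector \<Rightarrow> 'b::euclidean_space^'n"
  assumes "open S" "\<And>i. smooth_on S (\<lambda>x. f x $ i)"
  shows "smooth_on S f"
proof -
  have lin: "bounded_linear (\<lambda>z. axis i z :: 'b^'n)" for i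
    unfolding linear_conv_bounded_linear[symmetric]
    by (rule linearI) (auto simp: axis_def vec_eq_iff)
  have "f x = (\<Sum>i\<in>UNIV. axis i (f x $ i))" for x
    by (simp add: vec_eq_iff axis_def)
  moreover have "smooth_on S (\<lambda>x. \<Sum>i\<in>UNIV. axis i (f x $ i))"
    by (intro smooth_on_sum smooth_on_linear_compose[OF lin] assms)
  ultimately show ?thesis by presburger
qed

text \<open>In a family closed under differentiation, up to linear combinations with constant
  coefficients, all members gain one order of differentiability at once in each induction step. The
  exponential, the powers of \<open>inverse\<close> and the functions \<open>flat_exp k\<close> form
  such families.\<close>

lemma smooth_on_derivative_system:
  fixes f :: "'i \<Rightarrow> real \<Rightarrow> real"
  assumes "open S"
    and "\<And>i x. x \<in> S \<Longrightarrow> (f i has_real_derivative (\<Sum>j\<in>J i. c i j * f j x)) (at x)"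
  shows "smooth_on S (f i)"
  unfolding smooth_on_def
proof
  fix k show "Ck_on k S (f i)"
  proof (induction k arbitrary: i)
    case 0
    then show ?case
      by (auto intro!: continuous_at_imp_continuous_on DERIV_isCont assms(2))
  next
    case (Suc k)
    show ?case
    proof (rule Ck_on_Suc_has_derivativeI[where f'="\<lambda>x v. (\<Sum>j\<in>J i. c i j * f j x) * v"])
      show "(f i has_derivative (\<lambda>v. (\<Sum>j\<in>J i. c i j * f j x) * v)) (at x)" if "x \<in> S" for x
        using assms(2)[OF that, of i] by (simp add: has_field_derivative_def)
      show "Ck_on k S (\<lambda>x. (\<Sum>j\<in>J i. c i j * f j x) * v)" for v
        by (intro Ck_on_linear_compose[OF bounded_linear_mult_left] Ck_on_sum assms(1)
            Ck_on_linear_compose[OF bounded_linear_mult_right] Suc.IH)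
    qed (fact assms)
  qed
qed

lemma smooth_on_antiderivative:
  fixes f :: "real \<Rightarrow> real"
  assumes "open S" "\<And>x. x \<in> S \<Longrightarrow> (f has_real_derivative f' x) (at x)" "smooth_on S f'"
  shows "smooth_on S f"
proof -
  have "Ck_on (Suc k) S f" for k
  proof (rule Ck_on_Suc_has_derivativeI[where f'="\<lambda>x v. f' x * v"])
    show "(f has_derivative (\<lambda>v. f' x * v)) (at x)" if "x \<in> S" for x
      using assms(2)[OF that] by (simp add: has_field_derivative_def)
    show "Ck_on k S (\<lambda>x. f' x * v)" for v
      by (intro Ck_on_linear_compose[OF bounded_linear_mult_left] smooth_onD assms)
  qed (fact assms)
  then show ?thesis unfolding smooth_on_def using Ck_on_SucD by blast
qed

lemma smooth_on_exp: "smooth_on S (exp :: real \<Rightarrow> real)"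
proof -
  have "smooth_on UNIV ((\<lambda>_::unit. exp) () :: real \<Rightarrow> real)"
    by (rule smooth_on_derivative_system[where J="\<lambda>_. {()}" and c="\<lambda>_ _. 1"])
      (auto intro!: derivative_eq_intros)
  then show ?thesis using smooth_on_subset by blast
qed

lemma smooth_on_inverse: "smooth_on {x::real. x \<noteq> 0} inverse"
proof -
  have op: "open {x::real. x \<noteq> 0}" by (simp add: open_Collect_neq)
  have "smooth_on {x::real. x \<noteq> 0} ((\<lambda>k x. inverse x ^ Suc k) 0)"
  proof (rule smooth_on_derivative_system[OF op,
        where f="\<lambda>k x. inverse x ^ Suc k" and J="\<lambda>k. {Suc k}" and c="\<lambda>k _. - real (Suc k)"])
    fix k :: nat and x :: real assume "x \<in> {x. x \<noteq> 0}"
    then have x: "x \<noteq> 0" by simp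
    show "((\<lambda>x. inverse x ^ Suc k) has_real_derivative
        (\<Sum>j\<in>{Suc k}. - real (Suc k) * inverse x ^ Suc j)) (at x)"
      by (rule derivative_eq_intros refl x)+ (use x in \<open>auto simp: field_simps\<close>)
  qed
  then show ?thesis by simp
qed

lemma smooth_on_divide:
  fixes f g :: "'a::real_normed_vector \<Rightarrow> real"
  assumes "open S" "smooth_on S f" "smooth_on S g" "\<And>x. x \<in> S \<Longrightarrow> g x \<noteq> 0"
  shows "smooth_on S (\<lambda>x. f x / g x)"
  unfolding divide_inverse
  using assms by (intro smooth_on_mult smooth_on_compose[OF _ _ _ smooth_on_inverse])
    (auto simp: open_Collect_neq)

lemma smooth_on_ln: "smooth_on {0<..} (ln :: real \<Rightarrow> real)"
  by (rule smooth_on_antiderivative[where f'="\<lambda>x. 1 / x"])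
    (auto intro!: derivative_eq_intros smooth_on_divide)

lemma smooth_on_det:
  fixes f :: "'a::real_normed_vector \<Rightarrow> real^'n^'n"
  assumes "open S" "smooth_on S f"
  shows "smooth_on S (\<lambda>x. det (f x))"
  unfolding det_def
  by (intro smooth_on_sum smooth_on_mult smooth_on_prod smooth_on_nth smooth_on_const assms)

lemma matrix_inv_right:
  fixes M :: "real^'n^'n"
  assumes "det M \<noteq> 0"
  shows "M ** matrix_inv M = mat 1"
proof -
  have "\<exists>M'. M ** M' = mat 1 \<and> M' ** M = mat 1"
    using assms invertible_def invertible_det_nz by blast
  then show ?thesis unfolding matrix_inv_def by (rule someI2_ex) simp
qed

text \<open>Cramer's rule exhibits the inverse as a quotient of determinants, hence as smooth in the
  entries.\<close>

lemma matrix_inv_cramer: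
  fixes M :: "real^'n^'n"
  assumes "det M \<noteq> 0"
  shows "matrix_inv M *v b = (\<chi> k. det (\<chi> i j. if j = k then b $ i else M $ i $ j) / det M)"
proof -
  have "M *v (matrix_inv M *v b) = b"
    using assms by (simp add: matrix_vector_mul_assoc matrix_inv_right)
  then show ?thesis using cramer[OF assms] by blast
qed

lemma smooth_on_matrix_inv:
  fixes f :: "'a::real_normed_vector \<Rightarrow> real^'n^'n"
  assumes "open S" "smooth_on S f" "smooth_on S b" "\<And>x. x \<in> S \<Longrightarrow> det (f x) \<noteq> 0"
  shows "smooth_on S (\<lambda>x. matrix_inv (f x) *v b x)"
proof (rule smooth_on_cong[OF assms(1)])
  show "(\<chi> k. det (\<chi> i j. if j = k then b x $ i else f x $ i $ j) / det (f x))
      = matrix_inv (f x) *v b x" if "x \<in> S" for x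
    by (rule matrix_inv_cramer[OF assms(4)[OF that], symmetric])
  have *: "smooth_on S (\<lambda>x. (if j = k then b x $ i else f x $ i $ j))" for i j k
    by (cases "j = k") (auto intro!: smooth_on_nth assms)
  have "smooth_on S (\<lambda>x. det (\<chi> i j. if j = k then b x $ i else f x $ i $ j))" for k
    by (intro smooth_on_det assms(1) smooth_on_vecI) (simp add: *)
  then show "smooth_on S (\<lambda>x. \<chi> k. det (\<chi> i j. if j = k then b x $ i else f x $ i $ j) / det (f x))"
    by (intro smooth_on_vecI assms(1)) (simp add: smooth_on_divide smooth_on_det assms)
qed

lemma smooth_on_matrix_vector_mult:
  fixes f :: "'a::real_normed_vector \<Rightarrow> real^'n^'m"
  assumes "open S" "smooth_on S f" "smooth_on S b"
  shows "smooth_on S (\<lambda>x. f x *v b x)"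
  by (intro smooth_on_vecI assms(1))
    (simp add: matrix_vector_mul_component, intro smooth_on_inner smooth_on_nth assms)

section \<open>Symmetry of second derivatives\<close>

lemma DERIV_along_line:
  fixes g :: "'a::real_normed_vector \<Rightarrow> real"
  assumes "(g has_derivative (\<lambda>z. fd g (y + r *\<^sub>R w) z)) (at (y + r *\<^sub>R w))"
  shows "((\<lambda>r. g (y + r *\<^sub>R w)) has_real_derivative fd g (y + r *\<^sub>R w) w) (at r)"
proof -
  have "((\<lambda>r. y + r *\<^sub>R w) has_derivative (\<lambda>r'. r' *\<^sub>R w)) (at r)"
    by (auto intro!: derivative_eq_intros)
  from diff_chain_at[OF this assms]
  have "((\<lambda>r. g (y + r *\<^sub>R w)) has_derivative (\<lambda>r'. fd g (y + r *\<^sub>R w) (r' *\<^sub>R w))) (at r)"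
    by (simp add: o_def)
  moreover have "(\<lambda>r'. fd g (y + r *\<^sub>R w) (r' *\<^sub>R w)) = (*) (fd g (y + r *\<^sub>R w) w)"
    using linear_scale[OF has_derivative_linear[OF assms]] by (auto simp: mult.commute)
  ultimately show ?thesis by (simp add: has_field_derivative_def)
qed

text \<open>The mean value theorem is applied twice, along \<open>u\<close> and then along
  \<open>v\<close>. The second difference is symmetric in \<open>u\<close> and \<open>v\<close>, and
  for small \<open>h\<close> this symmetry passes to the second derivatives.\<close>

lemma mixed_difference_MVT:
  fixes f :: "'a::real_normed_vector \<Rightarrow> real"
  assumes "Ck_on 2 S f" "h > 0" "\<And>s t. 0 \<le> s \<Longrightarrow> s \<le> h \<Longrightarrow> 0 \<le> t \<Longrightarrow> t \<le> h \<Longrightarrow> x + s *\<^sub>R u + t *\<^sub>R v \<in> S"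
  shows "\<exists>s t. 0 \<le> s \<and> s \<le> h \<and> 0 \<le> t \<and> t \<le> h \<and>
    f (x + h *\<^sub>R u + h *\<^sub>R v) - f (x + h *\<^sub>R u) - f (x + h *\<^sub>R v) + f x
      = h * h * fd (\<lambda>y. fd f y u) (x + s *\<^sub>R u + t *\<^sub>R v) v"
proof -
  have 1: "(f has_derivative (\<lambda>w. fd f y w)) (at y)" if "y \<in> S" for y
    using assms(1) that by (intro differentiable_fd) (simp add: numeral_2_eq_2)
  have 2: "((\<lambda>y. fd f y u) has_derivative (\<lambda>w. fd (\<lambda>y. fd f y u) y w)) (at y)" if "y \<in> S" for y
    using assms(1) that by (intro differentiable_fd) (simp add: numeral_2_eq_2)
  have d1: "((\<lambda>s. f (x + s *\<^sub>R u + t *\<^sub>R v)) has_real_derivative fd f (x + s *\<^sub>R u + t *\<^sub>R v) u) (at s)"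
    if "0 \<le> s" "s \<le> h" "0 \<le> t" "t \<le> h" for s t
    using DERIV_along_line[where g=f and y="x + t *\<^sub>R v" and r=s and w=u] 1[OF assms(3)[OF that]]
    by (simp add: algebra_simps)
  have d2: "((\<lambda>t. fd f (x + s *\<^sub>R u + t *\<^sub>R v) u) has_real_derivative
      fd (\<lambda>y. fd f y u) (x + s *\<^sub>R u + t *\<^sub>R v) v) (at t)"
    if "0 \<le> s" "s \<le> h" "0 \<le> t" "t \<le> h" for s t
    using DERIV_along_line[where g="\<lambda>y. fd f y u" and y="x + s *\<^sub>R u" and r=t and w=v] 2[OF assms(3)[OF that]]
    by simp
  have "\<exists>s>0. s < h \<and> (f (x + h *\<^sub>R u + h *\<^sub>R v) - f (x + h *\<^sub>R u + 0 *\<^sub>R v))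
      - (f (x + 0 *\<^sub>R u + h *\<^sub>R v) - f (x + 0 *\<^sub>R u + 0 *\<^sub>R v))
      = (h - 0) * (fd f (x + s *\<^sub>R u + h *\<^sub>R v) u - fd f (x + s *\<^sub>R u + 0 *\<^sub>R v) u)"
    by (rule MVT2[where f="\<lambda>s. f (x + s *\<^sub>R u + h *\<^sub>R v) - f (x + s *\<^sub>R u + 0 *\<^sub>R v)"])
      (use \<open>h > 0\<close> in \<open>auto simp del: scaleR_zero_left intro!: DERIV_diff d1\<close>)
  then obtain s where s: "0 < s" "s < h" "f (x + h *\<^sub>R u + h *\<^sub>R v) - f (x + h *\<^sub>R u) - f (x + h *\<^sub>R v) + f x
      = h * (fd f (x + s *\<^sub>R u + h *\<^sub>R v) u - fd f (x + s *\<^sub>R u + 0 *\<^sub>R v) u)"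
    by auto
  have "\<exists>t>0. t < h \<and> fd f (x + s *\<^sub>R u + h *\<^sub>R v) u - fd f (x + s *\<^sub>R u + 0 *\<^sub>R v) u
      = (h - 0) * fd (\<lambda>y. fd f y u) (x + s *\<^sub>R u + t *\<^sub>R v) v"
    by (rule MVT2[where f="\<lambda>t. fd f (x + s *\<^sub>R u + t *\<^sub>R v) u"]) (use \<open>h > 0\<close> s in \<open>auto intro!: d2\<close>)
  then obtain t where "0 < t" "t < h" "fd f (x + s *\<^sub>R u + h *\<^sub>R v) u - fd f (x + s *\<^sub>R u + 0 *\<^sub>R v) u
      = h * fd (\<lambda>y. fd f y u) (x + s *\<^sub>R u + t *\<^sub>R v) v" by auto
  with s show ?thesis by (intro exI[of _ s] exI[of _ t]) (simp add: mult.assoc)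
qed

lemma fd_commute_real:
  fixes f :: "'a::real_normed_vector \<Rightarrow> real"
  assumes "open S" "Ck_on 2 S f" "x \<in> S"
  shows "fd (\<lambda>y. fd f y u) x v = fd (\<lambda>y. fd f y v) x u"
proof (rule ccontr)
  assume ne: "\<not> ?thesis"
  define e where "e = \<bar>fd (\<lambda>y. fd f y u) x v - fd (\<lambda>y. fd f y v) x u\<bar> / 2"
  have "e > 0" using ne by (simp add: e_def)
  have c: "continuous_on S (\<lambda>y. fd (\<lambda>y. fd f y u) y v)" for u v
    using assms(2) by (simp add: numeral_2_eq_2)
  have nb: "\<exists>d>0. ball x d \<subseteq> S \<and> (\<forall>y\<in>ball x d. \<bar>fd (\<lambda>y. fd f y u) y v - fd (\<lambda>y. fd f y u) x v\<bar> < e)"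
    for u v
  proof -
    have "isCont (\<lambda>y. fd (\<lambda>y. fd f y u) y v) x"
      using c continuous_on_eq_continuous_at assms by blast
    then obtain d where "d > 0" "\<And>y. dist x y < d \<Longrightarrow> \<bar>fd (\<lambda>y. fd f y u) y v - fd (\<lambda>y. fd f y u) x v\<bar> < e"
      using \<open>e > 0\<close> unfolding continuous_at_eps_delta dist_real_def by (metis dist_commute)
    moreover obtain d' where "d' > 0" "ball x d' \<subseteq> S"
      using assms open_contains_ball by blast
    ultimately show ?thesis
      by (intro exI[of _ "min d d'"]) (auto simp: subset_eq)
  qed
  obtain d where d: "d > 0" "ball x d \<subseteq> S"
      "\<And>y. y \<in> ball x d \<Longrightarrow> \<bar>fd (\<lambda>y. fd f y u) y v - fd (\<lambda>y. fd f y u) x v\<bar> < e"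
    using nb by blast
  obtain d' where d': "d' > 0" "ball x d' \<subseteq> S"
      "\<And>y. y \<in> ball x d' \<Longrightarrow> \<bar>fd (\<lambda>y. fd f y v) y u - fd (\<lambda>y. fd f y v) x u\<bar> < e"
    using nb by blast
  define r where "r = min d d'"
  define m where "m = norm u + norm v + 1"
  have "m > 0" by (simp add: m_def add_nonneg_pos)
  \<comment> \<open>This keeps the parallelogram with sides \<open>h *\<^sub>R u\<close> and
    \<open>h *\<^sub>R v\<close> within distance \<open>r / 2\<close> of \<open>x\<close>; the
    summand 1 in \<open>m\<close> covers \<open>u = v = 0\<close>.\<close>
  define h where "h = r / (2 * m)"
  have "r > 0" using d d' by (simp add: r_def)
  then have "h > 0" using \<open>m > 0\<close> by (simp add: h_def)
  have inb: "x + s *\<^sub>R u + t *\<^sub>R v \<in> ball x r"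
    if "norm u + norm v + 1 = m" "0 \<le> s" "s \<le> h" "0 \<le> t" "t \<le> h" for s t u v
  proof -
    have "norm (s *\<^sub>R u + t *\<^sub>R v) \<le> s * norm u + t * norm v"
      using that norm_triangle_ineq[of "s *\<^sub>R u" "t *\<^sub>R v"] by simp
    also have "\<dots> \<le> h * norm u + h * norm v"
      using that by (intro add_mono mult_right_mono) auto
    also have "\<dots> < h * (norm u + norm v + 1)" using \<open>h > 0\<close> by (simp add: algebra_simps)
    also have "\<dots> = r / 2" using \<open>m > 0\<close> unfolding that(1) h_def by simp
    finally show ?thesis using \<open>r > 0\<close> norm_minus_cancel[of "s *\<^sub>R u + t *\<^sub>R v"]
      by (simp add: dist_norm add.assoc)
  qed
  have hr: "norm u + norm v + 1 = m" "norm v + norm u + 1 = m"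
    by (simp_all add: m_def)
  have sub: "ball x r \<subseteq> ball x d" "ball x r \<subseteq> ball x d'" by (auto simp: r_def)
  have inS: "x + s *\<^sub>R u + t *\<^sub>R v \<in> S" "x + s *\<^sub>R v + t *\<^sub>R u \<in> S"
    if "0 \<le> s" "s \<le> h" "0 \<le> t" "t \<le> h" for s t
    using inb[OF hr(1) that] inb[OF hr(2) that] sub d(2) by blast+
  obtain s t where st: "0 \<le> s" "s \<le> h" "0 \<le> t" "t \<le> h"
    "f (x + h *\<^sub>R u + h *\<^sub>R v) - f (x + h *\<^sub>R u) - f (x + h *\<^sub>R v) + f x
      = h * h * fd (\<lambda>y. fd f y u) (x + s *\<^sub>R u + t *\<^sub>R v) v"
    using mixed_difference_MVT[OF assms(2) \<open>h > 0\<close> inS(1)] by blast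
  obtain s' t' where st': "0 \<le> s'" "s' \<le> h" "0 \<le> t'" "t' \<le> h"
    "f (x + h *\<^sub>R v + h *\<^sub>R u) - f (x + h *\<^sub>R v) - f (x + h *\<^sub>R u) + f x
      = h * h * fd (\<lambda>y. fd f y v) (x + s' *\<^sub>R v + t' *\<^sub>R u) u"
    using mixed_difference_MVT[OF assms(2) \<open>h > 0\<close> inS(2)] by blast
  have "x + h *\<^sub>R v + h *\<^sub>R u = x + h *\<^sub>R u + h *\<^sub>R v" by (simp only: ac_simps)
  note swap = this
  have "h * h * fd (\<lambda>y. fd f y u) (x + s *\<^sub>R u + t *\<^sub>R v) v
      = h * h * fd (\<lambda>y. fd f y v) (x + s' *\<^sub>R v + t' *\<^sub>R u) u"
    using st(5) st'(5) unfolding swap by linarith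
  then have "fd (\<lambda>y. fd f y u) (x + s *\<^sub>R u + t *\<^sub>R v) v = fd (\<lambda>y. fd f y v) (x + s' *\<^sub>R v + t' *\<^sub>R u) u"
    using \<open>h > 0\<close> by simp
  moreover have "\<bar>fd (\<lambda>y. fd f y u) (x + s *\<^sub>R u + t *\<^sub>R v) v - fd (\<lambda>y. fd f y u) x v\<bar> < e"
    by (rule d(3)) (use inb[OF hr(1) st(1-4)] sub in blast)
  moreover have "\<bar>fd (\<lambda>y. fd f y v) (x + s' *\<^sub>R v + t' *\<^sub>R u) u - fd (\<lambda>y. fd f y v) x u\<bar> < e"
    by (rule d'(3)) (use inb[OF hr(2) st'(1-4)] sub in blast)
  moreover have "\<bar>a - b\<bar> \<le> \<bar>c - a\<bar> + \<bar>c - b\<bar>" for a b c :: real by arith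
  ultimately show False unfolding e_def by (smt (verit) field_sum_of_halves)
qed

lemma fd_linear_compose:
  assumes "bounded_linear L" "f differentiable (at x)"
  shows "fd (\<lambda>y. L (f y)) x v = L (fd f x v)"
  by (rule fd_eq[OF bounded_linear.has_derivative[OF assms(1) differentiable_fd[OF assms(2)]]])

lemma fd_commute:
  fixes f :: "'a::real_normed_vector \<Rightarrow> 'b::euclidean_space"
  assumes "open S" "smooth_on S f" "x \<in> S"
  shows "fd (\<lambda>y. fd f y u) x v = fd (\<lambda>y. fd f y v) x u"
proof (rule euclidean_eqI)
  fix b :: 'b
  have L: "bounded_linear (\<lambda>z. z \<bullet> b)" by (rule bounded_linear_inner_left)
  have "fd (\<lambda>y. fd (\<lambda>y. f y \<bullet> b) y u) x v = fd (\<lambda>y. fd f y u) x v \<bullet> b" for u v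
  proof -
    have 1: "fd (\<lambda>y. f y \<bullet> b) y u = fd f y u \<bullet> b" if "y \<in> S" for y
      using assms(2) that by (intro fd_linear_compose[OF L] smooth_on_differentiable)
    have 2: "((\<lambda>y. fd f y u \<bullet> b) has_derivative (\<lambda>v. fd (\<lambda>y. fd f y u) x v \<bullet> b)) (at x)"
      by (rule bounded_linear.has_derivative[OF L smooth_on_has_derivative[OF smooth_on_fd[OF assms(2)] assms(3)]])
    show ?thesis
      by (rule fd_eq[OF has_derivative_transform_within_open[OF 2 assms(1,3)]]) (simp add: 1)
  qed
  moreover have "fd (\<lambda>y. fd (\<lambda>y. f y \<bullet> b) y u) x v = fd (\<lambda>y. fd (\<lambda>y. f y \<bullet> b) y v) x u"
    by (rule fd_commute_real[OF assms(1) smooth_onD[OF smooth_on_linear_compose[OF L assms(1,2)]] assms(3)])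
  ultimately show "fd (\<lambda>y. fd f y u) x v \<bullet> b = fd (\<lambda>y. fd f y v) x u \<bullet> b" by metis
qed

section \<open>Riemannian geometry in coordinates\<close>

lemma linear_axis_sum:
  fixes f :: "real^'n \<Rightarrow> 'b::real_vector"
  assumes "linear f"
  shows "f u = (\<Sum>i\<in>UNIV. u $ i *\<^sub>R f (axis i 1))"
proof -
  have "f u = f (\<Sum>i\<in>UNIV. u $ i *\<^sub>R axis i 1)"
    using basis_expansion[of u] by (simp add: scalar_mult_eq_scaleR)
  then show ?thesis using assms by (simp add: linear_sum linear_scale)
qed

lemma linear_axis_sum_real:
  fixes f :: "real^'n \<Rightarrow> real"
  shows "linear f \<Longrightarrow> (\<Sum>i\<in>UNIV. u $ i * f (axis i 1)) = f u"
  using linear_axis_sum[of f u] by simp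

lemma linear_axis_sum_real':
  fixes f :: "real^'n \<Rightarrow> real"
  shows "linear f \<Longrightarrow> (\<Sum>i\<in>UNIV. f (axis i 1) * u $ i) = f u"
  using linear_axis_sum_real[of f u] by (simp only: mult.commute)

lemma bounded_bilinear_matrix_vector_mult:
  "bounded_bilinear ((*v) :: real^'n^'m \<Rightarrow> real^'n \<Rightarrow> real^'m)"
  unfolding bilinear_conv_bounded_bilinear[symmetric] bilinear_def
  by (auto intro!: linearI simp: algebra_simps vec_eq_iff matrix_vector_mult_def sum.distrib sum_distrib_left)

lemma metric_inner_linear_simps [simp]:
  "metric_inner h x (a + b) w = metric_inner h x a w + metric_inner h x b w"
  "metric_inner h x w (a + b) = metric_inner h x w a + metric_inner h x w b"
  "metric_inner h x (a - b) w = metric_inner h x a w - metric_inner h x b w"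
  "metric_inner h x w (a - b) = metric_inner h x w a - metric_inner h x w b"
  "metric_inner h x (c *\<^sub>R a) w = c * metric_inner h x a w"
  "metric_inner h x w (c *\<^sub>R a) = c * metric_inner h x w a"
  "metric_inner h x (- a) w = - metric_inner h x a w"
  "metric_inner h x w (- a) = - metric_inner h x w a"
  "metric_inner h x 0 w = 0"
  "metric_inner h x w 0 = 0"
  unfolding metric_inner_def
  by (simp_all add: algebra_simps inner_diff_right inner_diff_left inner_add_right inner_add_left
      linear_neg[OF matrix_vector_mul_linear])

lemma linear_metric_inner:
  "linear (\<lambda>w. metric_inner h x v w)" "linear (\<lambda>v. metric_inner h x v w)"
  by (auto intro!: linearI)

definition dmetric :: "(real^'n \<Rightarrow> real^'n^'n) \<Rightarrow> real^'n \<Rightarrow> real^'n \<Rightarrow> real^'n \<Rightarrow> real^'n \<Rightarrow> real" where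
  "dmetric h x u v w = v \<bullet> (fd h x u *v w)"

text \<open>The Christoffel symbols as a vector-valued bilinear map, that is, the covariant
  derivative of constant coordinate fields. The later formulas are then free of indices.\<close>

definition chr :: "(real^'n \<Rightarrow> real^'n^'n) \<Rightarrow> real^'n \<Rightarrow> real^'n \<Rightarrow> real^'n \<Rightarrow> real^'n" where
  "chr h x u v = (\<chi> k. \<Sum>i\<in>UNIV. \<Sum>j\<in>UNIV. christoffel h k i j x * u $ i * v $ j)"

lemma chr_linear_simps [simp]:
  "chr h x (a + b) w = chr h x a w + chr h x b w"
  "chr h x w (a + b) = chr h x w a + chr h x w b"
  "chr h x (c *\<^sub>R a) w = c *\<^sub>R chr h x a w"
  "chr h x w (c *\<^sub>R a) = c *\<^sub>R chr h x w a"
  unfolding chr_def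
  by (auto simp: vec_eq_iff algebra_simps sum.distrib sum_distrib_left)

lemma linear_chr: "linear (\<lambda>u. chr h x u v)" "linear (\<lambda>v. chr h x u v)"
  by (auto intro!: linearI)

lemma chr_diff [simp]:
  "chr h x (a - b) w = chr h x a w - chr h x b w"
  "chr h x w (a - b) = chr h x w a - chr h x w b"
  using linear_diff[OF linear_chr(1)] linear_diff[OF linear_chr(2)] by blast+

lemma chr_axis: "chr h x (axis i 1) (axis j 1) $ k = christoffel h k i j x"
proof -
  have "(\<Sum>i'\<in>UNIV. \<Sum>j'\<in>UNIV. christoffel h k i' j' x * axis i 1 $ i' * axis j 1 $ j')
    = (\<Sum>i'\<in>UNIV. \<Sum>j'\<in>UNIV. if j' = j then if i' = i then christoffel h k i' j' x else 0 else 0)"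
    by (intro sum.cong refl) (auto simp: axis_def)
  then show ?thesis by (simp add: chr_def)
qed

lemma trilinear_axis_sum:
  fixes T :: "real^'n \<Rightarrow> real^'n \<Rightarrow> real^'n \<Rightarrow> real^'m"
  assumes "\<And>v w. linear (\<lambda>u. T u v w)" "\<And>u w. linear (\<lambda>v. T u v w)" "\<And>u v. linear (T u v)"
  shows "T u v w $ l =
    (\<Sum>i\<in>UNIV. \<Sum>j\<in>UNIV. \<Sum>k\<in>UNIV. T (axis i 1) (axis j 1) (axis k 1) $ l * u $ i * v $ j * w $ k)"
proof -
  have "T u v w $ l = (\<Sum>i\<in>UNIV. u $ i * T (axis i 1) v w $ l)"
    using linear_axis_sum[OF assms(1)[of v w], of u] by simp
  also have "\<dots> = (\<Sum>i\<in>UNIV. u $ i * (\<Sum>j\<in>UNIV. v $ j * T (axis i 1) (axis j 1) w $ l))"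
    by (subst linear_axis_sum[OF assms(2)[of _ w], of _ v]) simp
  also have "\<dots> = (\<Sum>i\<in>UNIV. u $ i * (\<Sum>j\<in>UNIV. v $ j * (\<Sum>k\<in>UNIV. w $ k * T (axis i 1) (axis j 1) (axis k 1) $ l)))"
    by (subst linear_axis_sum[OF assms(3), of _ _ w]) simp
  finally show ?thesis by (simp add: sum_distrib_left mult_ac)
qed

lemma trilinear_bound:
  fixes T :: "real^'a \<Rightarrow> real^'a \<Rightarrow> real^'a \<Rightarrow> real^'b"
  assumes "\<And>v w. linear (\<lambda>u. T u v w)" "\<And>u w. linear (\<lambda>v. T u v w)" "\<And>u v. linear (T u v)"
  shows "\<exists>C\<ge>0. \<forall>u v w. norm (T u v w) \<le> C * (norm u * norm v * norm w)"
proof (intro exI conjI allI)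
  let ?t = "\<lambda>l i j k. \<bar>T (axis i 1) (axis j 1) (axis k 1) $ l\<bar>"
  let ?C = "\<Sum>l\<in>UNIV. \<Sum>i\<in>UNIV. \<Sum>j\<in>UNIV. \<Sum>k\<in>UNIV. ?t l i j k"
  show "?C \<ge> 0" by (intro sum_nonneg) auto
  fix u v w
  have "norm (T u v w) \<le> (\<Sum>l\<in>UNIV. \<bar>T u v w $ l\<bar>)" by (rule norm_le_l1_cart)
  also have "\<dots> \<le> (\<Sum>l\<in>UNIV. \<Sum>i\<in>UNIV. \<Sum>j\<in>UNIV. \<Sum>k\<in>UNIV. ?t l i j k * (norm u * norm v * norm w))"
  proof (rule sum_mono)
    fix l
    have "\<bar>T u v w $ l\<bar> = \<bar>\<Sum>i\<in>UNIV. \<Sum>j\<in>UNIV. \<Sum>k\<in>UNIV. T (axis i 1) (axis j 1) (axis k 1) $ l * u $ i * v $ j * w $ k\<bar>"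
      by (subst trilinear_axis_sum[of T u v w l, OF assms]) (rule refl)
    also have "\<dots> \<le> (\<Sum>i\<in>UNIV. \<Sum>j\<in>UNIV. \<Sum>k\<in>UNIV. \<bar>T (axis i 1) (axis j 1) (axis k 1) $ l * u $ i * v $ j * w $ k\<bar>)"
      by (intro order_trans[OF sum_abs] sum_mono order_refl)
    also have "\<dots> \<le> (\<Sum>i\<in>UNIV. \<Sum>j\<in>UNIV. \<Sum>k\<in>UNIV. ?t l i j k * (norm u * norm v * norm w))"
      by (intro sum_mono) (simp add: abs_mult mult.assoc mult_left_mono mult_mono component_le_norm_cart)
    finally show "\<bar>T u v w $ l\<bar> \<le> (\<Sum>i\<in>UNIV. \<Sum>j\<in>UNIV. \<Sum>k\<in>UNIV. ?t l i j k * (norm u * norm v * norm w))" .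
  qed
  finally show "norm (T u v w) \<le> ?C * (norm u * norm v * norm w)"
    by (simp add: sum_distrib_right)
qed

lemma fd_add:
  "f differentiable (at x) \<Longrightarrow> g differentiable (at x) \<Longrightarrow> fd (\<lambda>y. f y + g y) x v = fd f x v + fd g x v"
  by (rule fd_eq) (intro has_derivative_add differentiable_fd)

lemma fd_nth:
  fixes f :: "'a::real_normed_vector \<Rightarrow> 'b::real_normed_vector^'n"
  shows "f differentiable (at x) \<Longrightarrow> fd (\<lambda>y. f y $ i) x v = fd f x v $ i"
  by (rule fd_linear_compose[OF bounded_linear_vec_nth])

lemma linear_fd: "f differentiable (at x) \<Longrightarrow> linear (\<lambda>v. fd f x v)"
  using linear_frechet_derivative[of f "at x"] by simp

section \<open>The Levi-Civita connection and the curvature tensor in one chart\<close>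

locale coord_metric =
  fixes U :: "(real^'n) set" and h :: "real^'n \<Rightarrow> real^'n^'n"
  assumes open_U: "open U" and smooth_h: "smooth_on U h"
    and transpose_h: "\<And>x. x \<in> U \<Longrightarrow> transpose (h x) = h x"
    and pos: "\<And>x v. x \<in> U \<Longrightarrow> v \<noteq> 0 \<Longrightarrow> v \<bullet> (h x *v v) > 0"
begin

abbreviation "mi \<equiv> metric_inner h"
abbreviation "dm \<equiv> dmetric h"
abbreviation "\<Gamma> \<equiv> chr h"

lemma mi_pos: "x \<in> U \<Longrightarrow> v \<noteq> 0 \<Longrightarrow> mi x v v > 0"
  using pos by (simp add: metric_inner_def)

lemma mi_nonneg: "x \<in> U \<Longrightarrow> mi x v v \<ge> 0"
  using mi_pos[of x v] by (cases "v = 0") auto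

lemma mi_sym: "x \<in> U \<Longrightarrow> mi x v w = mi x w v"
  unfolding metric_inner_def using transpose_h[of x] dot_lmul_matrix[of v "h x" w]
    vector_transpose_matrix[of v "h x"] transpose_matrix_vector[of "h x" v]
  by (simp add: inner_commute)

lemma mi_Cauchy_Schwarz:
  assumes "x \<in> U" shows "(mi x v w)\<^sup>2 \<le> mi x v v * mi x w w"
proof (cases "w = 0")
  case False
  then have p: "mi x w w > 0" using mi_pos assms by blast
  have "0 \<le> mi x (mi x w w *\<^sub>R v - mi x v w *\<^sub>R w) (mi x w w *\<^sub>R v - mi x v w *\<^sub>R w)"
    using mi_nonneg assms by blast
  also have "\<dots> = mi x w w * (mi x v v * mi x w w - (mi x v w)\<^sup>2)"
    using mi_sym[OF assms, of w v] by (simp add: algebra_simps power2_eq_square)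
  finally show ?thesis using p by (simp add: zero_le_mult_iff)
qed auto

lemma det_h: "x \<in> U \<Longrightarrow> det (h x) \<noteq> 0"
  using pos[of x] invertible_det_nz[of "h x"] invertible_left_inverse[of "h x"]
    matrix_left_invertible_ker[of "h x"]
  by (metis inner_zero_right less_irrefl)

lemma h_inv: "x \<in> U \<Longrightarrow> h x *v (matrix_inv (h x) *v b) = b"
  using matrix_inv_right[OF det_h] by (simp add: matrix_vector_mul_assoc)

lemma mi_inv: "x \<in> U \<Longrightarrow> mi x (matrix_inv (h x) *v b) w = b \<bullet> w"
  using mi_sym[of x w "matrix_inv (h x) *v b"]
  by (simp add: metric_inner_def h_inv) (simp add: inner_commute)

text \<open>This is the raising of an index: the vector on the left is the metric dual of the form
  \<open>f\<close>. The connection, the gradient and the Hessian endomorphism are all obtained from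
  their forms in this way.\<close>

lemma mi_inv_axis:
  assumes "x \<in> U" "linear f"
  shows "mi x (matrix_inv (h x) *v (\<chi> i. f (axis i 1))) w = f w"
  using linear_axis_sum_real[OF assms(2), of w] assms(1)
  by (simp add: mi_inv inner_vec_def mult.commute)

lemma mi_eqI:
  assumes "x \<in> U" "\<And>w. mi x a w = mi x b w" shows "a = b"
proof -
  have "mi x (a - b) (a - b) = 0" using assms(2) by simp
  then show ?thesis using mi_pos[OF assms(1), of "a - b"] by auto
qed

lemma differentiable_h: "x \<in> U \<Longrightarrow> h differentiable (at x)"
  using smooth_h smooth_on_differentiable by blast

lemma fd_mi:
  assumes "x \<in> U" "a differentiable (at x)" "b differentiable (at x)"
  shows "fd (\<lambda>y. mi y (a y) (b y)) x u
    = dm x u (a x) (b x) + mi x (fd a x u) (b x) + mi x (a x) (fd b x u)"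
proof -
  have "((\<lambda>y. h y *v b y) has_derivative (\<lambda>u. h x *v fd b x u + fd h x u *v b x)) (at x)"
    using assms differentiable_h
    by (intro bounded_bilinear.FDERIV[OF bounded_bilinear_matrix_vector_mult] differentiable_fd)
  from bounded_bilinear.FDERIV[OF bounded_bilinear_inner differentiable_fd[OF assms(2)] this]
  show ?thesis unfolding metric_inner_def dmetric_def
    by (subst fd_eq, assumption) (simp add: inner_add_right)
qed

lemma fd_mi_const: "x \<in> U \<Longrightarrow> fd (\<lambda>y. mi y a b) x u = dm x u a b"
  using fd_mi[of x "\<lambda>_. a" "\<lambda>_. b"] by simp

lemma smooth_mi: "smooth_on U a \<Longrightarrow> smooth_on U b \<Longrightarrow> smooth_on U (\<lambda>y. mi y (a y) (b y))"
  unfolding metric_inner_def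
  by (intro smooth_on_inner smooth_on_matrix_vector_mult smooth_h open_U)

lemma dm_sym: "x \<in> U \<Longrightarrow> dm x u v w = dm x u w v"
  unfolding fd_mi_const[symmetric]
  by (rule fd_eq[OF has_derivative_transform_within_open
        [OF smooth_on_has_derivative[OF smooth_mi[OF smooth_on_const smooth_on_const]] open_U]])
    (auto simp: mi_sym)

lemma dm_linear_simps:
  assumes "x \<in> U"
  shows "dm x (a + b) v w = dm x a v w + dm x b v w" "dm x (c *\<^sub>R a) v w = c * dm x a v w"
    "dm x u (a + b) w = dm x u a w + dm x u b w" "dm x u (c *\<^sub>R a) w = c * dm x u a w"
    "dm x u v (a + b) = dm x u v a + dm x u v b" "dm x u v (c *\<^sub>R a) = c * dm x u v a"
  using linear_add[OF linear_fd[OF differentiable_h[OF assms]]]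
    linear_scale[OF linear_fd[OF differentiable_h[OF assms]]]
  by (simp_all add: dmetric_def matrix_vector_mult_add_rdistrib matrix_vector_right_distrib
      inner_add_right inner_add_left scaleR_matrix_vector_assoc[symmetric] matrix_vector_mult_scaleR)

text \<open>The right-hand side of the Koszul formula for constant coordinate fields, classically
  the Christoffel symbols of the first kind.\<close>

definition koszul :: "real^'n \<Rightarrow> real^'n \<Rightarrow> real^'n \<Rightarrow> real^'n \<Rightarrow> real" where
  "koszul x u v w = (dm x u v w + dm x v u w - dm x w u v) / 2"

lemma linear_koszul:
  assumes "x \<in> U"
  shows "linear (\<lambda>u. koszul x u v w)" "linear (\<lambda>v. koszul x u v w)" "linear (\<lambda>w. koszul x u v w)"
  by (rule linearI; simp add: koszul_def dm_linear_simps[OF assms] field_simps)+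

lemma christoffel_koszul:
  assumes "x \<in> U"
  shows "christoffel h k i j x
    = (matrix_inv (h x) *v (\<chi> l. koszul x (axis i 1) (axis j 1) (axis l 1))) $ k"
proof -
  have "partial_deriv i (\<lambda>y. h y $ j $ l) x = dm x (axis i 1) (axis j 1) (axis l 1)" for i j l
  proof -
    have "(\<lambda>y. h y $ j) differentiable (at x)"
      using smooth_on_nth[OF open_U smooth_h] assms smooth_on_differentiable by blast
    then have "partial_deriv i (\<lambda>y. h y $ j $ l) x = fd h x (axis i 1) $ j $ l"
      unfolding partial_deriv_def using differentiable_h[OF assms] by (simp add: fd_nth)
    then show ?thesis
      by (simp add: dmetric_def inner_axis' matrix_vector_mult_basis column_def)
  qed
  then show ?thesis
    unfolding christoffel_def
    by (simp add: matrix_vector_mult_def koszul_def sum_distrib_left)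
qed

lemma chr_koszul:
  assumes "x \<in> U"
  shows "\<Gamma> x u v = matrix_inv (h x) *v (\<chi> l. koszul x u v (axis l 1))"
proof -
  let ?G = "\<lambda>u v. matrix_inv (h x) *v (\<chi> l. koszul x u v (axis l 1))"
  have "linear (\<lambda>u. ?G u v)" for v
      by (rule linear_compose[OF _ matrix_vector_mul_linear, of "\<lambda>u. \<chi> l. koszul x u v (axis l 1)", unfolded o_def],
      intro linearI) (auto simp: vec_eq_iff linear_add[OF linear_koszul(1)[OF assms]] linear_scale[OF linear_koszul(1)[OF assms]])
  note 1 = linear_axis_sum[OF this]
  have "linear (\<lambda>v. ?G u v)" for u
      by (rule linear_compose[OF _ matrix_vector_mul_linear, of "\<lambda>v. \<chi> l. koszul x u v (axis l 1)", unfolded o_def],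
      intro linearI) (auto simp: vec_eq_iff linear_add[OF linear_koszul(2)[OF assms]] linear_scale[OF linear_koszul(2)[OF assms]])
  note 2 = linear_axis_sum[OF this]
  have "?G u v = (\<Sum>i\<in>UNIV. u $ i *\<^sub>R ?G (axis i 1) v)" by (rule 1)
  also have "\<dots> = (\<Sum>i\<in>UNIV. u $ i *\<^sub>R (\<Sum>j\<in>UNIV. v $ j *\<^sub>R ?G (axis i 1) (axis j 1)))"
    using 2 by (intro sum.cong refl arg_cong2[where f=scaleR])
  finally show ?thesis
    by (simp add: vec_eq_iff chr_def christoffel_koszul[OF assms] sum_distrib_left mult_ac)
qed

lemma mi_chr: "x \<in> U \<Longrightarrow> mi x (\<Gamma> x u v) w = koszul x u v w"
  unfolding chr_koszul by (rule mi_inv_axis[OF _ linear_koszul(3)])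

lemma chr_eqI: "x \<in> U \<Longrightarrow> (\<And>w. mi x a w = koszul x u v w) \<Longrightarrow> a = \<Gamma> x u v"
  by (rule mi_eqI) (auto simp: mi_chr)

lemma chr_sym: "x \<in> U \<Longrightarrow> \<Gamma> x u v = \<Gamma> x v u"
  by (rule mi_eqI) (auto simp: mi_chr koszul_def dm_sym)

text \<open>Compatibility of the connection with the metric, for constant fields: in the sum of the
  two Koszul expressions everything but \<open>dm x u v w\<close> cancels.\<close>

lemma dm_chr: "x \<in> U \<Longrightarrow> dm x u v w = mi x (\<Gamma> x u v) w + mi x v (\<Gamma> x u w)"
  using mi_sym[of x v "\<Gamma> x u w"] dm_sym[of x u w v] dm_sym[of x v w u] dm_sym[of x w u v]
  by (simp add: mi_chr koszul_def field_simps)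

lemma smooth_chr: "smooth_on U (\<lambda>x. \<Gamma> x u v)"
proof (rule smooth_on_cong[OF open_U chr_koszul[symmetric]])
  have "smooth_on U (\<lambda>x. dm x u v w)" for u v w
    unfolding dmetric_def
    by (intro smooth_on_inner smooth_on_matrix_vector_mult smooth_on_fd smooth_h open_U smooth_on_const)
  then have "smooth_on U (\<lambda>x. \<chi> l. koszul x u v (axis l 1))"
    unfolding koszul_def
    by (intro smooth_on_vecI open_U)
      (auto intro!: smooth_on_divide smooth_on_diff smooth_on_add open_U)
  then show "smooth_on U (\<lambda>x. matrix_inv (h x) *v (\<chi> l. koszul x u v (axis l 1)))"
    by (intro smooth_on_matrix_inv open_U smooth_h det_h)
qed

lemma differentiable_chr: "x \<in> U \<Longrightarrow> (\<lambda>y. \<Gamma> y u v) differentiable (at x)"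
  using smooth_chr smooth_on_differentiable by blast

abbreviation "D\<Gamma> x u v w \<equiv> fd (\<lambda>y. \<Gamma> y v w) x u"

lemma linear_fd_chr:
  assumes "x \<in> U"
  shows "linear (\<lambda>u. D\<Gamma> x u v w)" "linear (\<lambda>v. D\<Gamma> x u v w)" "linear (\<lambda>w. D\<Gamma> x u v w)"
proof -
  show "linear (\<lambda>u. D\<Gamma> x u v w)" by (rule linear_fd[OF differentiable_chr[OF assms]])
  have c: "fd (\<lambda>y. c *\<^sub>R \<Gamma> y a b) x u = c *\<^sub>R D\<Gamma> x u a b" for c a b
    by (rule fd_linear_compose[OF bounded_linear_scaleR_right differentiable_chr[OF assms]])
  show "linear (\<lambda>v. D\<Gamma> x u v w)" "linear (\<lambda>w. D\<Gamma> x u v w)"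
    by (rule linearI; simp add: c fd_add differentiable_chr assms)+
qed

text \<open>Both sides are trilinear, so it suffices to compare them on axis vectors, where the
  right-hand side is \<open>curvature_coeff\<close>.\<close>

lemma curvature_chr:
  assumes "x \<in> U"
  shows "curvature h x u v w
    = D\<Gamma> x u v w - D\<Gamma> x v u w + \<Gamma> x u (\<Gamma> x v w) - \<Gamma> x v (\<Gamma> x u w)"
proof -
  let ?T = "\<lambda>u v w. D\<Gamma> x u v w - D\<Gamma> x v u w + \<Gamma> x u (\<Gamma> x v w) - \<Gamma> x v (\<Gamma> x u w)"
  have "linear (\<lambda>u. ?T u v w)" "linear (\<lambda>v. ?T u v w)" "linear (?T u v)" for u v w
    using linear_fd_chr[OF assms]
    by (auto intro!: linearI simp: linear_iff algebra_simps)
  note expand = trilinear_axis_sum[of ?T, OF this]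
  have coeff: "?T (axis i 1) (axis j 1) (axis k 1) $ l = curvature_coeff h l i j k x" for i j k l
  proof -
    have "D\<Gamma> x (axis i 1) (axis j 1) (axis k 1) $ l = partial_deriv i (christoffel h l j k) x" for i j
      using fd_nth[OF differentiable_chr[OF assms], of "axis j 1" "axis k 1" l "axis i 1"]
      by (simp add: chr_axis partial_deriv_def)
    moreover have "\<Gamma> x (axis i 1) (\<Gamma> x (axis j 1) (axis k 1)) $ l
      = (\<Sum>m\<in>UNIV. christoffel h m j k x * christoffel h l i m x)" for i j
      using linear_axis_sum[OF linear_chr(2)[of h x "axis i 1"], of "\<Gamma> x (axis j 1) (axis k 1)"]
      by (simp add: chr_axis)
    ultimately show ?thesis
      by (simp add: curvature_coeff_def sum_subtractf)
  qed
  show ?thesis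
    by (rule vec_eq_iff[THEN iffD2], rule allI, subst expand, simp only: coeff)
      (simp add: curvature_def)
qed

lemma linear_curvature:
  assumes "x \<in> U"
  shows "linear (\<lambda>u. curvature h x u v w)" "linear (\<lambda>v. curvature h x u v w)" "linear (\<lambda>w. curvature h x u v w)"
  unfolding curvature_chr[OF assms] using linear_fd_chr[OF assms]
  by (auto intro!: linearI simp: linear_iff algebra_simps)

lemma curvature_antisym: "x \<in> U \<Longrightarrow> curvature h x v u w = - curvature h x u v w"
  by (simp add: curvature_chr)

text \<open>The second derivatives of \<open>mi y w w\<close> in the directions \<open>u\<close> and
  \<open>v\<close> commute. Written through the connection, each is the sum of a term symmetric in
  \<open>u\<close> and \<open>v\<close> and a term whose antisymmetrisation is twice
  \<open>mi x (curvature h x u v w) w\<close>.\<close>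

lemma curvature_skew:
  assumes "x \<in> U"
  shows "mi x (curvature h x u v w) w = 0"
proof -
  have dd: "fd (\<lambda>y. dm y v w w) x u
    = 2 * mi x (D\<Gamma> x u v w + \<Gamma> x u (\<Gamma> x v w)) w + 2 * mi x (\<Gamma> x v w) (\<Gamma> x u w)" for u v
  proof -
    have "((\<lambda>y. 2 * mi y (\<Gamma> y v w) w) has_derivative
        (\<lambda>u. 2 * fd (\<lambda>y. mi y (\<Gamma> y v w) w) x u)) (at x)"
      by (intro has_derivative_mult_right smooth_on_has_derivative[OF smooth_mi assms] smooth_chr smooth_on_const)
    then have "fd (\<lambda>y. dm y v w w) x u = 2 * fd (\<lambda>y. mi y (\<Gamma> y v w) w) x u"
      by (rule fd_eq[OF has_derivative_transform_within_open[OF _ open_U assms]])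
        (simp add: mi_chr koszul_def dm_sym)
    then show ?thesis
      using fd_mi[OF assms differentiable_chr[OF assms, of v w] differentiable_const, of w u]
      by (simp add: dm_chr[OF assms])
  qed
  have "fd (\<lambda>y. dm y v w w) x u = fd (\<lambda>y. dm y u w w) x v"
  proof -
    have "fd (\<lambda>y. fd (\<lambda>y. mi y w w) y v) x u = fd (\<lambda>y. dm y v w w) x u" for u v
    proof -
      have "smooth_on U (\<lambda>y. dm y v w w)"
        unfolding dmetric_def
        by (intro smooth_on_inner smooth_on_matrix_vector_mult smooth_on_fd smooth_h open_U smooth_on_const)
      from has_derivative_transform_within_open[OF smooth_on_has_derivative[OF this assms] open_U assms,
          of "\<lambda>y. fd (\<lambda>y. mi y w w) y v"]
      show ?thesis by (intro fd_eq) (simp add: fd_mi_const)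
    qed
    then show ?thesis
      using fd_commute[OF open_U smooth_mi[OF smooth_on_const smooth_on_const] assms, of w w v u] by metis
  qed
  then show ?thesis
    using mi_sym[OF assms, of "\<Gamma> x v w" "\<Gamma> x u w"]
    by (simp add: dd curvature_chr[OF assms])
qed

end

section \<open>Conformal change of a metric\<close>

context coord_metric
begin

lemma metric_inner_scaled: "metric_inner (\<lambda>y. c y *\<^sub>R h y) x v w = c x * mi x v w"
  by (simp add: metric_inner_def scaleR_matrix_vector_assoc[symmetric])

end

locale conformal_metric = coord_metric U h for U :: "(real^'n) set" and h +
  fixes f :: "real^'n \<Rightarrow> real"
  assumes smooth_f: "smooth_on U f"
begin

definition ht :: "real^'n \<Rightarrow> real^'n^'n" where "ht y = exp (2 * f y) *\<^sub>R h y"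

lemma smooth_exp_f: "smooth_on U (\<lambda>y. exp (2 * f y))"
  by (rule smooth_on_compose[OF open_U open_UNIV _ smooth_on_exp])
    (auto intro!: smooth_on_mult open_U smooth_f)

lemma mi_ht: "metric_inner ht x v w = exp (2 * f x) * mi x v w"
  using metric_inner_scaled[of "\<lambda>y. exp (2 * f y)"] by (simp add: ht_def[abs_def])

lemma coord_metric_ht: "coord_metric U ht"
proof
  show "smooth_on U ht"
    unfolding ht_def[abs_def] by (intro smooth_on_scaleR smooth_exp_f smooth_h open_U)
  show "transpose (ht x) = ht x" if "x \<in> U" for x
    using transpose_h[OF that] by (simp add: ht_def vec_eq_iff transpose_def)
  show "0 < v \<bullet> (ht x *v v)" if "x \<in> U" "v \<noteq> 0" for x v
    using pos[OF that] by (simp add: ht_def scaleR_matrix_vector_assoc[symmetric])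
qed (rule open_U)

interpretation T: coord_metric U ht by (rule coord_metric_ht)

definition grad :: "real^'n \<Rightarrow> real^'n" where
  "grad y = matrix_inv (h y) *v (\<chi> i. fd f y (axis i 1))"

definition hess :: "real^'n \<Rightarrow> real^'n \<Rightarrow> real^'n \<Rightarrow> real" where
  "hess x u w = fd (\<lambda>y. fd f y w) x u - fd f x (\<Gamma> x u w)"

text \<open>The Hessian as an endomorphism; by \<open>fd_grad\<close> below it is the covariant
  derivative of the gradient.\<close>

definition hessvec :: "real^'n \<Rightarrow> real^'n \<Rightarrow> real^'n" where
  "hessvec x u = matrix_inv (h x) *v (\<chi> i. hess x u (axis i 1))"

lemma linear_df: "x \<in> U \<Longrightarrow> linear (\<lambda>v. fd f x v)"
  using linear_fd smooth_on_differentiable smooth_f by blast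

lemmas df_simps = linear_add[OF linear_df] linear_scale[OF linear_df] linear_diff[OF linear_df]

lemma differentiable_fd_f: "x \<in> U \<Longrightarrow> (\<lambda>y. fd f y w) differentiable (at x)"
  using smooth_on_differentiable[OF smooth_on_fd[OF smooth_f]] .

lemma mi_grad: "x \<in> U \<Longrightarrow> mi x (grad x) w = fd f x w"
  unfolding grad_def by (rule mi_inv_axis[OF _ linear_df])

lemma ddf_linear:
  assumes "x \<in> U"
  shows "fd (\<lambda>y. fd f y (a + b)) x u = fd (\<lambda>y. fd f y a) x u + fd (\<lambda>y. fd f y b) x u"
    "fd (\<lambda>y. fd f y (c *\<^sub>R a)) x u = c * fd (\<lambda>y. fd f y a) x u"
proof -
  have "((\<lambda>y. fd f y a + fd f y b) has_derivative
      (\<lambda>u. fd (\<lambda>y. fd f y a) x u + fd (\<lambda>y. fd f y b) x u)) (at x)"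
    by (intro has_derivative_add differentiable_fd differentiable_fd_f assms)
  from has_derivative_transform_within_open[OF this open_U assms, of "\<lambda>y. fd f y (a + b)"]
  show "fd (\<lambda>y. fd f y (a + b)) x u = fd (\<lambda>y. fd f y a) x u + fd (\<lambda>y. fd f y b) x u"
    by (intro fd_eq) (simp add: df_simps)
  have "((\<lambda>y. c * fd f y a) has_derivative (\<lambda>u. c * fd (\<lambda>y. fd f y a) x u)) (at x)"
    by (intro has_derivative_mult_right differentiable_fd differentiable_fd_f assms)
  from has_derivative_transform_within_open[OF this open_U assms, of "\<lambda>y. fd f y (c *\<^sub>R a)"]
  show "fd (\<lambda>y. fd f y (c *\<^sub>R a)) x u = c * fd (\<lambda>y. fd f y a) x u"
    by (intro fd_eq) (simp add: df_simps)
qed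

lemma ddf_sym: "x \<in> U \<Longrightarrow> fd (\<lambda>y. fd f y v) x u = fd (\<lambda>y. fd f y u) x v"
  by (rule fd_commute[OF open_U smooth_f])

lemma hess_sym: "x \<in> U \<Longrightarrow> hess x u v = hess x v u"
  unfolding hess_def using ddf_sym chr_sym by metis

lemma linear_hess:
  assumes "x \<in> U"
  shows "linear (hess x u)" "linear (\<lambda>u. hess x u v)"
proof -
  show 1: "linear (hess x u)" for u
    by (rule linearI) (simp_all add: hess_def ddf_linear assms df_simps algebra_simps)
  show "linear (\<lambda>u. hess x u v)"
    using 1[of v] by (simp add: hess_sym[OF assms, of _ v])
qed

lemma mi_hessvec: "x \<in> U \<Longrightarrow> mi x (hessvec x u) w = hess x u w"
  unfolding hessvec_def by (rule mi_inv_axis[OF _ linear_hess(1)])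

lemma smooth_grad: "smooth_on U grad"
  unfolding grad_def[abs_def]
  by (intro smooth_on_matrix_inv open_U smooth_h det_h smooth_on_vecI)
    (simp_all add: smooth_on_fd smooth_f)

lemma fd_grad:
  assumes "x \<in> U" shows "fd grad x u = hessvec x u - \<Gamma> x u (grad x)"
proof (rule mi_eqI[OF assms])
  fix w
  have "((\<lambda>y. mi y (grad y) w) has_derivative (\<lambda>u. fd (\<lambda>y. fd f y w) x u)) (at x)"
    by (rule has_derivative_transform_within_open[OF differentiable_fd[OF differentiable_fd_f[OF assms]] open_U assms])
      (simp add: mi_grad)
  then have "fd (\<lambda>y. fd f y w) x u = fd (\<lambda>y. mi y (grad y) w) x u"
    by (simp add: fd_eq)
  also have "\<dots> = dm x u (grad x) w + mi x (fd grad x u) w"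
    using fd_mi[OF assms smooth_on_differentiable[OF smooth_grad assms], of "\<lambda>_. w"] by simp
  finally show "mi x (fd grad x u) w = mi x (hessvec x u - \<Gamma> x u (grad x)) w"
    by (simp add: mi_hessvec assms hess_def dm_chr mi_grad)
qed

lemma dmetric_ht:
  assumes "x \<in> U"
  shows "dmetric ht x u v w = exp (2 * f x) * (2 * fd f x u * mi x v w + dm x u v w)"
proof -
  have "((\<lambda>y. exp (2 * f y)) has_derivative (\<lambda>u. exp (2 * f x) * (2 * fd f x u))) (at x)"
    by (rule has_derivative_eq_rhs[OF has_derivative_exp[OF has_derivative_mult_right
          [OF smooth_on_has_derivative[OF smooth_f assms], of 2]]]) (auto simp: mult_ac)
  note e = this
  have "(ht has_derivative (\<lambda>u. exp (2 * f x) *\<^sub>R fd h x u + (exp (2 * f x) * (2 * fd f x u)) *\<^sub>R h x)) (at x)"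
    unfolding ht_def[abs_def]
    by (intro has_derivative_scaleR e smooth_on_has_derivative[OF smooth_h assms])
  from fd_eq[OF this] show ?thesis
    by (simp add: dmetric_def metric_inner_def matrix_vector_mult_add_rdistrib inner_add_right
        scaleR_matrix_vector_assoc[symmetric] algebra_simps)
qed

text \<open>The Koszul formula determines the new connection. Each of its three derivatives of
  \<open>ht\<close> also differentiates the factor \<open>exp (2 * f x)\<close>, and this produces
  the three correction terms.\<close>

lemma chr_ht:
  assumes "x \<in> U"
  shows "chr ht x u v = \<Gamma> x u v + fd f x u *\<^sub>R v + fd f x v *\<^sub>R u - mi x u v *\<^sub>R grad x"
proof (rule T.chr_eqI[OF assms, symmetric])
  fix w
  show "metric_inner ht x (\<Gamma> x u v + fd f x u *\<^sub>R v + fd f x v *\<^sub>R u - mi x u v *\<^sub>R grad x) w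
    = T.koszul x u v w"
    unfolding T.koszul_def dmetric_ht[OF assms] mi_ht
    by (simp add: mi_chr[OF assms] mi_grad[OF assms] koszul_def field_simps mi_sym[OF assms, of w])
qed

text \<open>The Schouten-type tensor of the conformal change: it is the tensor whose Kulkarni-Nomizu product
  with the metric is subtracted from the curvature.\<close>

definition conf :: "real^'n \<Rightarrow> real^'n \<Rightarrow> real^'n \<Rightarrow> real" where
  "conf x u w = hess x u w - fd f x u * fd f x w + fd f x (grad x) / 2 * mi x u w"

definition confvec :: "real^'n \<Rightarrow> real^'n \<Rightarrow> real^'n" where
  "confvec x u = hessvec x u - fd f x u *\<^sub>R grad x + (fd f x (grad x) / 2) *\<^sub>R u"

lemma mi_confvec: "x \<in> U \<Longrightarrow> mi x (confvec x u) w = conf x u w"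
  by (simp add: confvec_def conf_def mi_hessvec mi_grad)

lemma conf_sym: "x \<in> U \<Longrightarrow> conf x u w = conf x w u"
  by (simp add: conf_def hess_sym[of x u w] mi_sym[of x u w])

lemma linear_conf: "x \<in> U \<Longrightarrow> linear (conf x u)"
  by (rule linearI)
    (simp_all add: conf_def linear_add[OF linear_hess(1)] linear_scale[OF linear_hess(1)] df_simps algebra_simps)

lemma fd_chr_ht:
  assumes "x \<in> U"
  shows "fd (\<lambda>y. chr ht y v w) x u
    = D\<Gamma> x u v w + fd (\<lambda>y. fd f y v) x u *\<^sub>R w + fd (\<lambda>y. fd f y w) x u *\<^sub>R v
      - (dm x u v w *\<^sub>R grad x + mi x v w *\<^sub>R (hessvec x u - \<Gamma> x u (grad x)))"
proof -
  have g: "((\<lambda>y. mi y v w *\<^sub>R grad y) has_derivative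
      (\<lambda>u. mi x v w *\<^sub>R fd grad x u + fd (\<lambda>y. mi y v w) x u *\<^sub>R grad x)) (at x)"
    by (intro has_derivative_scaleR smooth_on_has_derivative[OF _ assms] smooth_mi smooth_on_const smooth_grad)
  have s: "((\<lambda>y. fd f y a *\<^sub>R b) has_derivative (\<lambda>u. fd (\<lambda>y. fd f y a) x u *\<^sub>R b)) (at x)" for a b
    by (intro has_derivative_scaleR_left differentiable_fd differentiable_fd_f assms)
  have "((\<lambda>y. chr ht y v w) has_derivative (\<lambda>u. D\<Gamma> x u v w + fd (\<lambda>y. fd f y v) x u *\<^sub>R w
      + fd (\<lambda>y. fd f y w) x u *\<^sub>R v
      - (mi x v w *\<^sub>R fd grad x u + fd (\<lambda>y. mi y v w) x u *\<^sub>R grad x))) (at x)"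
    by (rule has_derivative_transform_within_open[OF _ open_U assms chr_ht[symmetric]])
      (intro has_derivative_diff has_derivative_add g s differentiable_fd differentiable_chr assms)
  from fd_eq[OF this] show ?thesis
    by (simp add: fd_mi_const fd_grad assms)
qed

text \<open>Differentiating the corrected connection yields second derivatives of \<open>f\<close>,
  which combine with connection terms to Hessians, and products of first derivatives. Both group
  into \<open>conf\<close> and its endomorphism \<open>confvec\<close>.\<close>

lemma curvature_ht:
  assumes "x \<in> U"
  shows "curvature ht x u v w = curvature h x u v w + conf x u w *\<^sub>R v - conf x v w *\<^sub>R u
    - mi x v w *\<^sub>R confvec x u + mi x u w *\<^sub>R confvec x v"
proof -
  note s = chr_sym[OF assms, of v u] ddf_sym[OF assms, of v u] mi_sym[OF assms, of v u]
    mi_sym[OF assms, of w] 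
  \<comment> \<open>These rules trade the differential of \<open>f\<close> on connection terms for
    Hessians and move every connection term into the left argument of the metric, after which the
    remaining ones cancel.\<close>
  have [simp]: "fd f x (\<Gamma> x u w) = fd (\<lambda>y. fd f y w) x u - hess x u w" for u w
    by (simp add: hess_def)
  have [simp]: "mi x a (grad x) = fd f x a" for a
    using mi_grad[OF assms, of a] mi_sym[OF assms, of a "grad x"] by simp
  have expand: "mi x u (\<Gamma> x v w) = dm x v u w - mi x (\<Gamma> x v u) w" for u v w
    using dm_chr[OF assms] by simp
  show ?thesis
    unfolding T.curvature_chr[OF assms] curvature_chr[OF assms] fd_chr_ht[OF assms] chr_ht[OF assms]
    by (simp add: df_simps assms conf_def confvec_def algebra_simps expand s mi_grad)
      (simp add: vec_eq_iff field_simps)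
qed

text \<open>The vector \<open>?z\<close> is a multiple of the part of \<open>v\<close> orthogonal to
  \<open>w\<close>, with the denominator cleared; it vanishes only if the vectors are
  parallel.\<close>

lemma gram_pos:
  assumes "x \<in> U" "v \<noteq> w" "independent {v, w}"
  shows "mi x v v * mi x w w - (mi x v w)\<^sup>2 > 0"
proof -
  have "w \<noteq> 0" using assms(3) dependent_zero by auto
  then have p: "mi x w w > 0" using mi_pos assms by blast
  let ?z = "mi x w w *\<^sub>R v - mi x v w *\<^sub>R w"
  have "?z \<noteq> 0"
  proof
    assume "?z = 0"
    then have "v = (mi x v w / mi x w w) *\<^sub>R w"
      using p by (simp add: vec_eq_iff field_simps)
    then have "v \<in> span {w}" by (metis span_base span_mul singletonI)
    then show False using assms(2,3) by (simp add: independent_insert)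
  qed
  then have "0 < mi x ?z ?z" using mi_pos assms by blast
  also have "\<dots> = mi x w w * (mi x v v * mi x w w - (mi x v w)\<^sup>2)"
    using mi_sym[OF assms(1), of w v] by (simp add: algebra_simps power2_eq_square)
  finally show ?thesis using p by (simp add: zero_less_mult_iff)
qed

text \<open>Since \<open>P = a * mi - conf\<close> is nonnegative, so is its Kulkarni-Nomizu product
  with the metric on every plane: once \<open>w\<close> is replaced by a multiple of its part
  orthogonal to \<open>v\<close>, the mixed term disappears and a sum of two nonnegative products
  remains.\<close>

lemma conf_kulkarni_nomizu_le:
  assumes "x \<in> U" and le: "\<And>v. conf x v v \<le> a * mi x v v"
  shows "conf x w w * mi x v v + conf x v v * mi x w w - 2 * conf x v w * mi x v w
    \<le> 2 * a * (mi x v v * mi x w w - (mi x v w)\<^sup>2)"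
proof (cases "v = 0")
  case True
  then show ?thesis using linear_0[OF linear_conf[OF assms(1)]] conf_sym[OF assms(1), of 0] by simp
next
  case False
  define m where "m = mi x v v"
  define b where "b = mi x v w"
  have "m > 0" using False mi_pos assms(1) by (simp add: m_def)
  define P where "P u w = a * mi x u w - conf x u w" for u w
  let ?w = "m *\<^sub>R w - b *\<^sub>R v"
  have "P u u \<ge> 0" for u using le[of u] by (simp add: P_def)
  then have "P ?w ?w \<ge> 0" "P v v \<ge> 0" by blast+
  have lin: "conf x u (c *\<^sub>R y - d *\<^sub>R z) = c * conf x u y - d * conf x u z" for u c y d z
    by (simp add: linear_diff[OF linear_conf[OF assms(1)]] linear_scale[OF linear_conf[OF assms(1)]])
  have PW: "P ?w ?w = m\<^sup>2 * P w w - 2 * m * b * P v w + b\<^sup>2 * P v v"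
    by (simp add: P_def lin conf_sym[OF assms(1), of ?w] conf_sym[OF assms(1), of w v]
        mi_sym[OF assms(1), of w v] algebra_simps power2_eq_square)
  have "m * P ?w ?w + P v v * (m * (m * mi x w w - b\<^sup>2)) = m\<^sup>2 * (P w w * m + P v v * mi x w w - 2 * P v w * b)"
    unfolding PW by (simp add: algebra_simps power2_eq_square)
  moreover have "m * mi x w w - b\<^sup>2 \<ge> 0"
    using mi_Cauchy_Schwarz[OF assms(1), of v w] by (simp add: m_def b_def)
  ultimately have "0 \<le> m\<^sup>2 * (P w w * m + P v v * mi x w w - 2 * P v w * b)"
    using \<open>m > 0\<close> \<open>P ?w ?w \<ge> 0\<close> \<open>P v v \<ge> 0\<close>
    by (metis add_nonneg_nonneg less_imp_le mult_nonneg_nonneg)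
  then have "0 \<le> P w w * m + P v v * mi x w w - 2 * P v w * b"
    using \<open>m > 0\<close> by (simp add: zero_le_mult_iff)
  then show ?thesis
    by (simp add: P_def m_def b_def algebra_simps power2_eq_square)
qed

text \<open>The numerator of the sectional curvature gains \<open>exp (2 * f x)\<close> and the Gram
  determinant its square, which leaves the factor \<open>exp (- 2 * f x)\<close>. The
  Kulkarni-Nomizu estimate bounds the loss by \<open>2 * a\<close>.\<close>

lemma sectional_curvature_ht_ge:
  assumes "x \<in> U" "\<And>v. conf x v v \<le> a * mi x v v" "v \<noteq> w" "independent {v, w}"
    and k: "k \<le> sectional_curvature h x v w"
  shows "exp (- 2 * f x) * (k - 2 * a) \<le> sectional_curvature ht x v w"
proof -
  define g where "g = mi x v v * mi x w w - (mi x v w)\<^sup>2"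
  define e where "e = exp (2 * f x)"
  have "g > 0" using gram_pos assms by (simp add: g_def)
  have "e > 0" by (simp add: e_def)
  define r where "r = mi x (curvature h x v w w) v"
  define s where "s = conf x w w * mi x v v + conf x v v * mi x w w - 2 * conf x v w * mi x v w"
  have "s \<le> 2 * a * g"
    using conf_kulkarni_nomizu_le[OF assms(1,2)] by (simp add: s_def g_def)
  have "k * g \<le> r"
    using k \<open>g > 0\<close> by (simp add: sectional_curvature_def g_def r_def field_simps)
  have "metric_inner ht x (curvature ht x v w w) v = e * (r - s)"
    unfolding mi_ht curvature_ht[OF assms(1)]
    by (simp add: e_def r_def s_def mi_confvec assms(1) conf_sym[OF assms(1), of w v]
        mi_sym[OF assms(1), of w v] algebra_simps)
  moreover have "metric_inner ht x v v * metric_inner ht x w w - (metric_inner ht x v w)\<^sup>2 = e\<^sup>2 * g"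
    by (simp add: mi_ht g_def e_def algebra_simps power2_eq_square)
  ultimately have "sectional_curvature ht x v w = (r - s) / (e * g)"
    using \<open>e > 0\<close> by (simp add: sectional_curvature_def power2_eq_square)
  moreover have "(k - 2 * a) * g \<le> r - s"
    using \<open>s \<le> 2 * a * g\<close> \<open>k * g \<le> r\<close> by (simp add: algebra_simps)
  moreover have "exp (- 2 * f x) = 1 / e" by (simp add: e_def exp_minus field_simps)
  moreover have "(k - 2 * a) / e \<le> (r - s) / g / e"
    using \<open>(k - 2 * a) * g \<le> r - s\<close> \<open>g > 0\<close> \<open>e > 0\<close>
    by (intro divide_right_mono) (auto simp: pos_le_divide_eq)
  ultimately show ?thesis
    by (simp add: mult.commute)
qed

text \<open>The Laplacian of \<open>f\<close> for the metric \<open>h\<close>.\<close>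

definition hess_trace :: "real^'n \<Rightarrow> real" where
  "hess_trace x = (\<Sum>i\<in>UNIV. hessvec x (axis i 1) $ i)"

lemma ricci_ht:
  assumes "x \<in> U"
  shows "ricci ht x v w = ricci h x v w - (real CARD('n) - 2) * conf x v w
    - (hess_trace x + (real CARD('n) / 2 - 1) * fd f x (grad x)) * mi x v w"
proof -
  have 1: "(\<Sum>i\<in>UNIV. conf x (axis i 1) w * v $ i) = conf x v w"
    using linear_axis_sum_real'[OF linear_conf[OF assms], of w v]
    by (simp add: conf_sym[OF assms, of _ w])
  have 2: "(\<Sum>i\<in>UNIV. mi x (axis i 1) w * confvec x v $ i) = conf x v w"
    using linear_axis_sum_real'[OF linear_metric_inner(2), of h x w "confvec x v"]
    by (simp add: mi_confvec[OF assms])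
  have 3: "(\<Sum>i\<in>UNIV. fd f x (axis i 1) * grad x $ i) = fd f x (grad x)"
    by (rule linear_axis_sum_real'[OF linear_df[OF assms]])
  have 4: "(\<Sum>i\<in>UNIV. confvec x (axis i 1) $ i)
      = hess_trace x + (real CARD('n) / 2 - 1) * fd f x (grad x)"
    by (simp add: confvec_def sum.distrib sum_subtractf 3 hess_trace_def) (simp add: algebra_simps)
  have "ricci ht x v w = ricci h x v w + (\<Sum>i\<in>UNIV. conf x (axis i 1) w * v $ i)
    - real CARD('n) * conf x v w - mi x v w * (\<Sum>i\<in>UNIV. confvec x (axis i 1) $ i)
    + (\<Sum>i\<in>UNIV. mi x (axis i 1) w * confvec x v $ i)"
    unfolding ricci_def curvature_ht[OF assms]
    by (simp add: sum.distrib sum_subtractf sum_distrib_left)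
  then show ?thesis
    unfolding 1 2 4 by (simp add: algebra_simps)
qed

text \<open>The bound is stated against the old metric, so that no exponential occurs. The slack
  \<open>2 * a\<close> from replacing \<open>CARD('n) - 2\<close> by \<open>CARD('n)\<close> goes in
  the right direction.\<close>

lemma ricci_ht_ge:
  assumes "x \<in> U" "conf x v v \<le> a * mi x v v" "CARD('n) \<ge> 2" "a \<ge> 0"
    and b: "hess_trace x + (real CARD('n) / 2 - 1) * fd f x (grad x) \<le> b"
    and k: "k * mi x v v \<le> ricci h x v v"
  shows "(k - real CARD('n) * a - b) * mi x v v \<le> ricci ht x v v"
proof -
  have "(real CARD('n) - 2) * conf x v v \<le> (real CARD('n) - 2) * (a * mi x v v)"
    using assms by (intro mult_left_mono) auto
  moreover have "(hess_trace x + (real CARD('n) / 2 - 1) * fd f x (grad x)) * mi x v v \<le> b * mi x v v"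
    using b mi_nonneg[OF assms(1)] by (intro mult_right_mono)
  moreover have "0 \<le> 2 * a * mi x v v" using assms mi_nonneg by simp
  ultimately show ?thesis using k unfolding ricci_ht[OF assms(1)] by (simp add: algebra_simps)
qed

end

section \<open>A lower bound for all sectional curvatures at a point\<close>

context coord_metric
begin

lemma mi_lower_bound:
  assumes "x \<in> U" shows "\<exists>l>0. \<forall>v. l * (norm v)\<^sup>2 \<le> mi x v v"
proof -
  have "continuous_on (sphere 0 1) (\<lambda>v. mi x v v)"
    unfolding metric_inner_def
    by (intro continuous_on_inner continuous_on_id linear_continuous_on matrix_vector_mul_bounded_linear)
  moreover have "sphere (0::real^'n) 1 \<noteq> {}" by (metis norm_axis_1 mem_sphere_0 empty_iff)
  ultimately obtain v0 where v0: "v0 \<in> sphere 0 1" "\<And>v. v \<in> sphere 0 1 \<Longrightarrow> mi x v0 v0 \<le> mi x v v"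
    using continuous_attains_inf[OF compact_sphere, of 0 1 "\<lambda>v. mi x v v"] by blast
  have "mi x v0 v0 * (norm v)\<^sup>2 \<le> mi x v v" for v
  proof (cases "v = 0")
    case False
    then have "mi x v0 v0 \<le> mi x (v /\<^sub>R norm v) (v /\<^sub>R norm v)" by (intro v0) simp
    then show ?thesis using False by (simp add: field_simps power2_eq_square)
  qed auto
  moreover have "mi x v0 v0 > 0" using v0(1) by (intro mi_pos assms) auto
  ultimately show ?thesis by blast
qed

text \<open>A vector \<open>w\<close> almost parallel to \<open>v\<close> makes the Gram determinant
  small. Replacing \<open>w\<close> by its part \<open>z\<close> orthogonal to \<open>v\<close>
  changes neither numerator nor denominator, and turns the denominator into a product of two squared
  lengths, which matches the trilinear bound on the numerator. The constant serves as the curvature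
  bound at \<open>p\<close> before the deformation.\<close>

lemma sectional_curvature_bounded_below:
  assumes "x \<in> U"
  shows "\<exists>C. \<forall>v w. v \<noteq> w \<and> independent {v, w} \<longrightarrow> C \<le> sectional_curvature h x v w"
proof -
  interpret c: conformal_metric U h "\<lambda>_. 0" by standard simp
  obtain l where l: "l > 0" "\<And>v. l * (norm v)\<^sup>2 \<le> mi x v v" using mi_lower_bound[OF assms] by blast
  obtain C where C: "C \<ge> 0" "\<And>u v w. norm (curvature h x u v w) \<le> C * (norm u * norm v * norm w)"
    using trilinear_bound[of "curvature h x"] linear_curvature[OF assms] by blast
  have "bounded_bilinear (\<lambda>a b. mi x a b)"
    unfolding bilinear_conv_bounded_bilinear[symmetric] bilinear_def by (auto intro: linear_metric_inner)
  then obtain L where L: "L \<ge> 0" "\<And>a b. \<bar>mi x a b\<bar> \<le> norm a * norm b * L"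
    using bounded_bilinear.nonneg_bounded real_norm_def by metis
  let ?K = "C * L / l\<^sup>2"
  have "- ?K \<le> sectional_curvature h x v w" if vw: "v \<noteq> w" "independent {v, w}" for v w
  proof -
    have "v \<noteq> 0" using vw(2) dependent_zero by auto
    then have p: "mi x v v > 0" using mi_pos assms by blast
    define c where "c = mi x v w / mi x v v"
    define z where "z = w - c *\<^sub>R v"
    have g: "mi x v v * mi x z z = mi x v v * mi x w w - (mi x v w)\<^sup>2"
      using p mi_sym[OF assms, of w v] by (simp add: z_def c_def field_simps power2_eq_square)
    have vv: "curvature h x v v t = 0" for t
      using curvature_antisym[OF assms, of v v t] by (simp add: vec_eq_iff)
    have r: "mi x (curvature h x v z z) v = mi x (curvature h x v w w) v"
      unfolding z_def
      by (simp add: linear_diff[OF linear_curvature(2)[OF assms]] linear_scale[OF linear_curvature(2)[OF assms]]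
          linear_diff[OF linear_curvature(3)[OF assms]] linear_scale[OF linear_curvature(3)[OF assms]]
          vv curvature_skew[OF assms])
    have "\<bar>mi x (curvature h x v z z) v\<bar> \<le> norm (curvature h x v z z) * norm v * L" by (rule L)
    also have "\<dots> \<le> (C * (norm v * norm z * norm z)) * norm v * L"
      by (intro mult_right_mono C L) auto
    also have "\<dots> = ?K * ((l * (norm v)\<^sup>2) * (l * (norm z)\<^sup>2))"
      using \<open>l > 0\<close> by (simp add: power2_eq_square)
    also have "\<dots> \<le> ?K * (mi x v v * mi x z z)"
      using C L l mi_nonneg[OF assms] by (intro mult_left_mono mult_mono) auto
    finally have "- ?K * (mi x v v * mi x w w - (mi x v w)\<^sup>2) \<le> mi x (curvature h x v w w) v"
      unfolding r g by linarith
    then show ?thesis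
      using c.gram_pos[OF assms vw] unfolding sectional_curvature_def by (simp add: pos_le_divide_eq)
  qed
  then show ?thesis by blast
qed

end

section \<open>Invariance of curvature under changes of coordinates\<close>

lemma fd_linear_family:
  fixes F :: "'a::real_normed_vector \<Rightarrow> real^'n \<Rightarrow> 'b::real_normed_vector"
  assumes "open U" "x \<in> U" and lin: "\<And>y. y \<in> U \<Longrightarrow> linear (F y)"
    and dF: "\<And>z. (\<lambda>y. F y z) differentiable (at x)" and da: "a differentiable (at x)"
  shows "((\<lambda>y. F y (a y)) has_derivative (\<lambda>u. fd (\<lambda>y. F y (a x)) x u + F x (fd a x u))) (at x)"
proof -
  have exp: "F y z = (\<Sum>i\<in>UNIV. z $ i *\<^sub>R F y (axis i 1))" if "y \<in> U" for y z
    using linear_axis_sum[OF lin[OF that]] .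
  have d1: "((\<lambda>y. \<Sum>i\<in>UNIV. z $ i *\<^sub>R F y (axis i 1)) has_derivative
      (\<lambda>u. \<Sum>i\<in>UNIV. z $ i *\<^sub>R fd (\<lambda>y. F y (axis i 1)) x u)) (at x)" for z
    by (intro has_derivative_sum has_derivative_scaleR_right differentiable_fd dF)
  have e1: "fd (\<lambda>y. F y z) x u = (\<Sum>i\<in>UNIV. z $ i *\<^sub>R fd (\<lambda>y. F y (axis i 1)) x u)" for z u
    by (rule fd_eq[OF has_derivative_transform_within_open[OF d1 assms(1,2)]]) (simp add: exp[symmetric])
  have "((\<lambda>y. \<Sum>i\<in>UNIV. a y $ i *\<^sub>R F y (axis i 1)) has_derivative
      (\<lambda>u. \<Sum>i\<in>UNIV. a x $ i *\<^sub>R fd (\<lambda>y. F y (axis i 1)) x u + fd a x u $ i *\<^sub>R F x (axis i 1))) (at x)"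
    by (intro has_derivative_sum has_derivative_scaleR differentiable_fd dF da
        bounded_linear.has_derivative[OF bounded_linear_vec_nth])
  moreover have "(\<Sum>i\<in>UNIV. a x $ i *\<^sub>R fd (\<lambda>y. F y (axis i 1)) x u + fd a x u $ i *\<^sub>R F x (axis i 1))
      = fd (\<lambda>y. F y (a x)) x u + F x (fd a x u)" for u
    by (simp add: sum.distrib e1[of "a x"] exp[OF assms(2), of "fd a x u"])
  ultimately have "((\<lambda>y. \<Sum>i\<in>UNIV. a y $ i *\<^sub>R F y (axis i 1)) has_derivative
      (\<lambda>u. fd (\<lambda>y. F y (a x)) x u + F x (fd a x u))) (at x)" by simp
  then show ?thesis
    by (rule has_derivative_transform_within_open[OF _ assms(1,2)]) (rule exp[symmetric])
qed

text \<open>Besides smoothness, only the pull-back relation is required of \<open>\<tau>\<close>: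
  positivity of \<open>h\<close> makes \<open>J x\<close> injective, hence bijective for reasons of
  dimension.\<close>

locale metric_transition = H: coord_metric U h + H': coord_metric V h'
  for U V :: "(real^'n) set" and h h' +
  fixes \<tau> :: "real^'n \<Rightarrow> real^'n"
  assumes smooth_\<tau>: "smooth_on U \<tau>" and \<tau>_in: "\<And>x. x \<in> U \<Longrightarrow> \<tau> x \<in> V"
    and pull: "\<And>x v w. x \<in> U \<Longrightarrow>
      metric_inner h x v w = metric_inner h' (\<tau> x) (fd \<tau> x v) (fd \<tau> x w)"
begin

abbreviation "J x v \<equiv> fd \<tau> x v"
abbreviation "D2 x u v \<equiv> fd (\<lambda>y. fd \<tau> y v) x u"
abbreviation "\<Gamma>' \<equiv> chr h'"

lemma differentiable_J: "x \<in> U \<Longrightarrow> (\<lambda>y. J y v) differentiable (at x)"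
  using smooth_on_differentiable[OF smooth_on_fd[OF smooth_\<tau>]] .

lemma linear_J: "x \<in> U \<Longrightarrow> linear (J x)"
  using linear_fd[OF smooth_on_differentiable[OF smooth_\<tau>]] by simp

lemmas J_simps = linear_add[OF linear_J] linear_diff[OF linear_J] linear_scale[OF linear_J]

lemma D2_sym: "x \<in> U \<Longrightarrow> D2 x u v = D2 x v u"
  by (rule fd_commute[OF H.open_U smooth_\<tau>])

lemma inj_J: "x \<in> U \<Longrightarrow> J x v = 0 \<Longrightarrow> v = 0"
  using H.mi_pos[of x v] pull[of x v v] by force

lemma surj_J:
  assumes "x \<in> U" shows "\<exists>w. J x w = z"
proof -
  have "inj (J x)" using inj_J[OF assms] linear_J[OF assms] linear_injective_0 by blast
  then show ?thesis using linear_injective_imp_surjective linear_J[OF assms] by (metis surjE)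
qed

lemma has_derivative_\<tau>: "x \<in> U \<Longrightarrow> (\<tau> has_derivative J x) (at x)"
  using smooth_on_has_derivative[OF smooth_\<tau>] by simp

lemma dm_pull:
  assumes "x \<in> U"
  shows "dmetric h x u v w = dmetric h' (\<tau> x) (J x u) (J x v) (J x w)
    + metric_inner h' (\<tau> x) (D2 x u v) (J x w) + metric_inner h' (\<tau> x) (J x v) (D2 x u w)"
proof -
  have hh: "((\<lambda>y. h' (\<tau> y)) has_derivative (\<lambda>u. fd h' (\<tau> x) (J x u))) (at x)"
    using diff_chain_at[OF has_derivative_\<tau>[OF assms]
        smooth_on_has_derivative[OF H'.smooth_h \<tau>_in[OF assms]]] by (simp add: o_def)
  have JJ: "((\<lambda>y. J y z) has_derivative (\<lambda>u. D2 x u z)) (at x)" for z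
    by (rule differentiable_fd[OF differentiable_J[OF assms]])
  have "((\<lambda>y. J y v \<bullet> (h' (\<tau> y) *v J y w)) has_derivative
      (\<lambda>u. J x v \<bullet> (h' (\<tau> x) *v D2 x u w + fd h' (\<tau> x) (J x u) *v J x w)
        + D2 x u v \<bullet> (h' (\<tau> x) *v J x w))) (at x)"
    by (intro bounded_bilinear.FDERIV[OF bounded_bilinear_inner]
        bounded_bilinear.FDERIV[OF bounded_bilinear_matrix_vector_mult] hh JJ)
  then have "((\<lambda>y. metric_inner h y v w) has_derivative
      (\<lambda>u. J x v \<bullet> (h' (\<tau> x) *v D2 x u w + fd h' (\<tau> x) (J x u) *v J x w)
        + D2 x u v \<bullet> (h' (\<tau> x) *v J x w))) (at x)"
    by (rule has_derivative_transform_within_open[OF _ H.open_U assms])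
      (simp only: pull, simp only: metric_inner_def)
  from fd_eq[OF this, of u] show ?thesis
    unfolding H.fd_mi_const[OF assms]
    by (simp add: dmetric_def metric_inner_def inner_add_right)
qed

text \<open>The transformation law of the Christoffel symbols. As \<open>J x\<close> is surjective,
  it can be tested against vectors \<open>J x w\<close>, where \<open>dm_pull\<close> compares the
  Koszul formulas of the two metrics.\<close>

lemma chr_pull:
  assumes "x \<in> U"
  shows "J x (chr h x u v) = D2 x u v + \<Gamma>' (\<tau> x) (J x u) (J x v)"
proof (rule H'.mi_eqI[OF \<tau>_in[OF assms]])
  fix z
  obtain w where w: "z = J x w" using surj_J[OF assms] by metis
  note t = \<tau>_in[OF assms]
  have "metric_inner h' (\<tau> x) (J x (chr h x u v)) z = H.koszul x u v w"
    unfolding w pull[OF assms, symmetric] by (rule H.mi_chr[OF assms])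
  also have "\<dots> = metric_inner h' (\<tau> x) (D2 x u v + \<Gamma>' (\<tau> x) (J x u) (J x v)) z"
    unfolding H.koszul_def dm_pull[OF assms] w
    by (simp add: H'.mi_chr[OF t] H'.koszul_def D2_sym[OF assms, where u=v and v=u] D2_sym[OF assms, where u=w]
        H'.mi_sym[OF t, of "J x u"] H'.mi_sym[OF t, of "J x v"] field_simps)
  finally show "metric_inner h' (\<tau> x) (J x (chr h x u v)) z
    = metric_inner h' (\<tau> x) (D2 x u v + \<Gamma>' (\<tau> x) (J x u) (J x v)) z" .
qed

lemma fd_chr_pull:
  assumes "x \<in> U"
  shows "D2 x u (chr h x v w) + J x (H.D\<Gamma> x u v w)
    = fd (\<lambda>y. D2 y v w) x u + H'.D\<Gamma> (\<tau> x) (J x u) (J x v) (J x w)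
      + \<Gamma>' (\<tau> x) (D2 x u v) (J x w) + \<Gamma>' (\<tau> x) (J x v) (D2 x u w)"
proof -
  have l: "((\<lambda>y. J y (chr h y v w)) has_derivative
      (\<lambda>u. D2 x u (chr h x v w) + J x (H.D\<Gamma> x u v w))) (at x)"
    by (rule fd_linear_family[where F="\<lambda>y z. J y z", OF H.open_U assms])
      (auto intro: linear_J differentiable_J H.differentiable_chr assms)
  have c: "((\<lambda>y. \<Gamma>' (\<tau> y) a b) has_derivative (\<lambda>u. H'.D\<Gamma> (\<tau> x) (J x u) a b)) (at x)" for a b
    using diff_chain_at[OF has_derivative_\<tau>[OF assms]
        smooth_on_has_derivative[OF H'.smooth_chr \<tau>_in[OF assms]]] by (simp add: o_def)
  have c1: "((\<lambda>y. \<Gamma>' (\<tau> y) (J y v) b) has_derivative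
      (\<lambda>u. H'.D\<Gamma> (\<tau> x) (J x u) (J x v) b + \<Gamma>' (\<tau> x) (D2 x u v) b)) (at x)" for b
    using fd_linear_family[where F="\<lambda>y z. \<Gamma>' (\<tau> y) z b" and a="\<lambda>y. J y v", OF H.open_U assms linear_chr(1)]
      fd_eq[OF c] differentiableI[OF c] differentiable_J[OF assms] by simp
  have c2: "((\<lambda>y. \<Gamma>' (\<tau> y) (J y v) (J y w)) has_derivative
      (\<lambda>u. H'.D\<Gamma> (\<tau> x) (J x u) (J x v) (J x w) + \<Gamma>' (\<tau> x) (D2 x u v) (J x w) + \<Gamma>' (\<tau> x) (J x v) (D2 x u w))) (at x)"
    using fd_linear_family[where F="\<lambda>y z. \<Gamma>' (\<tau> y) (J y v) z" and a="\<lambda>y. J y w", OF H.open_U assms linear_chr(2)]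
      fd_eq[OF c1] differentiableI[OF c1] differentiable_J[OF assms] by simp
  have d: "((\<lambda>y. D2 y v w) has_derivative (\<lambda>u. fd (\<lambda>y. D2 y v w) x u)) (at x)"
    by (rule smooth_on_has_derivative[OF smooth_on_fd[OF smooth_on_fd[OF smooth_\<tau>]] assms])
  have "((\<lambda>y. J y (chr h y v w)) has_derivative (\<lambda>u. fd (\<lambda>y. D2 y v w) x u
      + (H'.D\<Gamma> (\<tau> x) (J x u) (J x v) (J x w) + \<Gamma>' (\<tau> x) (D2 x u v) (J x w) + \<Gamma>' (\<tau> x) (J x v) (D2 x u w)))) (at x)"
    by (rule has_derivative_transform_within_open[OF has_derivative_add[OF d c2] H.open_U assms])
      (simp add: chr_pull)
  from fd_eq[OF this, of u] fd_eq[OF l, of u] show ?thesis by (simp add: add.assoc)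
qed

lemma D3_sym:
  assumes "x \<in> U" shows "fd (\<lambda>y. D2 y v w) x u = fd (\<lambda>y. D2 y u w) x v"
  by (rule fd_commute[OF H.open_U smooth_on_fd[OF smooth_\<tau>] assms])

text \<open>The differentiated transformation law is antisymmetrised in \<open>u\<close> and
  \<open>v\<close>; the terms with second and third derivatives of \<open>\<tau>\<close> are
  symmetric together and drop out.\<close>

lemma curvature_pull:
  assumes "x \<in> U"
  shows "J x (curvature h x u v w) = curvature h' (\<tau> x) (J x u) (J x v) (J x w)"
proof -
  note t = \<tau>_in[OF assms]
  have "J x (H.D\<Gamma> x u v w) + J x (chr h x u (chr h x v w))
    = fd (\<lambda>y. D2 y v w) x u + H'.D\<Gamma> (\<tau> x) (J x u) (J x v) (J x w)
      + \<Gamma>' (\<tau> x) (J x u) (\<Gamma>' (\<tau> x) (J x v) (J x w))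
      + \<Gamma>' (\<tau> x) (D2 x u v) (J x w) + \<Gamma>' (\<tau> x) (J x v) (D2 x u w) + \<Gamma>' (\<tau> x) (J x u) (D2 x v w)" for u v
    using fd_chr_pull[OF assms, where u=u and v=v and w=w] chr_pull[OF assms, where u=u and v="chr h x v w"]
    by (simp add: chr_pull[OF assms, where u=v and v=w] algebra_simps)
  note e = this[where u=u and v=v] this[where u=v and v=u]
  show ?thesis
    unfolding H.curvature_chr[OF assms] H'.curvature_chr[OF t]
    using e D3_sym[OF assms, where u=u and v=v and w=w] D2_sym[OF assms, where u=u and v=v]
    by (simp add: J_simps assms algebra_simps)
qed

lemma sectional_curvature_pull:
  "x \<in> U \<Longrightarrow> sectional_curvature h x v w = sectional_curvature h' (\<tau> x) (J x v) (J x w)"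
  unfolding sectional_curvature_def by (simp add: pull curvature_pull)

text \<open>The two endomorphisms whose traces are taken are conjugate by
  \<open>J x\<close>.\<close>

lemma ricci_pull:
  assumes "x \<in> U"
  shows "ricci h x v w = ricci h' (\<tau> x) (J x v) (J x w)"
proof -
  define j where "j = matrix (J x)"
  define L where "L = matrix (\<lambda>u. curvature h x u v w)"
  define L' where "L' = matrix (\<lambda>u. curvature h' (\<tau> x) u (J x v) (J x w))"
  have j: "j *v u = J x u" for u
    using linear_J[OF assms] by (simp add: j_def matrix_works)
  have l: "L *v u = curvature h x u v w" for u
    using H.linear_curvature(1)[OF assms] by (simp add: L_def matrix_works)
  have l': "L' *v u = curvature h' (\<tau> x) u (J x v) (J x w)" for u
    using H'.linear_curvature(1)[OF \<tau>_in[OF assms]] by (simp add: L'_def matrix_works)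
  have jL: "j ** L = L' ** j"
    by (simp add: matrix_eq matrix_vector_mul_assoc[symmetric] j l l' curvature_pull[OF assms])
  have "invertible j"
    unfolding invertible_left_inverse matrix_left_invertible_ker using inj_J[OF assms] by (simp add: j)
  then obtain k where k: "j ** k = mat 1" "k ** j = mat 1" by (auto simp: invertible_def)
  have "trace L = trace (k ** (j ** L))" by (simp add: matrix_mul_assoc k)
  also have "\<dots> = trace ((k ** L') ** j)" by (simp add: jL matrix_mul_assoc)
  also have "\<dots> = trace (j ** (k ** L'))" by (rule trace_mul_sym)
  also have "\<dots> = trace L'" by (simp add: matrix_mul_assoc k)
  finally show ?thesis
    by (simp add: trace_def ricci_def L_def L'_def matrix_def)
qed

end

section \<open>Smooth cut-off functions and the radial profile\<close>

definition flat_exp :: "nat \<Rightarrow> real \<Rightarrow> real" where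
  "flat_exp k t = (if t > 0 then (1 / t) ^ k * exp (- (1 / t)) else 0)"

text \<open>The powers of \<open>1 / t\<close> are included so that the family is closed under
  differentiation: each member differentiates into the next two. At 0 the exponential beats every
  power.\<close>

lemma flat_exp_has_derivative:
  "(flat_exp k has_real_derivative - real k * flat_exp (k + 1) t + flat_exp (k + 2) t) (at t)"
proof -
  consider "t < 0" | "t > 0" | "t = 0" by linarith
  then show ?thesis
  proof cases
    case 1
    then have "((\<lambda>t. 0) has_real_derivative - real k * flat_exp (k + 1) t + flat_exp (k + 2) t) (at t)"
      by (simp add: flat_exp_def)
    then show ?thesis
      by (rule has_field_derivative_transform_within_open[where S="{..<0}"]) (use 1 in \<open>auto simp: flat_exp_def\<close>)
  next
    case 2
    have "((\<lambda>t. inverse t ^ k * exp (- inverse t)) has_real_derivative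
        real k * inverse t ^ (k - 1) * (- (inverse t ^ 2)) * exp (- inverse t)
        + inverse t ^ k * (exp (- inverse t) * inverse t ^ 2)) (at t)"
      using 2 by (auto intro!: derivative_eq_intros simp: power2_eq_square)
    moreover have "real k * inverse t ^ (k - 1) * (- (inverse t ^ 2)) = - real k * inverse t ^ (k + 1)"
      by (cases k) (auto simp: power2_eq_square algebra_simps)
    then have "real k * inverse t ^ (k - 1) * (- (inverse t ^ 2)) * exp (- inverse t)
        + inverse t ^ k * (exp (- inverse t) * inverse t ^ 2)
        = - real k * flat_exp (k + 1) t + flat_exp (k + 2) t"
      using 2 by (simp only:) (simp add: flat_exp_def inverse_eq_divide power_add power2_eq_square mult_ac)
    ultimately have "((\<lambda>t. inverse t ^ k * exp (- inverse t)) has_real_derivative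
        - real k * flat_exp (k + 1) t + flat_exp (k + 2) t) (at t)"
      by (rule DERIV_cong)
    then show ?thesis
      by (rule has_field_derivative_transform_within_open[where S="{0<..}"])
        (use 2 in \<open>auto simp: flat_exp_def inverse_eq_divide\<close>)
  next
    case 3
    have "((\<lambda>t. (1 / t) ^ k * exp (- (1 / t)) / t) \<longlongrightarrow> 0) (at_right (0::real))"
      by real_asymp
    then have "((\<lambda>t. flat_exp k t / t) \<longlongrightarrow> 0) (at_right 0)"
      by (rule Lim_transform_eventually) (auto simp: flat_exp_def eventually_at_right_less intro: eventually_mono[OF eventually_at_right_less])
    moreover have "((\<lambda>t. flat_exp k t / t) \<longlongrightarrow> 0) (at_left 0)"
      by (rule Lim_transform_eventually[OF tendsto_const])
        (auto simp: flat_exp_def eventually_at_left_field intro!: exI[of _ "-1"])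
    ultimately have "((\<lambda>t. flat_exp k t / t) \<longlongrightarrow> 0) (at 0)"
      by (simp add: filterlim_split_at)
    then show ?thesis
      using 3 by (simp add: DERIV_def flat_exp_def)
  qed
qed

lemma smooth_on_flat_exp: "smooth_on UNIV (flat_exp k)"
proof (rule smooth_on_derivative_system[where J="\<lambda>k. {k + 1, k + 2}"
      and c="\<lambda>k j. if j = k + 1 then - real k else 1"])
  show "(flat_exp k has_real_derivative
      (\<Sum>j\<in>{k + 1, k + 2}. (if j = k + 1 then - real k else 1) * flat_exp j t)) (at t)" for k t
    using flat_exp_has_derivative[of k t] by simp
qed simp

definition smooth_step :: "real \<Rightarrow> real" where
  "smooth_step t = flat_exp 0 (1 - t) / (flat_exp 0 (1 - t) + flat_exp 0 t)"

lemma flat_exp_0_nonneg: "flat_exp 0 t \<ge> 0"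
  and flat_exp_0_pos: "t > 0 \<Longrightarrow> flat_exp 0 t > 0"
  by (auto simp: flat_exp_def)

lemma smooth_step_denom: "flat_exp 0 (1 - t) + flat_exp 0 t > 0"
proof (cases "t > 0")
  case True
  then show ?thesis using flat_exp_0_pos[of t] flat_exp_0_nonneg[of "1 - t"] by linarith
next
  case False
  then show ?thesis using flat_exp_0_pos[of "1 - t"] flat_exp_0_nonneg[of t] by linarith
qed

lemma smooth_step_bounds: "0 \<le> smooth_step t" "smooth_step t \<le> 1"
  using smooth_step_denom[of t] flat_exp_0_nonneg[of t] flat_exp_0_nonneg[of "1 - t"]
  by (auto simp: smooth_step_def)

lemma smooth_step_left: "t \<le> 0 \<Longrightarrow> smooth_step t = 1"
  using smooth_step_denom[of t] by (simp add: smooth_step_def flat_exp_def)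

lemma smooth_step_right: "t \<ge> 1 \<Longrightarrow> smooth_step t = 0"
  by (simp add: smooth_step_def flat_exp_def)

lemma smooth_on_smooth_step: "smooth_on UNIV smooth_step"
proof -
  have 1: "smooth_on UNIV (\<lambda>t. flat_exp 0 (1 - t))"
    by (rule smooth_on_compose[OF open_UNIV open_UNIV _ smooth_on_flat_exp])
      (auto intro!: smooth_on_diff)
  show ?thesis
    unfolding smooth_step_def[abs_def]
    by (intro smooth_on_divide smooth_on_add 1 smooth_on_flat_exp open_UNIV)
      (rule less_imp_neq[OF smooth_step_denom, symmetric])
qed

lemma smooth_on_DERIV:
  fixes f :: "real \<Rightarrow> real"
  assumes "smooth_on S f" "s \<in> S" shows "(f has_real_derivative fd f s 1) (at s)"
proof -
  have "fd f s v = fd f s 1 * v" for v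
    using linear_scale[OF linear_fd[OF smooth_on_differentiable[OF assms]], of v 1] by simp
  then have "(\<lambda>v. fd f s v) = (*) (fd f s 1)" by (rule ext)
  from has_derivative_eq_rhs[OF smooth_on_has_derivative[OF assms] this]
  show ?thesis unfolding has_field_derivative_def .
qed

lemma fd_locally_constant:
  assumes "open S" "x \<in> S" "\<And>y. y \<in> S \<Longrightarrow> f y = c" shows "fd f x v = 0"
  by (rule fd_eq[OF has_derivative_transform_within_open[OF has_derivative_const assms(1,2)]])
    (simp add: assms(3))

lemma smooth_step_derivative_bound: "\<exists>B>0. \<forall>t. \<bar>fd smooth_step t 1\<bar> \<le> B"
proof -
  have "continuous_on {0..1} (\<lambda>t. \<bar>fd smooth_step t 1\<bar>)"
    by (intro continuous_on_rabs continuous_on_subset[OF smooth_on_continuous[OF smooth_on_fd]])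
      (use smooth_on_smooth_step in auto)
  then obtain B where B: "\<And>t. t \<in> {0..1} \<Longrightarrow> \<bar>fd smooth_step t 1\<bar> \<le> B"
    using continuous_attains_sup[of "{0..1::real}" "\<lambda>t. \<bar>fd smooth_step t 1\<bar>"] by fastforce
  have "\<bar>fd smooth_step t 1\<bar> \<le> max B 1" for t
  proof -
    consider "t < 0" | "t > 1" | "t \<in> {0..1}" by fastforce
    then show ?thesis
    proof cases
      case 1
      then show ?thesis
        using fd_locally_constant[of "{..<0}" t smooth_step 1 1] smooth_step_left by auto
    next
      case 2
      then show ?thesis
        using fd_locally_constant[of "{1<..}" t smooth_step 0 1] smooth_step_right by auto
    qed (use B in fastforce)
  qed
  then show ?thesis by (intro exI[of _ "max B 1"]) auto
qed

text \<open>The profile is a smoothed truncation of a multiple of \<open>ln (s\<^sub>0 / s)\<close>: this makes \<open>s * y' s\<close>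
  uniformly small, although \<open>y 0\<close> is large and \<open>y\<close> vanishes beyond the small radius \<open>s\<^sub>0\<close>.\<close>

lemma radial_profile:
  assumes "\<kappa> > 0" "\<mu> > 0" "s\<^sub>0 > 0"
  obtains F y where "smooth_on UNIV F" "smooth_on UNIV y"
    "\<And>s. (F has_real_derivative - y s) (at s)" "y 0 = \<kappa>"
    "\<And>s. 0 \<le> y s" "\<And>s. y s \<le> \<kappa>" "\<And>s. s \<ge> 0 \<Longrightarrow> - s * fd y s 1 \<le> \<mu>"
    "\<And>s. s \<ge> s\<^sub>0 \<Longrightarrow> F s = 0" "\<And>s. s \<ge> s\<^sub>0 \<Longrightarrow> y s = 0"
    "\<And>s. s \<ge> 0 \<Longrightarrow> 0 \<le> F s" "\<And>s. s \<ge> 0 \<Longrightarrow> F s \<le> \<kappa> * s\<^sub>0"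
proof -
  obtain B where B: "B > 0" "\<And>t. \<bar>fd smooth_step t 1\<bar> \<le> B" using smooth_step_derivative_bound by blast
  \<comment> \<open>\<open>L\<close> is the length of the transition on the scale of
    \<open>ln s\<close>. The slopes of \<open>smooth_step\<close> are at most \<open>B\<close>, so
    \<open>- s * y' s\<close> is at most \<open>\<kappa> * B / L = \<mu>\<close>.\<close>
  define L where "L = \<kappa> * B / \<mu>"
  have "L > 0" using assms B by (simp add: L_def)
  \<comment> \<open>Affine in \<open>ln s\<close>, with value 1 at \<open>s\<^sub>0\<close> and
    value 0 at \<open>s\<^sub>1\<close> below, so that \<open>y\<close> is constant on either side
    of the interval between them.\<close>
  define a where "a s = (ln s - ln s\<^sub>0) / L + 1" for s
  define y where "y s = (if s \<le> 0 then \<kappa> else \<kappa> * smooth_step (a s))" for s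
  define s\<^sub>1 where "s\<^sub>1 = s\<^sub>0 * exp (- L)"
  have "s\<^sub>1 > 0" using assms by (simp add: s\<^sub>1_def)
  have small: "y s = \<kappa>" if "s < s\<^sub>1" for s
  proof (cases "s \<le> 0")
    case False
    then have "ln s \<le> ln s\<^sub>1" using that by simp
    also have "\<dots> = ln s\<^sub>0 - L" using assms by (simp add: s\<^sub>1_def ln_mult)
    finally have "a s \<le> 0" using \<open>L > 0\<close> by (simp add: a_def field_simps)
    then show ?thesis by (simp add: y_def smooth_step_left)
  qed (simp add: y_def)
  have large: "y s = 0" if "s \<ge> s\<^sub>0" for s
  proof -
    have "s > 0" "ln s\<^sub>0 \<le> ln s" using that assms by auto
    then have "a s \<ge> 1" using \<open>L > 0\<close> by (simp add: a_def)
    then show ?thesis using \<open>s > 0\<close> by (simp add: y_def smooth_step_right)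
  qed
  have sm_pos: "smooth_on {0<..} y"
  proof (rule smooth_on_cong[where f="\<lambda>s. \<kappa> * smooth_step (a s)"])
    have "smooth_on {0<..} a"
      unfolding a_def[abs_def] by (intro smooth_on_add smooth_on_divide smooth_on_diff smooth_on_ln)
        (use \<open>L > 0\<close> in auto)
    then show "smooth_on {0<..} (\<lambda>s. \<kappa> * smooth_step (a s))"
      by (intro smooth_on_mult smooth_on_const smooth_on_compose[OF _ open_UNIV _ smooth_on_smooth_step]) auto
  qed (auto simp: y_def)
  have "smooth_on {..<s\<^sub>1} y"
    by (rule smooth_on_cong[OF _ _ smooth_on_const[of _ \<kappa>]]) (auto simp: small)
  have sm: "smooth_on UNIV y"
  proof (rule smooth_on_local)
    fix s :: real
    show "\<exists>T. open T \<and> s \<in> T \<and> smooth_on T y"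
    proof (cases "s < s\<^sub>1")
      case True
      then show ?thesis using \<open>smooth_on {..<s\<^sub>1} y\<close> by (intro exI[of _ "{..<s\<^sub>1}"]) auto
    next
      case False
      then show ?thesis using sm_pos \<open>s\<^sub>1 > 0\<close> by (intro exI[of _ "{0<..}"]) auto
    qed
  qed
  have "\<exists>G. \<forall>s. -\<infinity> < ereal s \<longrightarrow> ereal s < \<infinity> \<longrightarrow> (G has_vector_derivative - y s) (at s)"
    using smooth_on_continuous[OF sm]
    by (intro einterval_antiderivative) (auto simp: continuous_on_eq_continuous_at intro!: continuous_intros)
  then obtain G where G: "\<And>s. (G has_real_derivative - y s) (at s)"
    by (auto simp: has_real_derivative_iff_has_vector_derivative)
  \<comment> \<open>The constant makes \<open>F\<close> vanish at \<open>s\<^sub>0\<close>, and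
    hence beyond it, where its derivative is 0.\<close>
  define F where "F s = G s - G s\<^sub>0" for s
  have dF: "(F has_real_derivative - y s) (at s)" for s
    unfolding F_def[abs_def] using G by (auto intro!: derivative_eq_intros)
  have y0: "0 \<le> y s" and y1: "y s \<le> \<kappa>" for s
    using assms smooth_step_bounds[of "a s"] by (auto simp: y_def mult_left_le)
  have F0: "F s = 0" if "s \<ge> s\<^sub>0" for s
  proof (cases "s = s\<^sub>0")
    case False
    then have "s\<^sub>0 < s" using that by simp
    then obtain z where "s\<^sub>0 < z" "F s - F s\<^sub>0 = (s - s\<^sub>0) * - y z"
      using MVT2[of s\<^sub>0 s F "\<lambda>s. - y s"] dF by blast
    then show ?thesis using large[of z] by (simp add: F_def)
  qed (simp add: F_def)
  have F1: "0 \<le> F s \<and> F s \<le> \<kappa> * s\<^sub>0" if "s \<ge> 0" for s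
  proof (cases "s < s\<^sub>0")
    case True
    then obtain z where z: "F s\<^sub>0 - F s = (s\<^sub>0 - s) * - y z"
      using MVT2[of s s\<^sub>0 F "\<lambda>s. - y s"] dF by blast
    have "(s\<^sub>0 - s) * y z \<le> s\<^sub>0 * \<kappa>"
      using y0 y1 that True assms by (intro mult_mono) auto
    moreover have "F s\<^sub>0 = 0" by (simp add: F_def)
    ultimately show ?thesis using z y0[of z] True by (simp add: mult.commute)
  qed (use F0 assms in auto)
  have small_slope: "- s * fd y s 1 \<le> \<mu>" if "s \<ge> 0" for s
  proof (cases "s = 0")
    case False
    then have "s > 0" using that by simp
    have "(a has_real_derivative 1 / (L * s)) (at s)"
      unfolding a_def[abs_def] using \<open>s > 0\<close> \<open>L > 0\<close> by (auto intro!: derivative_eq_intros simp: field_simps)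
    from DERIV_chain2[OF smooth_on_DERIV[OF smooth_on_smooth_step UNIV_I] this]
    have "((\<lambda>s. \<kappa> * smooth_step (a s)) has_real_derivative \<kappa> * (fd smooth_step (a s) 1 * (1 / (L * s)))) (at s)"
      by (rule DERIV_cmult)
    then have "(y has_real_derivative \<kappa> * (fd smooth_step (a s) 1 * (1 / (L * s)))) (at s)"
      by (rule has_field_derivative_transform_within_open[where S="{0<..}"]) (use \<open>s > 0\<close> in \<open>auto simp: y_def\<close>)
    with smooth_on_DERIV[OF sm UNIV_I] have "fd y s 1 = \<kappa> * (fd smooth_step (a s) 1 * (1 / (L * s)))"
      using DERIV_unique by blast
    then have "- s * fd y s 1 = \<kappa> * - fd smooth_step (a s) 1 / L" using \<open>s > 0\<close> by simp
    also have "\<dots> \<le> \<kappa> * B / L"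
      using B(2)[of "a s"] assms \<open>L > 0\<close> by (intro divide_right_mono mult_left_mono) auto
    also have "\<dots> = \<mu>" using assms B by (simp add: L_def)
    finally show ?thesis .
  qed (use assms in simp)
  have "smooth_on UNIV F"
    by (rule smooth_on_antiderivative[OF open_UNIV dF]) (intro smooth_on_uminus open_UNIV sm)
  then show ?thesis
    using that[of F y] sm dF small[of 0] \<open>s\<^sub>1 > 0\<close> y0 y1 small_slope F0 large F1 by blast
qed

section \<open>Second-order estimates near a point\<close>

lemma Taylor_second_order_le:
  fixes q :: "real^'n \<Rightarrow> real"
  assumes "smooth_on U q" "\<And>t. 0 \<le> t \<Longrightarrow> t \<le> 1 \<Longrightarrow> x + t *\<^sub>R v \<in> U"
    and M: "\<And>t. 0 \<le> t \<Longrightarrow> t \<le> 1 \<Longrightarrow> fd (\<lambda>y. fd q y v) (x + t *\<^sub>R v) v \<le> M"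
  shows "q (x + v) \<le> q x + fd q x v + M / 2"
proof -
  have along: "((\<lambda>r. g (x + r *\<^sub>R v)) has_real_derivative fd g (x + t *\<^sub>R v) v) (at t)"
    if "smooth_on U g" "0 \<le> t" "t \<le> 1" for g :: "real^'n \<Rightarrow> real" and t
    by (rule DERIV_along_line[OF smooth_on_has_derivative[OF that(1) assms(2)[OF that(2,3)]]])
  define diff where "diff m t = (if m = 0 then q (x + t *\<^sub>R v) else if m = 1 then fd q (x + t *\<^sub>R v) v
    else fd (\<lambda>y. fd q y v) (x + t *\<^sub>R v) v)" for m :: nat and t :: real
  have "\<exists>t>0. t < 1 \<and> diff 0 1 = (\<Sum>m<2. diff m 0 / fact m * 1 ^ m) + diff 2 t / fact 2 * 1 ^ 2"
  proof (rule Maclaurin)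
    show "\<forall>m t. m < 2 \<and> 0 \<le> t \<and> t \<le> 1 \<longrightarrow> DERIV (diff m) t :> diff (Suc m) t"
      using along[OF assms(1)] along[OF smooth_on_fd[OF assms(1)]]
      by (auto simp: diff_def[abs_def] less_2_cases_iff)
  qed auto
  then obtain t where t: "0 < t" "t < 1" "q (x + v) = q x + fd q x v + diff 2 t / 2"
    by (auto simp: diff_def numeral_2_eq_2)
  have "diff 2 t \<le> M" using M[of t] t by (simp add: diff_def)
  then show ?thesis using t by simp
qed

lemma form_le_entries:
  fixes G :: "real^'n \<Rightarrow> real^'n \<Rightarrow> real"
  assumes "\<And>w. linear (\<lambda>v. G v w)" "\<And>v. linear (G v)"
  shows "\<bar>G v v\<bar> \<le> (\<Sum>i\<in>UNIV. \<Sum>j\<in>UNIV. \<bar>G (axis i 1) (axis j 1)\<bar>) * (norm v)\<^sup>2"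
proof -
  have "G v v = (\<Sum>i\<in>UNIV. v $ i * G (axis i 1) v)"
    using linear_axis_sum_real[OF assms(1)] by simp
  also have "\<dots> = (\<Sum>i\<in>UNIV. v $ i * (\<Sum>j\<in>UNIV. v $ j * G (axis i 1) (axis j 1)))"
    using linear_axis_sum_real[OF assms(2)] by simp
  finally have "\<bar>G v v\<bar> \<le> (\<Sum>i\<in>UNIV. \<Sum>j\<in>UNIV. \<bar>v $ i * (v $ j * G (axis i 1) (axis j 1))\<bar>)"
    by (simp add: sum_distrib_left) (intro order_trans[OF sum_abs] sum_mono order_refl)
  also have "\<dots> \<le> (\<Sum>i\<in>UNIV. \<Sum>j\<in>UNIV. \<bar>G (axis i 1) (axis j 1)\<bar> * (norm v)\<^sup>2)"
  proof (intro sum_mono)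
    fix i j
    have "\<bar>v $ i\<bar> * \<bar>v $ j\<bar> \<le> norm v * norm v"
      by (intro mult_mono component_le_norm_cart) auto
    then have "\<bar>G (axis i 1) (axis j 1)\<bar> * (\<bar>v $ i\<bar> * \<bar>v $ j\<bar>) \<le> \<bar>G (axis i 1) (axis j 1)\<bar> * (norm v)\<^sup>2"
      unfolding power2_eq_square by (intro mult_left_mono) auto
    then show "\<bar>v $ i * (v $ j * G (axis i 1) (axis j 1))\<bar> \<le> \<bar>G (axis i 1) (axis j 1)\<bar> * (norm v)\<^sup>2"
      by (simp add: abs_mult mult_ac)
  qed
  finally show ?thesis by (simp add: sum_distrib_right)
qed

lemma open_smaller:
  fixes g :: "'a::topological_space \<Rightarrow> real"
  assumes "open U" "continuous_on U g"
  shows "open {x \<in> U. g x < c}" "open {x \<in> U. c < g x}"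
  using continuous_open_preimage[OF assms(2,1), of "{..<c}"] continuous_open_preimage[OF assms(2,1), of "{c<..}"]
  by (simp_all add: Int_def vimage_def)

context coord_metric
begin

text \<open>Closeness for all \<open>v\<close> at once follows from closeness of the finitely many
  entries on axis vectors, which depend continuously on \<open>x\<close>.\<close>

lemma forms_near:
  fixes G :: "real^'n \<Rightarrow> real^'n \<Rightarrow> real^'n \<Rightarrow> real"
  assumes "x0 \<in> U" and lin: "\<And>x w. x \<in> U \<Longrightarrow> linear (\<lambda>v. G x v w)" "\<And>x v. x \<in> U \<Longrightarrow> linear (G x v)"
    and cont: "\<And>v w. continuous_on U (\<lambda>x. G x v w)" and "d > 0"
  shows "\<exists>W. open W \<and> x0 \<in> W \<and> W \<subseteq> U \<and> (\<forall>x\<in>W. \<forall>v. \<bar>G x v v - G x0 v v\<bar> \<le> d * (norm v)\<^sup>2)"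
proof -
  let ?e = "\<lambda>x. \<Sum>i\<in>UNIV. \<Sum>j\<in>UNIV. \<bar>G x (axis i 1) (axis j 1) - G x0 (axis i 1) (axis j 1)\<bar>"
  have "continuous_on U ?e" by (intro continuous_intros cont)
  note op = open_smaller(1)[OF open_U this, of d]
  have "\<bar>G x v v - G x0 v v\<bar> \<le> d * (norm v)\<^sup>2" if "x \<in> U" "?e x < d" for x v
  proof -
    have l: "linear (\<lambda>v. G x v w - G x0 v w)" "linear (\<lambda>w. G x v w - G x0 v w)" for v w
      using lin[OF that(1)] lin[OF assms(1)] by (auto intro!: linear_compose_sub)
    have "\<bar>G x v v - G x0 v v\<bar> \<le> ?e x * (norm v)\<^sup>2"
      by (rule form_le_entries[where G="\<lambda>v w. G x v w - G x0 v w"]) (rule l)+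
    also have "\<dots> \<le> d * (norm v)\<^sup>2" using that(2) by (intro mult_right_mono) auto
    finally show ?thesis .
  qed
  then show ?thesis using op assms by (intro exI[of _ "{x \<in> U. ?e x < d}"]) auto
qed

end

context conformal_metric
begin

lemma hess_mi: "x \<in> U \<Longrightarrow> hess x u w = fd (\<lambda>y. fd f y w) x u - mi x (grad x) (\<Gamma> x u w)"
  by (simp add: hess_def mi_grad)

lemma smooth_hess: "smooth_on U (\<lambda>x. hess x u w)"
proof (rule smooth_on_cong[OF open_U hess_mi[symmetric]])
  show "smooth_on U (\<lambda>x. fd (\<lambda>y. fd f y w) x u - mi x (grad x) (\<Gamma> x u w))"
    by (rule smooth_on_diff[OF open_U smooth_on_fd[OF smooth_on_fd[OF smooth_f]] smooth_mi[OF smooth_grad smooth_chr]])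
qed

lemma continuous_hess_trace: "continuous_on U hess_trace"
proof -
  have "smooth_on U (\<lambda>x. hessvec x u)" for u
    unfolding hessvec_def
    by (intro smooth_on_matrix_inv open_U smooth_h det_h smooth_on_vecI) (simp_all add: smooth_hess)
  then show ?thesis unfolding hess_trace_def[abs_def]
    by (intro continuous_on_sum smooth_on_continuous[of U] smooth_on_nth open_U)
qed

text \<open>Landau's inequality: a nonnegative function with second derivatives bounded by \<open>L\<close>
  satisfies \<open>\<bar>f'\<bar>\<^sup>2 \<le> 2 L f\<close>, away from the boundary.\<close>

lemma gradient_bound_near_zero:
  assumes "x0 \<in> U" "\<And>x. x \<in> U \<Longrightarrow> 0 \<le> f x" "\<And>v. fd f x0 v = 0"
  shows "\<exists>W C. open W \<and> x0 \<in> W \<and> W \<subseteq> U \<and> C > 0 \<and> (\<forall>x\<in>W. fd f x (grad x) \<le> C * f x)"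
proof -
  obtain l where l: "l > 0" "\<And>v. l * (norm v)\<^sup>2 \<le> mi x0 v v" using mi_lower_bound[OF assms(1)] by blast
  obtain W1 where W1: "open W1" "x0 \<in> W1" "W1 \<subseteq> U" "\<And>x v. x \<in> W1 \<Longrightarrow> \<bar>mi x v v - mi x0 v v\<bar> \<le> l / 2 * (norm v)\<^sup>2"
    using forms_near[of x0 mi "l / 2", OF assms(1) linear_metric_inner(2,1)] l(1)
      smooth_on_continuous[OF smooth_mi[OF smooth_on_const smooth_on_const]] by (metis half_gt_zero)
  let ?H = "\<lambda>x u v. fd (\<lambda>y. fd f y v) x u"
  have lin: "linear (\<lambda>u. ?H x u v)" "linear (?H x u)" if "x \<in> U" for x u v
    using ddf_linear[OF that] linear_fd[OF differentiable_fd_f[OF that]] by (auto intro!: linearI)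
  obtain W2 where W2: "open W2" "x0 \<in> W2" "W2 \<subseteq> U" "\<And>x v. x \<in> W2 \<Longrightarrow> \<bar>?H x v v - ?H x0 v v\<bar> \<le> 1 * (norm v)\<^sup>2"
    using forms_near[of x0 ?H 1, OF assms(1) lin smooth_on_continuous[OF smooth_on_fd[OF smooth_on_fd[OF smooth_f]]]]
    by auto
  \<comment> \<open>On \<open>W2\<close> the second derivative along \<open>v\<close> exceeds its
    value at \<open>x0\<close> by at most \<open>(norm v)\<^sup>2\<close>; this accounts for the
    summand 1.\<close>
  define L where "L = (\<Sum>i\<in>UNIV. \<Sum>j\<in>UNIV. \<bar>?H x0 (axis i 1) (axis j 1)\<bar>) + 1"
  have "L > 0" unfolding L_def by (intro add_nonneg_pos sum_nonneg) auto
  have HL: "?H x v v \<le> L * (norm v)\<^sup>2" if "x \<in> W2" for x v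
    using W2(4)[OF that, of v] form_le_entries[of "?H x0" v, OF lin[OF assms(1)]]
    by (simp add: L_def algebra_simps)
  obtain r where r: "r > 0" "ball x0 (2 * r) \<subseteq> W1 \<inter> W2"
  proof -
    obtain e where "e > 0" "ball x0 e \<subseteq> W1 \<inter> W2"
      using W1(1,2) W2(1,2) open_Int open_contains_ball by (metis IntI)
    then show ?thesis using that[of "e / 2"] by simp
  qed
  define a where "a x = (\<chi> i. fd f x (axis i 1))" for x
  have da: "fd f x v = a x \<bullet> v" if "x \<in> U" for x v
    using linear_axis_sum_real'[OF linear_df[OF that], of v] by (simp add: a_def inner_vec_def)
  have "smooth_on U a"
    unfolding a_def[abs_def] by (intro smooth_on_vecI open_U) (simp add: smooth_on_fd smooth_f)
  then have ca: "continuous_on U (\<lambda>x. norm (a x))" by (intro continuous_on_norm smooth_on_continuous)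
  \<comment> \<open>A small gradient keeps the step \<open>v\<close> below shorter than
    \<open>r\<close>, so that the segment from \<open>x\<close> to \<open>x + v\<close> stays in the
    ball of radius \<open>2 * r\<close>.\<close>
  define W where "W = ball x0 r \<inter> {x \<in> U. norm (a x) < L * r}"
  have "a x0 = 0" using assms(3) by (simp add: a_def vec_eq_iff)
  then have x0W: "x0 \<in> W" using assms(1) r(1) \<open>L > 0\<close> by (simp add: W_def)
  have "open W" unfolding W_def by (intro open_Int open_ball open_smaller open_U ca)
  have est: "fd f x (grad x) \<le> (4 * L / l) * f x" if "x \<in> W" for x
  proof -
    have x: "x \<in> U" "dist x0 x < r" "norm (a x) < L * r" using that by (auto simp: W_def)
    \<comment> \<open>The minimiser of the quadratic upper bound
      \<open>f x + a x \<bullet> v + L * (norm v)\<^sup>2 / 2\<close>. Nonnegativity of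
      \<open>f\<close> at \<open>x + v\<close> then bounds the gradient.\<close>
    define v where "v = - (1 / L) *\<^sub>R a x"
    have nv: "norm v < r" using x(3) \<open>L > 0\<close> by (simp add: v_def field_simps)
    have inW: "x + t *\<^sub>R v \<in> W1 \<inter> W2" if "0 \<le> t" "t \<le> 1" for t
    proof -
      have "norm (t *\<^sub>R v) \<le> norm v" using that by (simp add: mult_left_le_one_le)
      then have "dist x0 (x + t *\<^sub>R v) < 2 * r"
        using x(2) nv norm_triangle_ineq4[of "x0 - x" "t *\<^sub>R v"] by (simp add: dist_norm algebra_simps)
      then show ?thesis using r(2) by auto
    qed
    have "f (x + v) \<le> f x + fd f x v + L * (norm v)\<^sup>2 / 2"
      using inW HL W2(3) by (intro Taylor_second_order_le[OF smooth_f]) auto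
    moreover have "0 \<le> f (x + v)" using inW[of 1] W1(3) assms(2) by auto
    moreover have "fd f x v = - (norm (a x))\<^sup>2 / L"
      by (simp add: da[OF x(1)] v_def power2_norm_eq_inner)
    moreover have "L * (norm v)\<^sup>2 / 2 = (norm (a x))\<^sup>2 / L / 2"
      using \<open>L > 0\<close> by (simp add: v_def power_mult_distrib power2_eq_square)
    ultimately have "(norm (a x))\<^sup>2 / L \<le> 2 * f x" by simp
    then have A: "(norm (a x))\<^sup>2 \<le> 2 * L * f x" using \<open>L > 0\<close> by (simp add: field_simps)
    have "x \<in> W1" using r x(2) by auto
    \<comment> \<open>The Euclidean bound on \<open>a x\<close> is now converted to the metric: the
      lower bound \<open>l / 2\<close> for the form at \<open>x\<close> yields
      \<open>l / 2 * m \<le> (norm (a x))\<^sup>2\<close>.\<close>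
    define m where "m = fd f x (grad x)"
    have m: "m = mi x (grad x) (grad x)" using mi_grad[OF x(1)] by (simp add: m_def)
    have "l / 2 * (norm (grad x))\<^sup>2 \<le> m"
      using abs_le_D2[OF W1(4)[OF \<open>x \<in> W1\<close>, of "grad x"]] l(2)[of "grad x"] unfolding m
      by (simp add: field_simps)
    moreover have "m \<ge> 0" unfolding m by (rule mi_nonneg[OF x(1)])
    moreover have "m \<le> norm (a x) * norm (grad x)"
      unfolding m_def da[OF x(1)] by (rule norm_cauchy_schwarz)
    ultimately have "l / 2 * (m * m) \<le> l / 2 * (norm (a x))\<^sup>2 * (norm (grad x))\<^sup>2"
      using l(1) mult_mono[of m "norm (a x) * norm (grad x)" m "norm (a x) * norm (grad x)"]
      by (simp add: power2_eq_square mult_ac)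
    also have "\<dots> = (norm (a x))\<^sup>2 * (l / 2 * (norm (grad x))\<^sup>2)" by simp
    also have "\<dots> \<le> (norm (a x))\<^sup>2 * m"
      using \<open>l / 2 * (norm (grad x))\<^sup>2 \<le> m\<close> by (intro mult_left_mono) auto
    finally have "l / 2 * m \<le> (norm (a x))\<^sup>2"
      using \<open>m \<ge> 0\<close> by (cases "m = 0") auto
    then have "l / 2 * m \<le> 2 * L * f x" using A by linarith
    then show ?thesis using l(1) unfolding m_def[symmetric] by (simp add: field_simps)
  qed
  show ?thesis
    using \<open>open W\<close> x0W est \<open>L > 0\<close> l(1) by (intro exI[of _ W] exI[of _ "4 * L / l"]) (auto simp: W_def)
qed

end

section \<open>Composition with the radial profile\<close>

context conformal_metric
begin

text \<open>Here \<open>f\<close> is the squared-distance-like function and \<open>F\<close> the radial profile.\<close>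

context
  fixes F y :: "real \<Rightarrow> real"
  assumes smooth_F: "smooth_on UNIV F" and smooth_y: "smooth_on UNIV y"
    and F_deriv: "\<And>s. (F has_real_derivative - y s) (at s)"
begin

lemma smooth_F_f: "smooth_on U (\<lambda>x. F (f x))"
  by (rule smooth_on_compose[OF open_U open_UNIV _ smooth_F smooth_f]) simp

interpretation P: conformal_metric U h "\<lambda>x. F (f x)"
  by standard (rule smooth_F_f)

lemma fd_F_f: "x \<in> U \<Longrightarrow> fd (\<lambda>x. F (f x)) x v = - y (f x) * fd f x v"
proof -
  assume x: "x \<in> U"
  have "(F has_derivative (\<lambda>r. - y (f x) * r)) (at (f x))"
    using F_deriv[of "f x"] unfolding has_field_derivative_def .
  from diff_chain_at[OF smooth_on_has_derivative[OF smooth_f x] this]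
  show ?thesis by (intro fd_eq) (simp add: o_def)
qed

lemma fd2_F_f:
  assumes "x \<in> U"
  shows "fd (\<lambda>z. fd (\<lambda>x. F (f x)) z w) x u
    = - fd y (f x) 1 * fd f x u * fd f x w - y (f x) * fd (\<lambda>z. fd f z w) x u"
proof -
  have "(y has_derivative (\<lambda>r. fd y (f x) 1 * r)) (at (f x))"
    using smooth_on_DERIV[OF smooth_y UNIV_I, of "f x"] unfolding has_field_derivative_def .
  from diff_chain_at[OF smooth_on_has_derivative[OF smooth_f assms] this]
  have 1: "((\<lambda>z. y (f z)) has_derivative (\<lambda>u. fd y (f x) 1 * fd f x u)) (at x)"
    by (simp add: o_def)
  have "((\<lambda>z. - (y (f z) * fd f z w)) has_derivative
      (\<lambda>u. - (y (f x) * fd (\<lambda>z. fd f z w) x u + fd y (f x) 1 * fd f x u * fd f x w))) (at x)"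
    by (intro has_derivative_minus has_derivative_mult 1 differentiable_fd differentiable_fd_f assms)
  then have "((\<lambda>z. fd (\<lambda>x. F (f x)) z w) has_derivative
      (\<lambda>u. - (y (f x) * fd (\<lambda>z. fd f z w) x u + fd y (f x) 1 * fd f x u * fd f x w))) (at x)"
    by (rule has_derivative_transform_within_open[OF _ open_U assms]) (simp add: fd_F_f)
  from fd_eq[OF this, of u] show ?thesis by simp
qed

lemma hess_F_f:
  "x \<in> U \<Longrightarrow> P.hess x u w = - fd y (f x) 1 * fd f x u * fd f x w - y (f x) * hess x u w"
  by (simp add: P.hess_def hess_def fd2_F_f fd_F_f algebra_simps)

lemma grad_F_f: "x \<in> U \<Longrightarrow> P.grad x = - y (f x) *\<^sub>R grad x"
  by (rule mi_eqI[of x]) (simp_all add: P.mi_grad mi_grad fd_F_f)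

lemma hessvec_F_f:
  "x \<in> U \<Longrightarrow> P.hessvec x u = (- fd y (f x) 1 * fd f x u) *\<^sub>R grad x - y (f x) *\<^sub>R hessvec x u"
  by (rule mi_eqI[of x]) (simp_all add: P.mi_hessvec mi_hessvec mi_grad hess_F_f)

lemma hess_trace_F_f:
  "x \<in> U \<Longrightarrow> P.hess_trace x = - fd y (f x) 1 * fd f x (grad x) - y (f x) * hess_trace x"
  unfolding P.hess_trace_def hess_trace_def
  using linear_axis_sum_real'[OF linear_df, of x "grad x"]
  by (simp add: hessvec_F_f sum_subtractf sum_negf mult.assoc flip: sum_distrib_left)

text \<open>Since the squared gradient \<open>m\<close> is at most \<open>C * f x\<close>, the
  derivative of \<open>y\<close> is multiplied by \<open>f x\<close>, and \<open>- s * y' s\<close>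
  is what the profile keeps small. Where \<open>y\<close> has nonnegative slope, the term has the
  right sign by itself.\<close>

lemma slope_term_le:
  assumes "f x \<ge> 0" "m \<le> C * f x" "0 \<le> m" "C > 0" "- f x * fd y (f x) 1 \<le> \<mu>" "\<mu> > 0"
  shows "- fd y (f x) 1 * m \<le> C * \<mu>"
proof (cases "fd y (f x) 1 \<ge> 0")
  case True
  then have "- fd y (f x) 1 * m \<le> 0" using assms by (simp add: mult_nonneg_nonneg)
  then show ?thesis using assms by (meson less_imp_le mult_pos_pos order_trans)
next
  case False
  then have "- fd y (f x) 1 * m \<le> - fd y (f x) 1 * (C * f x)"
    using assms by (intro mult_left_mono) auto
  also have "\<dots> = C * (- f x * fd y (f x) 1)" by simp
  also have "\<dots> \<le> C * \<mu>" using assms by (intro mult_left_mono) auto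
  finally show ?thesis .
qed

text \<open>The factor \<open>y (f x)\<close> vanishes unless \<open>f x < s\<^sub>0\<close>, and
  then \<open>m \<le> C * s\<^sub>0\<close>. Shrinking the support makes the term small even for
  large \<open>\<kappa>\<close>.\<close>

lemma squared_slope_term_le:
  assumes "0 \<le> y (f x)" "y (f x) \<le> \<kappa>" "f x \<ge> s\<^sub>0 \<Longrightarrow> y (f x) = 0" "0 \<le> m" "m \<le> C * f x" "C > 0" "s\<^sub>0 > 0"
  shows "(y (f x))\<^sup>2 * m \<le> \<kappa>\<^sup>2 * C * s\<^sub>0"
proof (cases "f x \<ge> s\<^sub>0")
  case False
  then have "m \<le> C * s\<^sub>0" using assms by (meson linear mult_left_mono less_imp_le order_trans)
  then have "(y (f x))\<^sup>2 * m \<le> \<kappa>\<^sup>2 * (C * s\<^sub>0)"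
    using assms by (intro mult_mono power_mono) auto
  then show ?thesis by simp
qed (use assms in simp)

text \<open>Of the four terms of the tensor, the Hessian of \<open>f\<close> and the square of the
  differential enter with a favourable sign and are dropped. The other two are covered by the two
  preceding estimates.\<close>

lemma conf_F_f_le:
  assumes "x \<in> U" "f x \<ge> 0" "C > 0" "\<mu> > 0" "s\<^sub>0 > 0"
    and C: "fd f x (grad x) \<le> C * f x" and H: "\<And>v. 0 \<le> hess x v v"
    and y: "0 \<le> y (f x)" "y (f x) \<le> \<kappa>" "f x \<ge> s\<^sub>0 \<Longrightarrow> y (f x) = 0" "- f x * fd y (f x) 1 \<le> \<mu>"
  shows "P.conf x v v \<le> (C * \<mu> + \<kappa>\<^sup>2 * C * s\<^sub>0) * mi x v v"
proof -
  define m where "m = fd f x (grad x)"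
  have "m = mi x (grad x) (grad x)" using mi_grad[OF assms(1)] by (simp add: m_def)
  then have "m \<ge> 0" using mi_nonneg[OF assms(1)] by simp
  have df2: "(fd f x v)\<^sup>2 \<le> m * mi x v v"
    using mi_Cauchy_Schwarz[OF assms(1), of "grad x" v] mi_grad[OF assms(1)]
    by (simp add: m_def)
  have "- fd y (f x) 1 * (fd f x v)\<^sup>2 \<le> C * \<mu> * mi x v v"
  proof (cases "fd y (f x) 1 \<ge> 0")
    case True
    then have "- fd y (f x) 1 * (fd f x v)\<^sup>2 \<le> 0" by (simp add: mult_nonneg_nonneg)
    also have "\<dots> \<le> C * \<mu> * mi x v v" using assms mi_nonneg[OF assms(1)] by simp
    finally show ?thesis .
  next
    case False
    then have "- fd y (f x) 1 * (fd f x v)\<^sup>2 \<le> - fd y (f x) 1 * (m * mi x v v)"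
      using df2 by (intro mult_left_mono) auto
    also have "\<dots> = (- fd y (f x) 1 * m) * mi x v v" by simp
    also have "\<dots> \<le> C * \<mu> * mi x v v"
      using slope_term_le[of x m C \<mu>] assms \<open>m \<ge> 0\<close> mi_nonneg[OF assms(1)]
      by (intro mult_right_mono) (auto simp: m_def)
    finally show ?thesis .
  qed
  moreover have "(y (f x))\<^sup>2 * m / 2 * mi x v v \<le> \<kappa>\<^sup>2 * C * s\<^sub>0 * mi x v v"
  proof -
    have "0 \<le> (y (f x))\<^sup>2 * m" using \<open>m \<ge> 0\<close> by simp
    moreover have "(y (f x))\<^sup>2 * m \<le> \<kappa>\<^sup>2 * C * s\<^sub>0"
      using C \<open>m \<ge> 0\<close> assms by (intro squared_slope_term_le) (auto simp: m_def)
    ultimately show ?thesis using mi_nonneg[OF assms(1)] by (intro mult_right_mono) auto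
  qed
  moreover have "0 \<le> y (f x) * hess x v v" using y H by simp
  moreover have "0 \<le> (y (f x) * fd f x v)\<^sup>2" by simp
  moreover have "P.conf x v v = - fd y (f x) 1 * (fd f x v)\<^sup>2 - y (f x) * hess x v v
      - (y (f x) * fd f x v)\<^sup>2 + (y (f x))\<^sup>2 * m / 2 * mi x v v"
    by (simp add: P.conf_def hess_F_f[OF assms(1)] fd_F_f[OF assms(1)] grad_F_f[OF assms(1)]
        linear_scale[OF linear_df[OF assms(1)]] linear_neg[OF linear_df[OF assms(1)]] m_def power2_eq_square)
  ultimately show ?thesis by (simp only: distrib_right)
qed

lemma trace_F_f_le:
  assumes "x \<in> U" "f x \<ge> 0" "C > 0" "\<mu> > 0" "s\<^sub>0 > 0"
    and C: "fd f x (grad x) \<le> C * f x" and H: "0 \<le> hess_trace x"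
    and y: "0 \<le> y (f x)" "y (f x) \<le> \<kappa>" "f x \<ge> s\<^sub>0 \<Longrightarrow> y (f x) = 0" "- f x * fd y (f x) 1 \<le> \<mu>"
  shows "P.hess_trace x + (real CARD('n) / 2 - 1) * fd (\<lambda>x. F (f x)) x (P.grad x)
    \<le> C * \<mu> + real CARD('n) * (\<kappa>\<^sup>2 * C * s\<^sub>0)"
proof -
  define m where "m = fd f x (grad x)"
  have "m = mi x (grad x) (grad x)" using mi_grad[OF assms(1)] by (simp add: m_def)
  then have "m \<ge> 0" using mi_nonneg[OF assms(1)] by simp
  have 1: "- fd y (f x) 1 * m \<le> C * \<mu>"
    using slope_term_le[of x m C \<mu>] assms \<open>m \<ge> 0\<close> by (auto simp: m_def)
  have 2: "(y (f x))\<^sup>2 * m \<le> \<kappa>\<^sup>2 * C * s\<^sub>0"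
    using C \<open>m \<ge> 0\<close> assms by (intro squared_slope_term_le) (auto simp: m_def)
  have "(real CARD('n) / 2 - 1) * ((y (f x))\<^sup>2 * m) \<le> real CARD('n) * ((y (f x))\<^sup>2 * m)"
    using \<open>m \<ge> 0\<close> by (intro mult_right_mono) auto
  also have "\<dots> \<le> real CARD('n) * (\<kappa>\<^sup>2 * C * s\<^sub>0)"
    using 2 by (intro mult_left_mono) auto
  finally have 3: "(real CARD('n) / 2 - 1) * ((y (f x))\<^sup>2 * m) \<le> real CARD('n) * (\<kappa>\<^sup>2 * C * s\<^sub>0)" .
  have "fd (\<lambda>x. F (f x)) x (P.grad x) = (y (f x))\<^sup>2 * m"
    by (simp add: fd_F_f[OF assms(1)] grad_F_f[OF assms(1)] m_def power2_eq_square
        linear_scale[OF linear_df[OF assms(1)]] linear_neg[OF linear_df[OF assms(1)]])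
  moreover have "0 \<le> y (f x) * hess_trace x" using y H by simp
  ultimately show ?thesis
    using 1 3 by (simp add: hess_trace_F_f[OF assms(1)] m_def[symmetric])
qed

text \<open>At a critical point only the Hessian term survives. Its negative sign, for positive
  \<open>y (f x)\<close>, is what raises the curvature there.\<close>

lemma conf_F_f_critical:
  assumes "x \<in> U" "\<And>v. fd f x v = 0" "hess x v v = 2 * mi x v v"
  shows "P.conf x v v = - (2 * y (f x)) * mi x v v"
  by (simp add: P.conf_def hess_F_f[OF assms(1)] fd_F_f[OF assms(1)] assms)

end

end

section \<open>Local curvature deformation around a point\<close>

context coord_metric
begin

text \<open>The Ricci clause measures both bounds by the old metric and so has no exponential
  factor; the other two clauses compare sectional curvatures of the old and the new metric, where
  the rescaling shows.\<close>

definition good_profile ::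
  "(real^'n \<Rightarrow> real) \<Rightarrow> (real^'n) set \<Rightarrow> real^'n \<Rightarrow> real \<Rightarrow> real \<Rightarrow> real \<Rightarrow> (real \<Rightarrow> real) \<Rightarrow> bool" where
  "good_profile q W x0 \<eta> \<kappa> s F \<longleftrightarrow> smooth_on UNIV F \<and> (\<forall>t\<ge>0. 0 \<le> F t \<and> F t \<le> \<eta>) \<and> (\<forall>t\<ge>s. F t = 0) \<and>
    (\<forall>x\<in>W. \<forall>k. (\<forall>v. k * mi x v v \<le> ricci h x v v) \<longrightarrow>
      (\<forall>v. (k - \<eta>) * mi x v v \<le> ricci (\<lambda>x. exp (2 * F (q x)) *\<^sub>R h x) x v v)) \<and>
    (\<forall>x\<in>W. \<forall>k v w. v \<noteq> w \<and> independent {v, w} \<and> k \<le> sectional_curvature h x v w \<longrightarrow>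
      exp (- 2 * F (q x)) * (k - \<eta>) \<le> sectional_curvature (\<lambda>x. exp (2 * F (q x)) *\<^sub>R h x) x v w) \<and>
    (\<forall>k v w. v \<noteq> w \<and> independent {v, w} \<and> k \<le> sectional_curvature h x0 v w \<longrightarrow>
      exp (- 2 * F (q x0)) * (k + \<kappa>) \<le> sectional_curvature (\<lambda>x. exp (2 * F (q x)) *\<^sub>R h x) x0 v w)"

text \<open>The order of the choices matters: \<open>W\<close> depends only on \<open>q\<close> and
  the metric, while \<open>\<eta>\<close>, \<open>\<kappa>\<close> and the support radius
  \<open>s\<close> come later. On a compact manifold \<open>s\<close> can therefore be chosen such
  that the deformation takes place inside \<open>W\<close>.\<close>

lemma curvature_deformation:
  assumes "CARD('n) \<ge> 2" "x0 \<in> U" "smooth_on U q" "\<And>x. x \<in> U \<Longrightarrow> 0 \<le> q x"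
    and "\<And>v. fd q x0 v = 0" and "q x0 = 0" and D2q: "\<And>u v. fd (\<lambda>x. fd q x v) x0 u = 2 * mi x0 u v"
  obtains W where "open W" "x0 \<in> W" "W \<subseteq> U"
    "\<forall>\<eta>>0. \<forall>\<kappa>>0. \<forall>s>0. \<exists>F. good_profile q W x0 \<eta> \<kappa> s F"
proof -
  interpret Q: conformal_metric U h q by standard (fact assms)
  have hess0: "Q.hess x0 u v = 2 * mi x0 u v" for u v
    by (simp add: Q.hess_def D2q assms(5))
  have "Q.hessvec x0 u = 2 *\<^sub>R u" for u
    by (rule mi_eqI[OF assms(2)]) (simp add: Q.mi_hessvec[OF assms(2)] hess0)
  then have trace0: "Q.hess_trace x0 > 0"
    by (simp add: Q.hess_trace_def)
  \<comment> \<open>At \<open>x0\<close> the Hessian of \<open>q\<close> is \<open>2 * mi\<close>,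
    hence at least \<open>2 * l\<close> on unit vectors; an error of \<open>l\<close> therefore
    keeps it nonnegative nearby.\<close>
  obtain l where l: "l > 0" "\<And>v. l * (norm v)\<^sup>2 \<le> mi x0 v v" using mi_lower_bound[OF assms(2)] by blast
  obtain W1 where W1: "open W1" "x0 \<in> W1" "W1 \<subseteq> U"
      "\<And>x v. x \<in> W1 \<Longrightarrow> \<bar>Q.hess x v v - Q.hess x0 v v\<bar> \<le> l * (norm v)\<^sup>2"
    using forms_near[of x0 Q.hess l, OF assms(2) Q.linear_hess(2,1) smooth_on_continuous[OF Q.smooth_hess] l(1)]
    by auto
  have W1': "0 \<le> Q.hess x v v" if "x \<in> W1" for x v
    using abs_le_D2[OF W1(4)[OF that, of v]] l(2)[of v] mi_nonneg[OF assms(2), of v] by (simp add: hess0)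
  obtain W2 C where W2: "open W2" "x0 \<in> W2" "W2 \<subseteq> U" "C > 0" "\<And>x. x \<in> W2 \<Longrightarrow> fd q x (Q.grad x) \<le> C * q x"
    using Q.gradient_bound_near_zero[OF assms(2,4,5)] by auto
  define W where "W = W1 \<inter> W2 \<inter> {x \<in> U. 0 < Q.hess_trace x}"
  show ?thesis
  proof (rule that[of W])
    show "open W" unfolding W_def
      by (intro open_Int W1 W2 open_smaller(2)[OF open_U Q.continuous_hess_trace])
    show "x0 \<in> W" using W1 W2 trace0 assms(2) by (simp add: W_def)
    show "W \<subseteq> U" by (auto simp: W_def)
    show "\<forall>\<eta>>0. \<forall>\<kappa>>0. \<forall>s>0. \<exists>F. good_profile q W x0 \<eta> \<kappa> s F"
    proof (intro allI impI)
      fix \<eta> \<kappa> s :: real assume pos: "\<eta> > 0" "\<kappa> > 0" "s > 0"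
      define n where "n = real CARD('n)"
      have "n \<ge> 2" using assms(1) by (simp add: n_def)
      \<comment> \<open>The factors 8 and \<open>n\<close> lead to
        \<open>n * a \<le> \<eta> / 4\<close> and \<open>b \<le> \<eta> / 2\<close>, which together
        stay below the permitted loss \<open>\<eta>\<close>.\<close>
      define \<mu> where "\<mu> = \<eta> / (8 * n * C)"
      \<comment> \<open>The three bounds put the support below \<open>s\<close>, ensure
        \<open>F \<le> \<kappa> * s\<^sub>0 \<le> \<eta>\<close>, and control the squared slope
        term.\<close>
      define s\<^sub>0 where "s\<^sub>0 = min s (min (\<eta> / \<kappa>) (\<eta> / (8 * n * (\<kappa>\<^sup>2 * C))))"
      have "\<mu> > 0" using pos W2 \<open>n \<ge> 2\<close> by (simp add: \<mu>_def)
      have "s\<^sub>0 > 0" using pos W2 \<open>n \<ge> 2\<close> by (simp add: s\<^sub>0_def)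
      have s0: "s\<^sub>0 \<le> s" "\<kappa> * s\<^sub>0 \<le> \<eta>" "\<kappa>\<^sup>2 * C * s\<^sub>0 \<le> \<eta> / (8 * n)"
      proof -
        have "\<kappa> * s\<^sub>0 \<le> \<kappa> * (\<eta> / \<kappa>)" using pos by (intro mult_left_mono) (auto simp: s\<^sub>0_def)
        then show "\<kappa> * s\<^sub>0 \<le> \<eta>" using pos by simp
        have "\<kappa>\<^sup>2 * C * s\<^sub>0 \<le> \<kappa>\<^sup>2 * C * (\<eta> / (8 * n * (\<kappa>\<^sup>2 * C)))"
          using pos W2 by (intro mult_left_mono) (auto simp: s\<^sub>0_def)
        then show "\<kappa>\<^sup>2 * C * s\<^sub>0 \<le> \<eta> / (8 * n)" using pos W2 by (simp add: field_simps)
      qed (simp add: s\<^sub>0_def)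
      have C\<mu>: "C * \<mu> = \<eta> / (8 * n)" using W2 by (simp add: \<mu>_def)
      define a where "a = C * \<mu> + \<kappa>\<^sup>2 * C * s\<^sub>0"
      define b where "b = C * \<mu> + n * (\<kappa>\<^sup>2 * C * s\<^sub>0)"
      have na: "n * a \<le> \<eta> / 4"
      proof -
        have "n * a \<le> n * (\<eta> / (8 * n) + \<eta> / (8 * n))"
          unfolding a_def C\<mu> using s0 \<open>n \<ge> 2\<close> by (intro mult_left_mono) auto
        then show ?thesis using \<open>n \<ge> 2\<close> by (simp add: field_simps)
      qed
      have "a \<ge> 0" using \<open>\<mu> > 0\<close> \<open>s\<^sub>0 > 0\<close> W2 by (simp add: a_def)
      have b: "b \<le> \<eta> / 2"
      proof -
        have "\<eta> / (8 * n) \<le> \<eta> / 8" using \<open>n \<ge> 2\<close> pos by (intro divide_left_mono) auto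
        moreover have "n * (\<kappa>\<^sup>2 * C * s\<^sub>0) \<le> n * (\<eta> / (8 * n))" using s0 \<open>n \<ge> 2\<close> by (intro mult_left_mono) auto
        ultimately show ?thesis using \<open>n \<ge> 2\<close> pos by (simp add: b_def C\<mu>)
      qed
      have "2 * a \<le> \<eta>" using na mult_right_mono[OF \<open>n \<ge> 2\<close> \<open>a \<ge> 0\<close>] pos by linarith
      obtain F y where Fy: "smooth_on UNIV F" "smooth_on UNIV y"
        "\<And>s. (F has_real_derivative - y s) (at s)" "y 0 = \<kappa>"
        "\<And>s. 0 \<le> y s" "\<And>s. y s \<le> \<kappa>" "\<And>s. s \<ge> 0 \<Longrightarrow> - s * fd y s 1 \<le> \<mu>"
        "\<And>s. s \<ge> s\<^sub>0 \<Longrightarrow> F s = 0" "\<And>s. s \<ge> s\<^sub>0 \<Longrightarrow> y s = 0"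
        "\<And>s. s \<ge> 0 \<Longrightarrow> 0 \<le> F s" "\<And>s. s \<ge> 0 \<Longrightarrow> F s \<le> \<kappa> * s\<^sub>0"
        using radial_profile[OF pos(2) \<open>\<mu> > 0\<close> \<open>s\<^sub>0 > 0\<close>] by blast
      note Fy' = Fy(1,2,3)
      interpret P: conformal_metric U h "\<lambda>x. F (q x)"
        by standard (rule Q.smooth_F_f[OF Fy'])
      have ht: "P.ht = (\<lambda>x. exp (2 * F (q x)) *\<^sub>R h x)" by (simp add: P.ht_def[abs_def])
      have c: "P.conf x v v \<le> a * mi x v v" if "x \<in> W" for x v
      proof -
        have x: "x \<in> U" "x \<in> W1" "x \<in> W2" using that by (auto simp: W_def)
        show ?thesis unfolding a_def
          by (rule Q.conf_F_f_le[OF Fy' x(1) assms(4)[OF x(1)] W2(4) \<open>\<mu> > 0\<close> \<open>s\<^sub>0 > 0\<close> W2(5)[OF x(3)] W1'[OF x(2)]])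
            (use Fy assms(4)[OF x(1)] in auto)
      qed
      have t: "P.hess_trace x + (real CARD('n) / 2 - 1) * fd (\<lambda>x. F (q x)) x (P.grad x) \<le> b" if "x \<in> W" for x
      proof -
        have x: "x \<in> U" "x \<in> W1" "x \<in> W2" "0 \<le> Q.hess_trace x" using that by (auto simp: W_def)
        show ?thesis unfolding b_def n_def
          by (rule Q.trace_F_f_le[OF Fy' x(1) assms(4)[OF x(1)] W2(4) \<open>\<mu> > 0\<close> \<open>s\<^sub>0 > 0\<close> W2(5)[OF x(3)] x(4)])
            (use Fy assms(4)[OF x(1)] in auto)
      qed
      have "(k - \<eta>) * mi x v v \<le> ricci P.ht x v v"
        if "x \<in> W" "\<forall>v. k * mi x v v \<le> ricci h x v v" for x k v
      proof -
        have "x \<in> U" using that by (auto simp: W_def)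
        have "(k - \<eta>) * mi x v v \<le> (k - n * a - b) * mi x v v"
          using na b pos mi_nonneg[OF \<open>x \<in> U\<close>] by (intro mult_right_mono) auto
        also have "\<dots> \<le> ricci P.ht x v v"
          unfolding n_def using that(2) by (intro P.ricci_ht_ge \<open>x \<in> U\<close> c t that \<open>a \<ge> 0\<close> assms(1)) auto
        finally show ?thesis .
      qed
      moreover have "exp (- 2 * F (q x)) * (k - \<eta>) \<le> sectional_curvature P.ht x v w"
        if "x \<in> W" "v \<noteq> w" "independent {v, w}" "k \<le> sectional_curvature h x v w" for x k v w
      proof -
        have "x \<in> U" using that by (auto simp: W_def)
        have "exp (- 2 * F (q x)) * (k - \<eta>) \<le> exp (- 2 * F (q x)) * (k - 2 * a)"
          using \<open>2 * a \<le> \<eta>\<close> by (intro mult_left_mono) auto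
        also have "\<dots> \<le> sectional_curvature P.ht x v w"
          by (intro P.sectional_curvature_ht_ge \<open>x \<in> U\<close> c that)
        finally show ?thesis .
      qed
      moreover have "exp (- 2 * F (q x0)) * (k + \<kappa>) \<le> sectional_curvature P.ht x0 v w"
        if "v \<noteq> w" "independent {v, w}" "k \<le> sectional_curvature h x0 v w" for k v w
      proof -
        have cc: "P.conf x0 v v = - (2 * y (q x0)) * mi x0 v v" for v
          by (rule Q.conf_F_f_critical[OF Fy' assms(2,5) hess0])
        \<comment> \<open>The tensor at \<open>x0\<close> is \<open>- 2 * \<kappa>\<close> times the
          metric, so the bound even gains \<open>4 * \<kappa>\<close>, of which only
          \<open>\<kappa>\<close> is kept.\<close>
        have "exp (- 2 * F (q x0)) * (k - 2 * (- (2 * y (q x0)))) \<le> sectional_curvature P.ht x0 v w"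
          by (intro P.sectional_curvature_ht_ge assms(2) that) (simp add: cc)
        moreover have "exp (- 2 * F (q x0)) * (k + \<kappa>) \<le> exp (- 2 * F (q x0)) * (k - 2 * (- (2 * y (q x0))))"
          using pos Fy(4) assms(6) by (intro mult_left_mono) auto
        ultimately show ?thesis by linarith
      qed
      moreover have "F t \<le> \<eta>" if "t \<ge> 0" for t
        using Fy(11)[OF that] s0(2) by linarith
      ultimately show "\<exists>F. good_profile q W x0 \<eta> \<kappa> s F"
        using Fy(1,8,10) s0(1) unfolding good_profile_def ht by (intro exI[of _ F]) auto
    qed
  qed
qed

end

section \<open>Invariant means on compact groups\<close>

text \<open>Lists rather than sets, so that coinciding translates count with multiplicity and
  averages compose.\<close>

definition avg :: "'a list \<Rightarrow> ('a \<Rightarrow> real) \<Rightarrow> real" where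
  "avg bs g = sum_list (map g bs) / real (length bs)"

lemma avg_ge:
  assumes "bs \<noteq> []" "\<And>b. b \<in> set bs \<Longrightarrow> lo \<le> g b"
  shows "lo \<le> avg bs g"
proof -
  have "real (length bs) * lo \<le> sum_list (map g bs)" using assms(2)
    by (induction bs) (auto simp: algebra_simps intro: add_mono)
  then show ?thesis using assms(1) by (simp add: avg_def field_simps)
qed

lemma avg_le:
  assumes "bs \<noteq> []" "\<And>b. b \<in> set bs \<Longrightarrow> g b \<le> hi"
  shows "avg bs g \<le> hi"
proof -
  have "sum_list (map g bs) \<le> real (length bs) * hi" using assms(2)
    by (induction bs) (auto simp: algebra_simps intro: add_mono)
  then show ?thesis using assms(1) by (simp add: avg_def field_simps)
qed

lemma avg_dist:
  assumes "bs \<noteq> []" "\<And>b. b \<in> set bs \<Longrightarrow> \<bar>g b - c\<bar> \<le> e"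
  shows "\<bar>avg bs g - c\<bar> \<le> e"
proof -
  have "c - e \<le> g b" "g b \<le> c + e" if "b \<in> set bs" for b
    using assms(2)[OF that] by (auto simp: abs_le_iff)
  then have "c - e \<le> avg bs g" "avg bs g \<le> c + e"
    using assms(1) by (intro avg_ge avg_le; simp)+
  then show ?thesis by (auto simp: abs_le_iff)
qed

lemma avg_add: "avg bs (\<lambda>b. g b + h b) = avg bs g + avg bs h"
  by (simp add: avg_def sum_list_addf add_divide_distrib)

lemma avg_diff: "avg bs (\<lambda>b. g b - h b) = avg bs g - avg bs h"
  by (simp add: avg_def sum_list_subtractf diff_divide_distrib)

lemma avg_cmult: "avg bs (\<lambda>b. c * g b) = c * avg bs g"
  by (simp add: avg_def sum_list_const_mult)

lemma avg_map: "avg (map k bs) g = avg bs (\<lambda>b. g (k b))"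
  by (simp add: avg_def o_def)

lemma avg_cong: "(\<And>b. b \<in> set bs \<Longrightarrow> g b = h b) \<Longrightarrow> avg bs g = avg bs h"
  by (simp add: avg_def cong: map_cong)

lemma avg_avg:
  "avg bs (\<lambda>b. avg ds (g b))
    = sum_list (map (\<lambda>b. sum_list (map (g b) ds)) bs) / (real (length bs) * real (length ds))"
proof -
  have "(\<lambda>b. avg ds (g b)) = (\<lambda>b. 1 / real (length ds) * sum_list (map (g b) ds))"
    by (simp add: avg_def)
  then have "avg bs (\<lambda>b. avg ds (g b)) = 1 / real (length ds) * avg bs (\<lambda>b. sum_list (map (g b) ds))"
    by (simp only: avg_cmult)
  then show ?thesis by (simp add: avg_def)
qed

lemma avg_swap: "avg bs (\<lambda>b. avg ds (\<lambda>d. g b d)) = avg ds (\<lambda>d. avg bs (\<lambda>b. g b d))"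
proof -
  have "sum_list (map (\<lambda>b. sum_list (map (g b) ds)) bs) = sum_list (map (\<lambda>d. sum_list (map (\<lambda>b. g b d) bs)) ds)"
    by (induction bs) (simp_all add: sum_list_addf)
  then show ?thesis by (simp add: avg_avg mult.commute)
qed

lemma avg_concat: "avg (concat (map (\<lambda>b. map (k b) cs) bs)) g = avg bs (\<lambda>b. avg cs (\<lambda>c. g (k b c)))"
proof -
  have "length (concat (map (\<lambda>b. map (k b) cs) bs)) = length bs * length cs"
    by (induction bs) auto
  moreover have "sum_list (map g (concat (map (\<lambda>b. map (k b) cs) bs)))
      = sum_list (map (\<lambda>b. sum_list (map (\<lambda>c. g (k b c)) cs)) bs)"
    by (induction bs) (auto simp: o_def)
  ultimately show ?thesis
    unfolding avg_avg avg_def[of "concat _"] by simp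
qed

lemma abs_diff_leD: "\<bar>a - b\<bar> \<le> e \<Longrightarrow> a \<le> b + e" "\<bar>a - b\<bar> \<le> e \<Longrightarrow> b - e \<le> a" for a b e :: real
  by linarith+

lemma eq_if_close: "(\<And>e. e > 0 \<Longrightarrow> \<bar>a - b\<bar> \<le> c * e) \<Longrightarrow> c > 0 \<Longrightarrow> a = b" for a b c :: real
  using field_le_epsilon[of "\<bar>a - b\<bar>" 0] by (metis abs_le_zero_iff add_0 divide_pos_pos eq_iff_diff_eq_0 nonzero_mult_div_cancel_left less_irrefl times_divide_eq_right)

text \<open>The invariant mean constructed here is the normalised Haar integral of continuous
  functions, obtained in the manner of von Neumann from averages over finitely many
  translates.\<close>

locale compact_group = Group.group G for G :: "('g, 'z) monoid_scheme" (structure) +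
  fixes Y :: "'g topology"
  assumes topspace_Y: "topspace Y = carrier G" and compact_Y: "compact_space Y"
    and cont_mult: "continuous_map (prod_topology Y Y) Y (\<lambda>(a, b). a \<otimes> b)"
    and cont_inv: "continuous_map Y Y (\<lambda>a. inv a)"
begin

abbreviation cont :: "('g \<Rightarrow> real) \<Rightarrow> bool" where
  "cont f \<equiv> continuous_map Y euclideanreal f"

lemma cont_mult_left: "b \<in> carrier G \<Longrightarrow> continuous_map Y Y (\<lambda>x. b \<otimes> x)"
  using continuous_map_compose[OF continuous_map_pairedI[of Y Y "\<lambda>_. b" Y "\<lambda>x. x"] cont_mult]
  by (simp add: o_def topspace_Y)

lemma cont_mult_right: "b \<in> carrier G \<Longrightarrow> continuous_map Y Y (\<lambda>x. x \<otimes> b)"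
  using continuous_map_compose[OF continuous_map_pairedI[of Y Y "\<lambda>x. x" Y "\<lambda>_. b"] cont_mult]
  by (simp add: o_def topspace_Y)

lemma cont_translate:
  assumes "cont f"
  shows "b \<in> carrier G \<Longrightarrow> cont (\<lambda>x. f (b \<otimes> x))" "b \<in> carrier G \<Longrightarrow> cont (\<lambda>x. f (x \<otimes> b))"
    "cont (\<lambda>x. f (inv x))"
  using continuous_map_compose[OF cont_mult_left assms] continuous_map_compose[OF cont_mult_right assms]
    continuous_map_compose[OF cont_inv assms] by (simp_all add: o_def)

lemma cont_avg:
  assumes "\<And>b. b \<in> set bs \<Longrightarrow> cont (\<lambda>x. g x b)" shows "cont (\<lambda>x. avg bs (g x))"
proof -
  have "cont (\<lambda>x. sum_list (map (g x) bs))"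
    using assms by (induction bs) (auto intro!: continuous_map_add)
  then show ?thesis unfolding avg_def divide_inverse
    by (intro continuous_map_real_mult) auto
qed

lemma cont_bounded: "cont f \<Longrightarrow> \<exists>K. \<forall>x\<in>carrier G. \<bar>f x\<bar> \<le> K"
proof -
  assume "cont f"
  then have "compact (f ` carrier G)"
    using image_compactin[of Y "topspace Y" euclideanreal f] compact_Y
    by (simp add: compact_space_def topspace_Y)
  from compact_imp_bounded[OF this] show ?thesis by (auto simp: bounded_iff)
qed

definition translators :: "'g list \<Rightarrow> bool" where
  "translators bs \<longleftrightarrow> bs \<noteq> [] \<and> set bs \<subseteq> carrier G"

text \<open>Compactness in the first variable: the tube lemma is applied to the open set of pairs
  \<open>(x, v)\<close> with \<open>\<bar>f (x \<otimes> v) - f x\<bar> < e\<close>, which contains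
  all pairs \<open>(x, \<one>)\<close>.\<close>

lemma uniformly_continuous_right:
  assumes "cont f" "e > 0"
  shows "\<exists>V. openin Y V \<and> \<one> \<in> V \<and> (\<forall>x\<in>carrier G. \<forall>v\<in>V. \<bar>f (x \<otimes> v) - f x\<bar> < e)"
proof -
  let ?d = "\<lambda>(x, v). \<bar>f (x \<otimes> v) - f x\<bar>"
  have 1: "continuous_map (prod_topology Y Y) euclideanreal (\<lambda>p. f (fst p \<otimes> snd p))"
    using continuous_map_compose[OF cont_mult assms(1)] by (simp add: o_def case_prod_unfold)
  have 2: "continuous_map (prod_topology Y Y) euclideanreal (\<lambda>p. f (fst p))"
    using continuous_map_compose[OF continuous_map_fst assms(1)] by (simp add: o_def)
  have "continuous_map (prod_topology Y Y) euclideanreal ?d"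
    using continuous_map_real_abs[OF continuous_map_diff[OF 1 2]]
    by (simp add: case_prod_unfold)
  then have op: "openin (prod_topology Y Y) {p \<in> topspace (prod_topology Y Y). ?d p \<in> {..<e}}"
    by (rule openin_continuous_map_preimage) auto
  have c: "compactin Y (topspace Y)" "compactin Y {\<one>}"
    using compact_Y by (auto simp: compact_space_def topspace_Y)
  have sub: "topspace Y \<times> {\<one>} \<subseteq> {p \<in> topspace (prod_topology Y Y). ?d p \<in> {..<e}}"
    using assms(2) by (auto simp: topspace_Y)
  obtain U V where UV: "openin Y U" "openin Y V" "topspace Y \<subseteq> U" "{\<one>} \<subseteq> V"
      "U \<times> V \<subseteq> {p \<in> topspace (prod_topology Y Y). ?d p \<in> {..<e}}"
    by (rule Wallace_theorem_prod_topology[OF c op sub])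
  have "\<bar>f (x \<otimes> v) - f x\<bar> < e" if "x \<in> carrier G" "v \<in> V" for x v
  proof -
    have "(x, v) \<in> U \<times> V" using UV(3) that topspace_Y by auto
    with UV(5) have "(x, v) \<in> {p \<in> topspace (prod_topology Y Y). ?d p \<in> {..<e}}" by (rule subsetD)
    then show ?thesis by simp
  qed
  then show ?thesis using UV(2,4) by (intro exI[of _ V]) auto
qed

lemma finite_translates_cover:
  assumes "openin Y V" "\<one> \<in> V"
  shows "\<exists>cs. translators cs \<and> (\<forall>z\<in>carrier G. \<exists>c\<in>set cs. inv c \<otimes> z \<in> V)"
proof -
  let ?T = "\<lambda>c. {z \<in> topspace Y. inv c \<otimes> z \<in> V}"
  have "openin Y (?T c)" if "c \<in> carrier G" for c
    by (rule openin_continuous_map_preimage[OF cont_mult_left assms(1)]) (use that in auto)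
  moreover have "topspace Y \<subseteq> \<Union> (?T ` carrier G)"
    using assms(2) by (auto simp: topspace_Y intro!: bexI)
  ultimately obtain \<F> where "finite \<F>" "\<F> \<subseteq> ?T ` carrier G" "topspace Y \<subseteq> \<Union> \<F>"
    using compact_Y unfolding compact_space_def compactin_def by (metis (no_types, lifting) imageE)
  then obtain F where F: "finite F" "F \<subseteq> carrier G" "\<F> = ?T ` F"
    by (meson finite_subset_image)
  obtain cs where cs: "set cs = F" using finite_list[OF F(1)] by blast
  have cov: "\<exists>c\<in>set cs. inv c \<otimes> z \<in> V" if "z \<in> carrier G" for z
    using \<open>topspace Y \<subseteq> \<Union> \<F>\<close> that F(3) cs topspace_Y by auto
  then have "cs \<noteq> []" using one_closed by fastforce
  then show ?thesis using cov F(2) cs by (auto simp: translators_def)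
qed

text \<open>One averaging step over a fixed finite number \<open>N\<close> of translates, chosen such that at each
  point one of them is nearly minimal, lowers the oscillation by a definite amount. Iterating gives
  an average which is nearly constant.\<close>

lemma left_average_nearly_constant:
  assumes "cont f" "e > 0"
  shows "\<exists>bs c. translators bs \<and> (\<forall>x\<in>carrier G. \<bar>avg bs (\<lambda>b. f (b \<otimes> x)) - c\<bar> \<le> e)"
proof -
  \<comment> \<open>The iteration proceeds while the oscillation is at least \<open>3 * d\<close>
    and ends at \<open>3 * d = e\<close>.\<close>
  define d where "d = e / 3"
  have "d > 0" using assms(2) by (simp add: d_def)
  \<comment> \<open>Nearness is measured by right multiplication, so it holds uniformly for all left
    translates of \<open>f\<close> and hence for every left average. Therefore neither
    \<open>V\<close> nor \<open>N\<close> changes during the iteration.\<close>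
  obtain V where V: "openin Y V" "\<one> \<in> V" "\<And>x v. x \<in> carrier G \<Longrightarrow> v \<in> V \<Longrightarrow> \<bar>f (x \<otimes> v) - f x\<bar> < d"
    using uniformly_continuous_right[OF assms(1) \<open>d > 0\<close>] by blast
  have Vc: "V \<subseteq> carrier G" using openin_subset[OF V(1)] topspace_Y by simp
  obtain cs where cs: "translators cs" "\<And>z. z \<in> carrier G \<Longrightarrow> \<exists>c\<in>set cs. inv c \<otimes> z \<in> V"
    using finite_translates_cover[OF V(1,2)] by blast
  define N where "N = real (length cs)"
  have "N \<ge> 1" using cs(1) by (cases cs) (auto simp: N_def translators_def)
  let ?L = "\<lambda>bs x. avg bs (\<lambda>b. f (b \<otimes> x))"
  let ?osc = "\<lambda>bs m w. translators bs \<and> (\<forall>x\<in>carrier G. m \<le> ?L bs x \<and> ?L bs x \<le> m + w)"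
  have step: "\<exists>bs' m'. ?osc bs' m' (w - d / N)" if osc: "?osc bs m w" and w: "w \<ge> 3 * d" for bs m w
  proof (cases "\<exists>x0\<in>carrier G. ?L bs x0 \<le> m + d")
    case False
    \<comment> \<open>If the average never comes within \<open>d\<close> of \<open>m\<close>, the
      lower bound itself moves up by \<open>d\<close>.\<close>
    have "d / N \<le> d" using \<open>N \<ge> 1\<close> \<open>d > 0\<close> by (simp add: field_simps)
    then have "?osc bs (m + d) (w - d / N)" using osc False by fastforce
    then show ?thesis by blast
  next
    case True
    then obtain x0 where x0: "x0 \<in> carrier G" "?L bs x0 \<le> m + d" by blast
    \<comment> \<open>For every \<open>x\<close> some \<open>c\<close> puts
      \<open>inv c \<otimes> x\<close> into \<open>V\<close>, so that the average at
      \<open>x0 \<otimes> inv c \<otimes> x\<close> differs by at most \<open>d\<close> from its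
      nearly minimal value at \<open>x0\<close>.\<close>
    define bs' where "bs' = concat (map (\<lambda>c. map (\<lambda>b. b \<otimes> (x0 \<otimes> inv c)) bs) cs)"
    have csc: "c \<in> carrier G" if "c \<in> set cs" for c using cs(1) that by (auto simp: translators_def)
    have bsc: "b \<in> carrier G" if "b \<in> set bs" for b using osc that by (auto simp: translators_def)
    have tr: "translators bs'"
      using cs(1) osc x0(1) by (auto simp: translators_def bs'_def intro!: m_closed inv_closed)
    have L': "?L bs' x = avg cs (\<lambda>c. ?L bs (x0 \<otimes> inv c \<otimes> x))" if x: "x \<in> carrier G" for x
    proof -
      have "?L bs' x = avg cs (\<lambda>c. avg bs (\<lambda>b. f (b \<otimes> (x0 \<otimes> inv c) \<otimes> x)))"
        unfolding bs'_def by (rule avg_concat)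
      also have "\<dots> = avg cs (\<lambda>c. ?L bs (x0 \<otimes> inv c \<otimes> x))"
        by (intro avg_cong arg_cong[where f=f]) (use x x0 csc bsc in \<open>simp add: m_assoc\<close>)
      finally show ?thesis .
    qed
    have "m \<le> ?L bs' x \<and> ?L bs' x \<le> m + (w - d / N)" if x: "x \<in> carrier G" for x
    proof
      have b: "m \<le> ?L bs (x0 \<otimes> inv c \<otimes> x)" "?L bs (x0 \<otimes> inv c \<otimes> x) \<le> m + w" if "c \<in> set cs" for c
        using osc x0 x csc[OF that] by auto
      show "m \<le> ?L bs' x"
        unfolding L'[OF x] using cs(1) b by (intro avg_ge[of cs]) (auto simp: translators_def)
      obtain c where c: "c \<in> set cs" "inv c \<otimes> x \<in> V" using cs(2)[OF x] by blast
      have "\<bar>?L bs (x0 \<otimes> inv c \<otimes> x) - ?L bs x0\<bar> \<le> d"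
      proof -
        have "\<bar>avg bs (\<lambda>b. f (b \<otimes> (x0 \<otimes> inv c \<otimes> x)) - f (b \<otimes> x0)) - 0\<bar> \<le> d"
        proof (rule avg_dist)
          fix b assume "b \<in> set bs"
          then have "b \<otimes> (x0 \<otimes> inv c \<otimes> x) = b \<otimes> x0 \<otimes> (inv c \<otimes> x)"
            using x x0 csc[OF c(1)] bsc by (simp add: m_assoc)
          then show "\<bar>f (b \<otimes> (x0 \<otimes> inv c \<otimes> x)) - f (b \<otimes> x0) - 0\<bar> \<le> d"
            using V(3)[OF _ c(2), of "b \<otimes> x0"] bsc[OF \<open>b \<in> set bs\<close>] x0(1) by simp
        qed (use osc in \<open>simp add: translators_def\<close>)
        then show ?thesis by (simp add: avg_diff)
      qed
      then have small: "?L bs (x0 \<otimes> inv c \<otimes> x) \<le> m + 2 * d" using x0(2) by linarith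
      \<comment> \<open>One summand is at most \<open>m + 2 * d\<close>, the other
        \<open>N - 1\<close> are at most \<open>m + w\<close>. Since \<open>w \<ge> 3 * d\<close>,
        the upper bound drops by at least \<open>d / N\<close>.\<close>
      have "sum_list (map (\<lambda>c. ?L bs (x0 \<otimes> inv c \<otimes> x)) cs) \<le> N * (m + w) - (w - 2 * d)"
      proof -
        obtain ys zs where yz: "cs = ys @ c # zs" using split_list[OF c(1)] by blast
        have part: "sum_list (map (\<lambda>c. ?L bs (x0 \<otimes> inv c \<otimes> x)) us) \<le> real (length us) * (m + w)"
          if "set us \<subseteq> set cs" for us
          using that
        proof (induction us)
          case (Cons a us)
          then have "?L bs (x0 \<otimes> inv a \<otimes> x) \<le> m + w" using b(2) by simp
          with Cons show ?case by (simp add: algebra_simps)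
        qed simp
        have "N = real (length ys) + real (length zs) + 1" by (simp add: N_def yz)
        moreover have "set ys \<subseteq> set cs" "set zs \<subseteq> set cs" by (auto simp: yz)
        ultimately show ?thesis
          using part[of ys] part[of zs] small unfolding yz by (simp add: algebra_simps)
      qed
      then have "?L bs' x \<le> (N * (m + w) - (w - 2 * d)) / N"
        unfolding L'[OF x] avg_def[of cs] N_def by (intro divide_right_mono) auto
      also have "\<dots> = m + (w - (w - 2 * d) / N)" using \<open>N \<ge> 1\<close> by (simp add: field_simps)
      also have "\<dots> \<le> m + (w - d / N)"
        using w \<open>N \<ge> 1\<close> by (simp add: divide_right_mono)
      finally show "?L bs' x \<le> m + (w - d / N)" .
    qed
    then show ?thesis using tr by blast
  qed
  have iter: "\<exists>bs m. ?osc bs m (3 * d)" if "?osc bs m (3 * d + real k * (d / N))" for bs m k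
    using that
  proof (induction k arbitrary: bs m)
    case (Suc k)
    have "3 * d + real (Suc k) * (d / N) \<ge> 3 * d" using \<open>N \<ge> 1\<close> \<open>d > 0\<close> by simp
    from step[OF Suc.prems this] obtain bs' m' where
      "?osc bs' m' (3 * d + real (Suc k) * (d / N) - d / N)" by blast
    then have "?osc bs' m' (3 * d + real k * (d / N))" by (simp add: algebra_simps add_divide_distrib)
    then show ?case by (rule Suc.IH)
  qed auto
  obtain K where K: "\<And>x. x \<in> carrier G \<Longrightarrow> \<bar>f x\<bar> \<le> K" using cont_bounded[OF assms(1)] by blast
  obtain k :: nat where k: "2 * K / (d / N) \<le> real k" using real_arch_simple by blast
  \<comment> \<open>The single translate by \<open>\<one>\<close> starts the iteration, with
    oscillation at most \<open>2 * K\<close>.\<close>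
  have "?osc [\<one>] (- K) (3 * d + real k * (d / N))"
  proof -
    have "2 * K \<le> real k * (d / N)" using k \<open>d > 0\<close> \<open>N \<ge> 1\<close> by (simp add: field_simps)
    then show ?thesis using K \<open>d > 0\<close> by (auto simp: translators_def avg_def abs_le_iff add_increasing2) (smt (verit))+
  qed
  then obtain bs m where "?osc bs m (3 * d)" using iter by blast
  then have "translators bs \<and> (\<forall>x\<in>carrier G. \<bar>?L bs x - m\<bar> \<le> e)"
    by (auto simp: d_def abs_le_iff)
  then show ?thesis by blast
qed

text \<open>Inversion exchanges left and right translations.\<close>

lemma right_average_nearly_constant:
  assumes "cont f" "e > 0"
  shows "\<exists>bs c. translators bs \<and> (\<forall>x\<in>carrier G. \<bar>avg bs (\<lambda>b. f (x \<otimes> b)) - c\<bar> \<le> e)"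
proof -
  obtain bs c where bs: "translators bs" "\<And>x. x \<in> carrier G \<Longrightarrow> \<bar>avg bs (\<lambda>b. f (inv (b \<otimes> x))) - c\<bar> \<le> e"
    using left_average_nearly_constant[OF cont_translate(3)[OF assms(1)] assms(2)] by blast
  have "\<bar>avg (map (\<lambda>b. inv b) bs) (\<lambda>b. f (x \<otimes> b)) - c\<bar> \<le> e" if "x \<in> carrier G" for x
  proof -
    have "avg (map (\<lambda>b. inv b) bs) (\<lambda>b. f (x \<otimes> b)) = avg bs (\<lambda>b. f (inv (b \<otimes> inv x)))"
      unfolding avg_map
      by (intro avg_cong) (use bs(1) that in \<open>auto simp: translators_def inv_mult_group subset_iff\<close>)
    then show ?thesis using bs(2)[of "inv x"] that by simp
  qed
  moreover have "translators (map (\<lambda>b. inv b) bs)" using bs(1) by (auto simp: translators_def)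
  ultimately show ?thesis by blast
qed

text \<open>An infimum of upper bounds of left averages can be written down for every function; for
  continuous ones it is the common limit of the nearly constant left and right averages.\<close>

definition mean :: "('g \<Rightarrow> real) \<Rightarrow> real" where
  "mean f = Inf {u. \<exists>bs. translators bs \<and> (\<forall>x\<in>carrier G. avg bs (\<lambda>b. f (b \<otimes> x)) \<le> u)}"

text \<open>Left and right translations commute, so a double average can be bounded from either
  side.\<close>

lemma left_right_average:
  assumes "translators bs" "translators ds"
    and l: "\<And>x. x \<in> carrier G \<Longrightarrow> avg bs (\<lambda>b. f (b \<otimes> x)) \<le> u"
    and r: "\<And>x. x \<in> carrier G \<Longrightarrow> d \<le> avg ds (\<lambda>b. f (x \<otimes> b))"
  shows "d \<le> u"
proof -
  have "d \<le> avg bs (\<lambda>b. avg ds (\<lambda>d. f (b \<otimes> d)))"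
    using assms(1) by (intro avg_ge[of bs] r) (auto simp: translators_def)
  also have "\<dots> = avg ds (\<lambda>d. avg bs (\<lambda>b. f (b \<otimes> d)))" by (rule avg_swap)
  also have "\<dots> \<le> u"
    using assms(2) by (intro avg_le[of ds] l) (auto simp: translators_def)
  finally show ?thesis .
qed

lemma left_right_average':
  assumes "translators bs" "translators ds"
    and l: "\<And>x. x \<in> carrier G \<Longrightarrow> u \<le> avg bs (\<lambda>b. f (b \<otimes> x))"
    and r: "\<And>x. x \<in> carrier G \<Longrightarrow> avg ds (\<lambda>b. f (x \<otimes> b)) \<le> d"
  shows "u \<le> d"
proof -
  have "- d \<le> - u"
    by (rule left_right_average[OF assms(1,2), where f="\<lambda>x. -1 * f x"])
      (use l r in \<open>simp_all only: avg_cmult, simp_all\<close>)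
  then show ?thesis by simp
qed

text \<open>An almost constant right average determines the mean up to its error: comparison with
  all left averages bounds the mean below, and an almost constant left average bounds it
  above.\<close>

lemma mean_right_approx:
  assumes "cont f" "translators ds" and ds: "\<And>x. x \<in> carrier G \<Longrightarrow> \<bar>avg ds (\<lambda>b. f (x \<otimes> b)) - d\<bar> \<le> e"
  shows "\<bar>mean f - d\<bar> \<le> e"
proof -
  let ?S = "{u. \<exists>bs. translators bs \<and> (\<forall>x\<in>carrier G. avg bs (\<lambda>b. f (b \<otimes> x)) \<le> u)}"
  have lb: "d - e \<le> u" if u: "u \<in> ?S" for u
  proof -
    obtain bs where bs: "translators bs" "\<forall>x\<in>carrier G. avg bs (\<lambda>b. f (b \<otimes> x)) \<le> u" using u by blast
    show ?thesis
      by (rule left_right_average[OF bs(1) assms(2), where f=f]) (use bs(2) abs_diff_leD(2)[OF ds] in auto)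
  qed
  have ub: "mean f \<le> d + e + 2 * t" if "t > 0" for t
  proof -
    obtain bs c where bs: "translators bs" "\<And>x. x \<in> carrier G \<Longrightarrow> \<bar>avg bs (\<lambda>b. f (b \<otimes> x)) - c\<bar> \<le> t"
      using left_average_nearly_constant[OF assms(1) \<open>t > 0\<close>] by blast
    have "c - t \<le> d + e"
      by (rule left_right_average'[OF bs(1) assms(2), where f=f])
        (use abs_diff_leD(2)[OF bs(2)] abs_diff_leD(1)[OF ds] in auto)
    then have "c + t \<le> d + e + 2 * t" by simp
    moreover have "c + t \<in> ?S" using bs(1) abs_diff_leD(1)[OF bs(2)] by blast
    then have "mean f \<le> c + t" unfolding mean_def using lb by (intro cInf_lower bdd_belowI)
    ultimately show ?thesis by linarith
  qed
  have "mean f \<le> d + e"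
  proof (rule field_le_epsilon)
    show "mean f \<le> d + e + x" if "x > 0" for x using ub[of "x / 2"] that by simp
  qed
  moreover have "d - e \<le> mean f"
  proof -
    obtain bs c where bs: "translators bs" "\<And>x. x \<in> carrier G \<Longrightarrow> \<bar>avg bs (\<lambda>b. f (b \<otimes> x)) - c\<bar> \<le> 1"
      using left_average_nearly_constant[OF assms(1), of 1] by auto
    then have "c + 1 \<in> ?S" using abs_diff_leD(1)[OF bs(2)] by blast
    then show ?thesis unfolding mean_def using lb by (intro cInf_greatest) auto
  qed
  ultimately show ?thesis by (simp add: abs_le_iff)
qed

lemma mean_left_approx:
  assumes "cont f" "translators bs" and bs: "\<And>x. x \<in> carrier G \<Longrightarrow> \<bar>avg bs (\<lambda>b. f (b \<otimes> x)) - c\<bar> \<le> e"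
  shows "\<bar>mean f - c\<bar> \<le> e"
proof (rule field_le_epsilon)
  fix t :: real assume "t > 0"
  then obtain ds d where ds: "translators ds" "\<And>x. x \<in> carrier G \<Longrightarrow> \<bar>avg ds (\<lambda>b. f (x \<otimes> b)) - d\<bar> \<le> t / 2"
    using right_average_nearly_constant[OF assms(1), of "t / 2"] by auto
  have "\<bar>mean f - d\<bar> \<le> t / 2" by (rule mean_right_approx[OF assms(1) ds])
  moreover have "d - t / 2 \<le> c + e"
    by (rule left_right_average[OF assms(2) ds(1), where f=f])
      (use abs_diff_leD(1)[OF bs] abs_diff_leD(2)[OF ds(2)] in auto)
  moreover have "c - e \<le> d + t / 2"
    by (rule left_right_average'[OF assms(2) ds(1), where f=f])
      (use abs_diff_leD(2)[OF bs] abs_diff_leD(1)[OF ds(2)] in auto)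
  ultimately show "\<bar>mean f - c\<bar> \<le> e + t" unfolding abs_le_iff by (intro conjI) linarith+
qed

text \<open>Additivity needs one list of translators for both functions: \<open>ds\<close> makes
  \<open>f\<close> almost constant, then \<open>cs\<close> does so for the right average of
  \<open>g\<close> by \<open>ds\<close>. Further averaging does not spoil an almost constant
  average, so the list \<open>us\<close> of products serves both.\<close>

lemma mean_add:
  assumes "cont f" "cont g"
  shows "mean (\<lambda>x. f x + g x) = mean f + mean g"
proof (rule eq_if_close[where c=4])
  fix e :: real assume "e > 0"
  obtain ds d where ds: "translators ds" "\<And>x. x \<in> carrier G \<Longrightarrow> \<bar>avg ds (\<lambda>b. f (x \<otimes> b)) - d\<bar> \<le> e"
    using right_average_nearly_constant[OF assms(1) \<open>e > 0\<close>] by blast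
  let ?h = "\<lambda>x. avg ds (\<lambda>b. g (x \<otimes> b))"
  have "cont ?h"
    using ds(1) by (intro cont_avg cont_translate assms) (auto simp: translators_def)
  then obtain cs c where cs: "translators cs" "\<And>x. x \<in> carrier G \<Longrightarrow> \<bar>avg cs (\<lambda>b. ?h (x \<otimes> b)) - c\<bar> \<le> e"
    using right_average_nearly_constant[OF _ \<open>e > 0\<close>] by blast
  define us where "us = concat (map (\<lambda>b. map (\<lambda>d. b \<otimes> d) ds) cs)"
  have us: "translators us" using ds(1) cs(1) by (auto simp: translators_def us_def)
  have comp: "avg us (\<lambda>b. k (x \<otimes> b)) = avg cs (\<lambda>b. avg ds (\<lambda>d. k (x \<otimes> b \<otimes> d)))"
    if "x \<in> carrier G" for k :: "'g \<Rightarrow> real" and x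
  proof -
    have "avg us (\<lambda>b. k (x \<otimes> b)) = avg cs (\<lambda>b. avg ds (\<lambda>d. k (x \<otimes> (b \<otimes> d))))"
      unfolding us_def by (rule avg_concat)
    also have "\<dots> = avg cs (\<lambda>b. avg ds (\<lambda>d. k (x \<otimes> b \<otimes> d)))"
      by (intro avg_cong) (use ds(1) cs(1) that in \<open>auto simp: translators_def m_assoc subset_iff\<close>)
    finally show ?thesis .
  qed
  have F: "\<bar>avg us (\<lambda>b. f (x \<otimes> b)) - d\<bar> \<le> e" if "x \<in> carrier G" for x
    unfolding comp[OF that] using cs(1) that by (intro avg_dist[of cs] ds(2)) (auto simp: translators_def)
  have Gc: "\<bar>avg us (\<lambda>b. g (x \<otimes> b)) - c\<bar> \<le> e" if "x \<in> carrier G" for x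
    unfolding comp[OF that] using cs(2)[OF that] .
  have "\<bar>mean f - d\<bar> \<le> e" by (rule mean_right_approx[OF assms(1) us F])
  moreover have "\<bar>mean g - c\<bar> \<le> e" by (rule mean_right_approx[OF assms(2) us Gc])
  moreover have "\<bar>mean (\<lambda>x. f x + g x) - (d + c)\<bar> \<le> 2 * e"
  proof (rule mean_right_approx[OF _ us])
    show "cont (\<lambda>x. f x + g x)" by (intro continuous_map_add assms)
    show "\<bar>avg us (\<lambda>b. f (x \<otimes> b) + g (x \<otimes> b)) - (d + c)\<bar> \<le> 2 * e" if "x \<in> carrier G" for x
      using F[OF that] Gc[OF that] unfolding avg_add abs_le_iff by linarith
  qed
  ultimately show "\<bar>mean (\<lambda>x. f x + g x) - (mean f + mean g)\<bar> \<le> 4 * e"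
    unfolding abs_le_iff by linarith
qed simp

lemma mean_cmult:
  assumes "cont f" shows "mean (\<lambda>x. k * f x) = k * mean f"
proof (rule eq_if_close[where c="2 * (\<bar>k\<bar> + 1)"])
  fix e :: real assume "e > 0"
  obtain ds d where ds: "translators ds" "\<And>x. x \<in> carrier G \<Longrightarrow> \<bar>avg ds (\<lambda>b. f (x \<otimes> b)) - d\<bar> \<le> e"
    using right_average_nearly_constant[OF assms(1) \<open>e > 0\<close>] by blast
  have 1: "\<bar>mean f - d\<bar> \<le> e" by (rule mean_right_approx[OF assms(1) ds])
  have 2: "\<bar>mean (\<lambda>x. k * f x) - k * d\<bar> \<le> \<bar>k\<bar> * e"
  proof (rule mean_right_approx[OF _ ds(1)])
    show "cont (\<lambda>x. k * f x)" by (intro continuous_map_real_mult_left assms)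
    show "\<bar>avg ds (\<lambda>b. k * f (x \<otimes> b)) - k * d\<bar> \<le> \<bar>k\<bar> * e" if "x \<in> carrier G" for x
      using ds(2)[OF that] unfolding avg_cmult right_diff_distrib[symmetric] abs_mult
      by (intro mult_left_mono) auto
  qed
  have "\<bar>k * mean f - k * d\<bar> \<le> \<bar>k\<bar> * e"
    using 1 unfolding right_diff_distrib[symmetric] abs_mult by (intro mult_left_mono) auto
  then have "\<bar>mean (\<lambda>x. k * f x) - k * mean f\<bar> \<le> 2 * (\<bar>k\<bar> * e)" using 2 unfolding abs_le_iff by linarith
  also have "\<dots> \<le> 2 * (\<bar>k\<bar> + 1) * e" using \<open>e > 0\<close> by (simp add: algebra_simps)
  finally show "\<bar>mean (\<lambda>x. k * f x) - k * mean f\<bar> \<le> 2 * (\<bar>k\<bar> + 1) * e" .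
qed simp

lemma mean_cong: "(\<And>x. x \<in> carrier G \<Longrightarrow> f x = g x) \<Longrightarrow> mean f = mean g"
proof -
  assume fg: "\<And>x. x \<in> carrier G \<Longrightarrow> f x = g x"
  have "avg bs (\<lambda>b. f (b \<otimes> x)) = avg bs (\<lambda>b. g (b \<otimes> x))" if "translators bs" "x \<in> carrier G" for bs x
    by (intro avg_cong fg) (use that in \<open>auto simp: translators_def\<close>)
  then show ?thesis
    unfolding mean_def by (intro arg_cong[where f=Inf] Collect_cong ex_cong1 conj_cong refl ball_cong) simp
qed

lemma mean_ge:
  assumes "cont f" "\<And>x. x \<in> carrier G \<Longrightarrow> k \<le> f x" shows "k \<le> mean f"
proof (rule field_le_epsilon)
  fix e :: real assume "e > 0"
  then obtain ds d where ds: "translators ds" "\<And>x. x \<in> carrier G \<Longrightarrow> \<bar>avg ds (\<lambda>b. f (x \<otimes> b)) - d\<bar> \<le> e / 2"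
    using right_average_nearly_constant[OF assms(1), of "e / 2"] by auto
  have "\<bar>mean f - d\<bar> \<le> e / 2" by (rule mean_right_approx[OF assms(1) ds])
  moreover have "k \<le> avg ds (\<lambda>b. f (\<one> \<otimes> b))"
    using ds(1) assms(2) by (intro avg_ge) (auto simp: translators_def subset_iff)
  ultimately show "k \<le> mean f + e" using ds(2)[of \<one>] unfolding abs_le_iff by (simp add: algebra_simps)
qed

lemma mean_const: "mean (\<lambda>_. k) = k"
proof -
  have "\<bar>mean (\<lambda>_. k) - k\<bar> \<le> 0"
    by (rule mean_right_approx[where ds="[\<one>]"]) (auto simp: translators_def avg_def)
  then show ?thesis by simp
qed

lemma mean_minus: "cont f \<Longrightarrow> mean (\<lambda>x. - f x) = - mean f"
  using mean_cmult[of f "-1"] by simp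

lemma mean_diff: "cont f \<Longrightarrow> cont g \<Longrightarrow> mean (\<lambda>x. f x - g x) = mean f - mean g"
  using mean_add[of f "\<lambda>x. - g x"] mean_minus[of g] continuous_map_minus[of Y g] by simp

lemma mean_abs_le:
  assumes "cont f" "\<And>x. x \<in> carrier G \<Longrightarrow> \<bar>f x\<bar> \<le> k" shows "\<bar>mean f\<bar> \<le> k"
proof -
  have "- k \<le> mean f" by (rule mean_ge[OF assms(1)]) (use assms(2) in \<open>force simp: abs_le_iff\<close>)
  moreover have "- k \<le> mean (\<lambda>x. - f x)"
    by (rule mean_ge) (use assms in \<open>auto simp: abs_le_iff continuous_map_minus\<close>)
  ultimately show ?thesis by (simp add: mean_minus assms(1) abs_le_iff)
qed

text \<open>Right translation by \<open>b\<close> only changes the point at which a left average is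
  evaluated, so one almost constant left average approximates both means.\<close>

lemma mean_translate:
  assumes "cont f" "b \<in> carrier G" shows "mean (\<lambda>x. f (x \<otimes> b)) = mean f"
proof (rule eq_if_close[where c=2])
  fix e :: real assume "e > 0"
  obtain bs c where bs: "translators bs" "\<And>x. x \<in> carrier G \<Longrightarrow> \<bar>avg bs (\<lambda>b. f (b \<otimes> x)) - c\<bar> \<le> e"
    using left_average_nearly_constant[OF assms(1) \<open>e > 0\<close>] by blast
  have "\<bar>mean f - c\<bar> \<le> e" by (rule mean_left_approx[OF assms(1) bs])
  moreover have "\<bar>mean (\<lambda>x. f (x \<otimes> b)) - c\<bar> \<le> e"
  proof (rule mean_left_approx[OF cont_translate(2)[OF assms] bs(1)])
    fix x assume x: "x \<in> carrier G"
    have "avg bs (\<lambda>a. f (a \<otimes> x \<otimes> b)) = avg bs (\<lambda>a. f (a \<otimes> (x \<otimes> b)))"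
      by (intro avg_cong) (use bs(1) x assms(2) in \<open>auto simp: translators_def m_assoc subset_iff\<close>)
    then show "\<bar>avg bs (\<lambda>a. f (a \<otimes> x \<otimes> b)) - c\<bar> \<le> e" using bs(2)[of "x \<otimes> b"] x assms(2) by simp
  qed
  ultimately show "\<bar>mean (\<lambda>x. f (x \<otimes> b)) - mean f\<bar> \<le> 2 * e" unfolding abs_le_iff by linarith
qed simp

end

section \<open>Smooth families and differentiation under the mean\<close>

text \<open>Joint continuity, phrased with open boxes because the group carries an explicit topology
  while the coordinates use the topology of their type.\<close>

definition param_cont :: "'g topology \<Rightarrow> ('g \<Rightarrow> 'a::topological_space \<Rightarrow> real) \<Rightarrow> 'g \<Rightarrow> 'a \<Rightarrow> bool" where
  "param_cont Y u a x \<longleftrightarrow> (\<forall>e>0. \<exists>A V. openin Y A \<and> open V \<and> a \<in> A \<and> x \<in> V \<and>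
     (\<forall>b\<in>A. \<forall>y\<in>V. \<bar>u b y - u a x\<bar> < e))"

text \<open>The group element is a parameter: derivatives are taken in the second argument only, but
  must be jointly continuous in both.\<close>

primrec param_Ck ::
  "nat \<Rightarrow> 'g topology \<Rightarrow> ('g \<times> 'a::real_normed_vector) set \<Rightarrow> ('g \<Rightarrow> 'a \<Rightarrow> real) \<Rightarrow> bool" where
  "param_Ck 0 Y \<Omega> u \<longleftrightarrow> (\<forall>(a, x)\<in>\<Omega>. param_cont Y u a x)"
| "param_Ck (Suc k) Y \<Omega> u \<longleftrightarrow> (\<forall>(a, x)\<in>\<Omega>. param_cont Y u a x) \<and>
     (\<forall>(a, x)\<in>\<Omega>. u a differentiable (at x)) \<and> (\<forall>v. param_Ck k Y \<Omega> (\<lambda>a x. fd (u a) x v))"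

definition box_open :: "'g topology \<Rightarrow> ('g \<times> 'a::topological_space) set \<Rightarrow> bool" where
  "box_open Y \<Omega> \<longleftrightarrow> (\<forall>(a, x)\<in>\<Omega>. \<exists>A V. openin Y A \<and> open V \<and> a \<in> A \<and> x \<in> V \<and> A \<times> V \<subseteq> \<Omega>)"

lemma box_openD:
  "box_open Y \<Omega> \<Longrightarrow> (a, x) \<in> \<Omega> \<Longrightarrow> \<exists>A V. openin Y A \<and> open V \<and> a \<in> A \<and> x \<in> V \<and> A \<times> V \<subseteq> \<Omega>"
  by (auto simp: box_open_def)

lemma param_Ck_local:
  "(\<And>a x. (a, x) \<in> \<Omega> \<Longrightarrow> \<exists>\<Omega>'. (a, x) \<in> \<Omega>' \<and> param_Ck k Y \<Omega>' u) \<Longrightarrow> param_Ck k Y \<Omega> u"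
proof (induction k arbitrary: u)
  case 0
  have "param_cont Y u a x" if ax: "(a, x) \<in> \<Omega>" for a x
    using 0[OF ax] by auto
  then show ?case by auto
next
  case (Suc k)
  have "param_Ck k Y \<Omega> (\<lambda>a x. fd (u a) x v)" for v
  proof (rule Suc.IH)
    fix a x assume ax: "(a, x) \<in> \<Omega>"
    obtain \<Omega>' where "(a, x) \<in> \<Omega>'" "param_Ck (Suc k) Y \<Omega>' u" using Suc.prems[OF ax] by blast
    then show "\<exists>\<Omega>'. (a, x) \<in> \<Omega>' \<and> param_Ck k Y \<Omega>' (\<lambda>a x. fd (u a) x v)" by auto
  qed
  moreover have "param_cont Y u a x \<and> u a differentiable (at x)" if ax: "(a, x) \<in> \<Omega>" for a x
    using Suc.prems[OF ax] by auto
  ultimately show ?case by auto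
qed

lemma param_contE:
  assumes "param_cont Y u a x" "e > 0"
  obtains A V where "openin Y A" "open V" "a \<in> A" "x \<in> V"
    "\<forall>b\<in>A. \<forall>y\<in>V. \<bar>u b y - u a x\<bar> < e"
proof -
  have "\<exists>A V. openin Y A \<and> open V \<and> a \<in> A \<and> x \<in> V \<and> (\<forall>b\<in>A. \<forall>y\<in>V. \<bar>u b y - u a x\<bar> < e)"
    using assms(1)[unfolded param_cont_def] assms(2) by simp
  then show thesis using that by (elim exE conjE)
qed

lemma param_contI:
  assumes "\<And>e. e > 0 \<Longrightarrow> \<exists>A V. openin Y A \<and> open V \<and> a \<in> A \<and> x \<in> V \<and>
     (\<forall>b\<in>A. \<forall>y\<in>V. \<bar>u b y - u a x\<bar> < e)"
  shows "param_cont Y u a x"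
  using assms by (simp add: param_cont_def)

lemma param_cont_cong:
  assumes "param_cont Y u a x" "openin Y A" "open V" "a \<in> A" "x \<in> V"
    and eq: "\<And>b y. b \<in> A \<Longrightarrow> y \<in> V \<Longrightarrow> u b y = u' b y"
  shows "param_cont Y u' a x"
proof (rule param_contI)
  fix e :: real assume "e > 0"
  with assms(1) obtain A' V' where AV: "openin Y A'" "open V'" "a \<in> A'" "x \<in> V'"
      "\<forall>b\<in>A'. \<forall>y\<in>V'. \<bar>u b y - u a x\<bar> < e"
    by (rule param_contE)
  have "\<bar>u' b y - u' a x\<bar> < e" if "b \<in> A \<inter> A'" "y \<in> V \<inter> V'" for b y
    using AV(5) eq[of b y] eq[of a x] that assms(4,5) by force
  moreover have "openin Y (A \<inter> A')" "open (V \<inter> V')" "a \<in> A \<inter> A'" "x \<in> V \<inter> V'"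
    using assms AV by auto
  ultimately show "\<exists>A V. openin Y A \<and> open V \<and> a \<in> A \<and> x \<in> V \<and> (\<forall>b\<in>A. \<forall>y\<in>V. \<bar>u' b y - u' a x\<bar> < e)"
    by blast
qed

lemma param_Ck_cong:
  assumes "box_open Y \<Omega>" "\<And>a x. (a, x) \<in> \<Omega> \<Longrightarrow> u a x = u' a x" "param_Ck k Y \<Omega> u"
  shows "param_Ck k Y \<Omega> u'"
  using assms(2,3)
proof (induction k arbitrary: u u')
  have c: "\<forall>(a, x)\<in>\<Omega>. param_cont Y u' a x"
    if eq: "\<And>a x. (a, x) \<in> \<Omega> \<Longrightarrow> u a x = u' a x" and u: "\<forall>(a, x)\<in>\<Omega>. param_cont Y u a x" for u u'
  proof clarify
    fix a x assume ax: "(a, x) \<in> \<Omega>"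
    from box_openD[OF assms(1) ax] obtain A V where "openin Y A" "open V" "a \<in> A" "x \<in> V" "A \<times> V \<subseteq> \<Omega>" by blast
    note AV = this
    have "param_cont Y u a x" using u ax by blast
    then show "param_cont Y u' a x"
      by (rule param_cont_cong[OF _ AV(1-4)]) (use AV(5) eq in blast)
  qed
  {
    case 0
    show ?case unfolding param_Ck.simps by (rule c[of u]) (use 0 in auto)
  next
    case (Suc k)
    have d: "(u' a has_derivative (\<lambda>v. fd (u a) x v)) (at x)" if ax: "(a, x) \<in> \<Omega>" for a x
    proof -
      from box_openD[OF assms(1) ax] obtain A V where AV: "openin Y A" "open V" "a \<in> A" "x \<in> V" "A \<times> V \<subseteq> \<Omega>" by blast
      have "(u a has_derivative (\<lambda>v. fd (u a) x v)) (at x)"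
        using Suc.prems(2) ax by (intro differentiable_fd) auto
      then show ?thesis
        by (rule has_derivative_transform_within_open[OF _ AV(2,4)]) (use AV Suc.prems(1) in auto)
    qed
    have "param_Ck k Y \<Omega> (\<lambda>a x. fd (u' a) x v)" for v
      by (rule Suc.IH[where u="\<lambda>a x. fd (u a) x v"]) (use Suc.prems(2) fd_eq[OF d] in auto)
    moreover have "\<forall>(a, x)\<in>\<Omega>. param_cont Y u' a x"
      by (rule c[of u]) (use Suc.prems in auto)
    moreover have "u' a differentiable (at x)" if "(a, x) \<in> \<Omega>" for a x
      by (rule differentiableI[OF d[OF that]])
    ultimately show ?case by auto
  }
qed

text \<open>Joint regularity is inherited from a function of the coordinates of both arguments. The
  derivative in \<open>x\<close> is \<open>fd w\<close> along \<open>(0, v)\<close>, which is again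
  of the same form.\<close>

lemma param_Ck_compose_chart:
  fixes w :: "'e::real_normed_vector \<times> 'a::real_normed_vector \<Rightarrow> real"
  assumes "open R" and D: "\<And>S. open S \<Longrightarrow> openin Y {a \<in> D. b a \<in> S}" and "Ck_on k R w"
  shows "param_Ck k Y {(a, x). a \<in> D \<and> (b a, x) \<in> R} (\<lambda>a x. w (b a, x))"
  using assms(3)
proof (induction k arbitrary: w)
  let ?\<Omega> = "{(a, x). a \<in> D \<and> (b a, x) \<in> R}"
  have box: "\<exists>A V. openin Y A \<and> open V \<and> a \<in> A \<and> x \<in> V \<and> (\<forall>c\<in>A. c \<in> D) \<and> (\<forall>c\<in>A. \<forall>y\<in>V. (b c, y) \<in> N)"
    if N: "open N" and a: "a \<in> D" and ax: "(b a, x) \<in> N" for N a x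
  proof -
    obtain S V where "open S" "open V" "b a \<in> S" "x \<in> V" "S \<times> V \<subseteq> N"
      using open_prod_elim[OF N ax] by (metis mem_Sigma_iff)
    then show ?thesis
      using D[of S] a by (intro exI[of _ "{a \<in> D. b a \<in> S}"] exI[of _ V]) auto
  qed
  have c: "\<forall>(a, x)\<in>?\<Omega>. param_cont Y (\<lambda>a x. w (b a, x)) a x"
    if w: "continuous_on R w" for w :: "'e \<times> 'a \<Rightarrow> real"
  proof clarify
    fix a x assume ax: "a \<in> D" "(b a, x) \<in> R"
    show "param_cont Y (\<lambda>a x. w (b a, x)) a x"
    proof (rule param_contI)
      fix e :: real assume "e > 0"
      let ?N = "R \<inter> w -` ball (w (b a, x)) e"
      have "open ?N" using continuous_open_preimage[OF w assms(1) open_ball] .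
      from box[OF this ax(1), of x] obtain A V where "openin Y A" "open V" "a \<in> A" "x \<in> V" "\<forall>c\<in>A. \<forall>y\<in>V. (b c, y) \<in> ?N"
        using \<open>e > 0\<close> ax by auto
      then show "\<exists>A V. openin Y A \<and> open V \<and> a \<in> A \<and> x \<in> V \<and> (\<forall>c\<in>A. \<forall>y\<in>V. \<bar>w (b c, y) - w (b a, x)\<bar> < e)"
        by (intro exI[of _ A] exI[of _ V]) (auto simp: dist_real_def abs_minus_commute)
    qed
  qed
  have bo: "box_open Y ?\<Omega>"
    unfolding box_open_def
  proof clarify
    fix a x assume ax: "a \<in> D" "(b a, x) \<in> R"
    from box[OF assms(1) ax] obtain A V where "openin Y A" "open V" "a \<in> A" "x \<in> V" "\<forall>c\<in>A. c \<in> D"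
      "\<forall>c\<in>A. \<forall>y\<in>V. (b c, y) \<in> R" by (elim exE conjE)
    then show "\<exists>A V. openin Y A \<and> open V \<and> a \<in> A \<and> x \<in> V \<and> A \<times> V \<subseteq> ?\<Omega>"
      by (intro exI[of _ A] exI[of _ V]) auto
  qed
  {
    case 0
    then show ?case using c by simp
  next
    case (Suc k)
    have d: "((\<lambda>x. w (b a, x)) has_derivative (\<lambda>v. fd w (b a, x) (0, v))) (at x)" if "(b a, x) \<in> R" for a x
    proof -
      have "(w has_derivative (\<lambda>z. fd w (b a, x) z)) (at (b a, x))"
        using Suc.prems that by (intro differentiable_fd) auto
      moreover have "((\<lambda>x. (b a, x)) has_derivative (\<lambda>v. (0, v))) (at x)"
        by (auto intro!: derivative_eq_intros)
      ultimately show ?thesis using diff_chain_at[of "\<lambda>x. (b a, x)" _ x w] by (simp add: o_def)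
    qed
    have "param_Ck k Y ?\<Omega> (\<lambda>a x. fd (\<lambda>x. w (b a, x)) x v)" for v
    proof (rule param_Ck_cong[OF bo])
      show "param_Ck k Y ?\<Omega> (\<lambda>a x. fd w (b a, x) (0, v))"
        using Suc.prems by (intro Suc.IH) simp
    qed (auto simp: fd_eq[OF d])
    moreover have "\<forall>(a, x)\<in>?\<Omega>. param_cont Y (\<lambda>a x. w (b a, x)) a x"
      by (rule c) (use Ck_on_le[OF Suc.prems, of 0] in simp)
    moreover have "(\<lambda>x. w (b a, x)) differentiable (at x)" if "(b a, x) \<in> R" for a x
      by (rule differentiableI[OF d[OF that]])
    ultimately show ?case by auto
  }
qed

lemma Ck_on_slice:
  fixes w :: "'e::real_normed_vector \<times> 'a::real_normed_vector \<Rightarrow> 'b::real_normed_vector"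
  assumes "open R" "Ck_on k R w"
  shows "Ck_on k {x. (e, x) \<in> R} (\<lambda>x. w (e, x))"
  using assms(2)
proof (induction k arbitrary: w)
  case 0
  then show ?case
    by (auto intro!: continuous_on_compose2[of R w] continuous_intros)
next
  case (Suc k)
  have op: "open {x. (e, x) \<in> R}"
    using open_vimage[OF assms(1), of "\<lambda>x. (e, x)"] by (simp add: vimage_def continuous_intros)
  show ?case
  proof (rule Ck_on_Suc_has_derivativeI[OF op, where f'="\<lambda>x v. fd w (e, x) (0, v)"])
    fix x assume "x \<in> {x. (e, x) \<in> R}"
    then have "(w has_derivative (\<lambda>z. fd w (e, x) z)) (at (e, x))"
      using Suc.prems by (intro differentiable_fd) auto
    moreover have "((\<lambda>x. (e, x)) has_derivative (\<lambda>v. (0, v))) (at x)"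
      by (auto intro!: derivative_eq_intros)
    ultimately show "((\<lambda>x. w (e, x)) has_derivative (\<lambda>v. fd w (e, x) (0, v))) (at x)"
      using diff_chain_at[of "\<lambda>x. (e, x)" _ x w] by (simp add: o_def)
  next
    show "Ck_on k {x. (e, x) \<in> R} (\<lambda>x. fd w (e, x) (0, v))" for v
      using Suc.prems by (intro Suc.IH) simp
  qed
qed

section \<open>Means of smooth families\<close>

context compact_group
begin

lemma param_cont_cont:
  assumes "\<And>a. a \<in> carrier G \<Longrightarrow> param_cont Y u a x"
  shows "cont (\<lambda>a. u a x)"
  unfolding continuous_map_def
proof (intro conjI allI impI)
  fix T :: "real set" assume "openin euclideanreal T"
  then have "open T" by simp
  show "openin Y {a \<in> topspace Y. u a x \<in> T}"
  proof (subst openin_subopen, clarify)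
    fix a assume a: "a \<in> topspace Y" "u a x \<in> T"
    then obtain e where e: "e > 0" "ball (u a x) e \<subseteq> T"
      using \<open>open T\<close> open_contains_ball by blast
    have "a \<in> carrier G" using a(1) topspace_Y by simp
    then obtain A V where "openin Y A" "open V" "a \<in> A" "x \<in> V" "\<forall>b\<in>A. \<forall>y\<in>V. \<bar>u b y - u a x\<bar> < e"
      by (rule param_contE[OF assms e(1)])
    then show "\<exists>A. openin Y A \<and> a \<in> A \<and> A \<subseteq> {a \<in> topspace Y. u a x \<in> T}"
      using e(2) openin_subset[of Y A] by (intro exI[of _ A]) (auto simp: dist_real_def abs_minus_commute)
  qed
qed simp

text \<open>A tube argument: finitely many of the sets \<open>A a\<close> cover the group, and the
  intersection of the corresponding \<open>V a\<close> serves all group elements. The bound is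
  halved because both values are compared with \<open>u a x\<close> for the centre \<open>a\<close>
  of such a set.\<close>

lemma param_cont_uniform:
  assumes u: "\<And>a. a \<in> carrier G \<Longrightarrow> param_cont Y u a x" and "e > 0"
  shows "\<exists>V. open V \<and> x \<in> V \<and> (\<forall>a\<in>carrier G. \<forall>y\<in>V. \<bar>u a y - u a x\<bar> < e)"
proof -
  have "\<forall>a\<in>carrier G. \<exists>A V. openin Y A \<and> open V \<and> a \<in> A \<and> x \<in> V \<and> (\<forall>b\<in>A. \<forall>y\<in>V. \<bar>u b y - u a x\<bar> < e / 2)"
  proof
    fix a assume "a \<in> carrier G"
    have "e / 2 > 0" using \<open>e > 0\<close> by simp
    then show "\<exists>A V. openin Y A \<and> open V \<and> a \<in> A \<and> x \<in> V \<and> (\<forall>b\<in>A. \<forall>y\<in>V. \<bar>u b y - u a x\<bar> < e / 2)"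
      using u[OF \<open>a \<in> carrier G\<close>] unfolding param_cont_def by blast
  qed
  then obtain A V where AV: "\<And>a. a \<in> carrier G \<Longrightarrow> openin Y (A a) \<and> open (V a) \<and> a \<in> A a \<and> x \<in> V a"
      "\<And>a b y. a \<in> carrier G \<Longrightarrow> b \<in> A a \<Longrightarrow> y \<in> V a \<Longrightarrow> \<bar>u b y - u a x\<bar> < e / 2"
    by metis
  have "\<And>U. U \<in> A ` carrier G \<Longrightarrow> openin Y U" "topspace Y \<subseteq> \<Union> (A ` carrier G)"
    using AV(1) by (auto simp: topspace_Y)
  then obtain \<F> where "finite \<F>" "\<F> \<subseteq> A ` carrier G" "topspace Y \<subseteq> \<Union> \<F>"
    using compact_Y unfolding compact_space_def compactin_def by metis
  then obtain F where F: "finite F" "F \<subseteq> carrier G" "\<F> = A ` F"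
    by (meson finite_subset_image)
  let ?V = "\<Inter>a\<in>F. V a"
  have "\<bar>u b y - u b x\<bar> < e" if b: "b \<in> carrier G" and y: "y \<in> ?V" for b y
  proof -
    have "b \<in> \<Union> (A ` F)" using \<open>topspace Y \<subseteq> \<Union> \<F>\<close> F(3) b topspace_Y by auto
    then obtain a where a: "a \<in> F" "b \<in> A a" by blast
    have "\<bar>u b y - u a x\<bar> < e / 2"
      by (rule AV(2)) (use a F(2) y in auto)
    moreover have "\<bar>u b x - u a x\<bar> < e / 2"
      by (rule AV(2)) (use a F(2) AV(1) in auto)
    ultimately show ?thesis by linarith
  qed
  moreover have "open ?V" "x \<in> ?V" using AV(1) F by auto
  ultimately show ?thesis by blast
qed

text \<open>Near \<open>x\<close> the derivatives are uniformly close to those at \<open>x\<close>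
  for all group elements, so the linearisation error is uniformly small. The mean is linear and
  bounded by the supremum, hence preserves this estimate.\<close>

lemma mean_has_derivative:
  fixes u :: "'g \<Rightarrow> real^'n \<Rightarrow> real"
  assumes "open U" "param_Ck 1 Y (carrier G \<times> U) u" "x \<in> U"
  shows "((\<lambda>x. mean (\<lambda>a. u a x)) has_derivative (\<lambda>v. mean (\<lambda>a. fd (u a) x v))) (at x)"
proof -
  have pc: "param_cont Y u a y" "u a differentiable (at y)" "param_cont Y (\<lambda>a x. fd (u a) x v) a y"
    if "a \<in> carrier G" "y \<in> U" for a y v
    using assms(2) that by auto
  have cu: "cont (\<lambda>a. u a y)" "cont (\<lambda>a. fd (u a) y v)" if "y \<in> U" for y v
    using param_cont_cont pc that by blast+
  have lin: "linear (\<lambda>v. fd (u a) y v)" if "a \<in> carrier G" "y \<in> U" for a y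
    by (rule linear_fd[OF pc(2)[OF that]])
  have bl: "bounded_linear (\<lambda>v. mean (\<lambda>a. fd (u a) x v))"
    unfolding linear_conv_bounded_linear[symmetric]
  proof (rule linearI)
    fix v w and c :: real
    have "mean (\<lambda>a. fd (u a) x (v + w)) = mean (\<lambda>a. fd (u a) x v + fd (u a) x w)"
      by (intro mean_cong) (simp add: linear_add[OF lin[OF _ assms(3)]])
    then show "mean (\<lambda>a. fd (u a) x (v + w)) = mean (\<lambda>a. fd (u a) x v) + mean (\<lambda>a. fd (u a) x w)"
      using mean_add cu(2)[OF assms(3)] by simp
    have "mean (\<lambda>a. fd (u a) x (c *\<^sub>R v)) = mean (\<lambda>a. c * fd (u a) x v)"
      by (intro mean_cong) (simp add: linear_scale[OF lin[OF _ assms(3)]])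
    then show "mean (\<lambda>a. fd (u a) x (c *\<^sub>R v)) = c *\<^sub>R mean (\<lambda>a. fd (u a) x v)"
      using mean_cmult cu(2)[OF assms(3)] by simp
  qed
  have est: "\<exists>d>0. \<forall>y. norm (y - x) < d \<longrightarrow> norm (mean (\<lambda>a. u a y) - mean (\<lambda>a. u a x)
      - mean (\<lambda>a. fd (u a) x (y - x))) \<le> e * norm (y - x)" if "e > 0" for e :: real
  proof -
    define n where "n = real CARD('n)"
    have "n > 0" by (simp add: n_def)
    \<comment> \<open>The operator norm of the difference of derivatives is estimated through its
      \<open>n\<close> values on axis vectors, hence \<open>e / n\<close>.\<close>
    have "\<forall>i. \<exists>V. open V \<and> x \<in> V \<and> (\<forall>a\<in>carrier G. \<forall>y\<in>V. \<bar>fd (u a) y (axis i 1) - fd (u a) x (axis i 1)\<bar> < e / n)"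
    proof
      fix i
      have "e / n > 0" using \<open>e > 0\<close> \<open>n > 0\<close> by simp
      from param_cont_uniform[OF pc(3)[OF _ assms(3)] this]
      show "\<exists>V. open V \<and> x \<in> V \<and> (\<forall>a\<in>carrier G. \<forall>y\<in>V. \<bar>fd (u a) y (axis i 1) - fd (u a) x (axis i 1)\<bar> < e / n)" .
    qed
    then obtain V where V: "\<And>i. open (V i) \<and> x \<in> V i"
        "\<And>i a y. a \<in> carrier G \<Longrightarrow> y \<in> V i \<Longrightarrow> \<bar>fd (u a) y (axis i 1) - fd (u a) x (axis i 1)\<bar> < e / n"
      by metis
    have "open (U \<inter> (\<Inter>i. V i))" using V(1) assms(1) by (intro open_Int open_INT) auto
    moreover have "x \<in> U \<inter> (\<Inter>i. V i)" using V(1) assms(3) by auto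
    ultimately obtain d where d: "d > 0" "ball x d \<subseteq> U \<inter> (\<Inter>i. V i)"
      using open_contains_ball by meson
    have pt: "\<bar>u a y - u a x - fd (u a) x (y - x)\<bar> \<le> e * norm (y - x)"
      if a: "a \<in> carrier G" and y: "y \<in> ball x d" for a y
    proof -
      have "norm (u a y - u a x - fd (u a) x (y - x)) \<le> norm (y - x) * e"
      proof (rule differentiable_bound_linearization[where S="ball x d" and f'="\<lambda>z. frechet_derivative (u a) (at z)"])
        show "x + t *\<^sub>R (y - x) \<in> ball x d" if "t \<in> {0..1}" for t
          using y that by (auto simp: dist_norm norm_minus_commute intro: le_less_trans[OF mult_left_le_one_le])
        show "(u a has_derivative fd (u a) z) (at z within ball x d)" if "z \<in> ball x d" for z
          using differentiable_fd[OF pc(2)[OF a]] d(2) that has_derivative_at_withinI by blast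
        show "onorm (frechet_derivative (u a) (at z) - frechet_derivative (u a) (at x)) \<le> e"
          if z: "z \<in> ball x d" for z
          unfolding fun_diff_def
        proof (rule onorm_le)
          fix v
          have zU: "z \<in> U" using z d(2) by auto
          have "linear (\<lambda>v. fd (u a) z v - fd (u a) x v)"
            by (intro linear_compose_sub lin a zU assms(3))
          from linear_axis_sum_real[OF this, of v]
          have "\<bar>fd (u a) z v - fd (u a) x v\<bar> = \<bar>\<Sum>i\<in>UNIV. v $ i * (fd (u a) z (axis i 1) - fd (u a) x (axis i 1))\<bar>"
            by simp
          also have "\<dots> \<le> (\<Sum>i\<in>(UNIV::'n set). norm v * (e / n))"
          proof (intro order_trans[OF sum_abs] sum_mono)
            fix i :: 'n
            have "\<bar>fd (u a) z (axis i 1) - fd (u a) x (axis i 1)\<bar> \<le> e / n"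
              using V(2)[OF a, of z i] z d(2) by force
            then show "\<bar>v $ i * (fd (u a) z (axis i 1) - fd (u a) x (axis i 1))\<bar> \<le> norm v * (e / n)"
              unfolding abs_mult by (intro mult_mono component_le_norm_cart) auto
          qed
          also have "\<dots> = e * norm v" using \<open>n > 0\<close> by (simp add: n_def)
          finally show "norm (fd (u a) z v - fd (u a) x v) \<le> e * norm v" by simp
        qed
      qed (use d(1) in auto)
      then show ?thesis by (simp add: mult.commute)
    qed
    have "norm (mean (\<lambda>a. u a y) - mean (\<lambda>a. u a x) - mean (\<lambda>a. fd (u a) x (y - x))) \<le> e * norm (y - x)"
      if "norm (y - x) < d" for y
    proof -
      have y: "y \<in> ball x d" using that by (simp add: dist_norm norm_minus_commute)
      then have yU: "y \<in> U" using d(2) by auto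
      note c = cu(1)[OF yU] cu(1)[OF assms(3)] cu(2)[OF assms(3)]
      have "mean (\<lambda>a. u a y) - mean (\<lambda>a. u a x) - mean (\<lambda>a. fd (u a) x (y - x))
          = mean (\<lambda>a. u a y - u a x - fd (u a) x (y - x))"
        using mean_diff[OF continuous_map_diff[OF c(1,2)] c(3)] mean_diff[OF c(1,2)] by simp
      then show ?thesis
        using mean_abs_le[OF continuous_map_diff[OF continuous_map_diff[OF c(1,2)] c(3)] pt[OF _ y]] by simp
    qed
    then show ?thesis using d(1) by blast
  qed
  show ?thesis unfolding has_derivative_at_alt using bl est by blast
qed

lemma mean_Ck_on:
  fixes u :: "'g \<Rightarrow> real^'n \<Rightarrow> real"
  assumes "open U" "param_Ck k Y (carrier G \<times> U) u"
  shows "Ck_on k U (\<lambda>x. mean (\<lambda>a. u a x))"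
  using assms(2)
proof (induction k arbitrary: u)
  case 0
  have "isCont (\<lambda>x. mean (\<lambda>a. u a x)) x" if "x \<in> U" for x
    unfolding continuous_at_eps_delta
  proof (intro allI impI)
    fix e :: real assume "e > 0"
    have "param_cont Y u a x" if "a \<in> carrier G" for a using 0 that \<open>x \<in> U\<close> by auto
    from param_cont_uniform[of u x "e / 2", OF this] \<open>e > 0\<close> obtain V where
      "open V" "x \<in> V" and V: "\<forall>a\<in>carrier G. \<forall>y\<in>V. \<bar>u a y - u a x\<bar> < e / 2"
      by (metis half_gt_zero)
    have "open (V \<inter> U)" "x \<in> V \<inter> U"
      using \<open>open V\<close> \<open>x \<in> V\<close> \<open>x \<in> U\<close> assms(1) by auto
    then obtain d where d: "d > 0" "ball x d \<subseteq> V \<inter> U"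
      using open_contains_ball by blast
    have "dist (mean (\<lambda>a. u a y)) (mean (\<lambda>a. u a x)) < e" if y: "dist y x < d" for y
    proof -
      have y: "y \<in> U" "y \<in> V" using y d(2) by (auto simp: dist_commute)
      have c: "cont (\<lambda>a. u a y)" "cont (\<lambda>a. u a x)"
        using 0 y \<open>x \<in> U\<close> by (auto intro!: param_cont_cont)
      have "\<bar>mean (\<lambda>a. u a y - u a x)\<bar> \<le> e / 2"
        using V y by (intro mean_abs_le continuous_map_diff c) (auto intro: less_imp_le)
      then show ?thesis using \<open>e > 0\<close> by (simp add: mean_diff[OF c] dist_real_def)
    qed
    then show "\<exists>d>0. \<forall>y. dist y x < d \<longrightarrow> dist (mean (\<lambda>a. u a y)) (mean (\<lambda>a. u a x)) < e"
      using d(1) by blast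
  qed
  then show ?case by (simp add: continuous_at_imp_continuous_on)
next
  case (Suc k)
  have "param_Ck 1 Y (carrier G \<times> U) u"
    using Suc.prems by (cases k) auto
  then show ?case
    by (intro Ck_on_Suc_has_derivativeI[OF assms(1) mean_has_derivative[OF assms(1)]])
      (use Suc in auto)
qed

end

text \<open>Terms that still contain \<open>\<psi> x - x0\<close> vanish at the fixed point, so
  second derivatives of \<open>\<psi>\<close> do not contribute: the Hessian is that of the form,
  pulled back by a derivative that preserves it.\<close>

lemma quadratic_form_second_derivative:
  fixes H :: "real^'n^'n" and \<psi> :: "real^'n \<Rightarrow> real^'n"
  assumes "open U" "smooth_on U \<psi>" "x0 \<in> U" "\<psi> x0 = x0" "transpose H = H"
    and J: "\<And>v w. fd \<psi> x0 v \<bullet> (H *v fd \<psi> x0 w) = v \<bullet> (H *v w)"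
  defines "q \<equiv> \<lambda>x. (\<psi> x - x0) \<bullet> (H *v (\<psi> x - x0))"
  shows "fd q x0 v = 0" "fd (\<lambda>x. fd q x v) x0 w = 2 * (w \<bullet> (H *v v))"
proof -
  have sym: "a \<bullet> (H *v b) = b \<bullet> (H *v a)" for a b
    using assms(5) dot_lmul_matrix[of a H b] vector_transpose_matrix[of a H]
      transpose_matrix_vector[of H a] by (simp add: inner_commute)
  have bb: "bounded_bilinear (\<lambda>a b. a \<bullet> (H *v b))"
    unfolding bilinear_conv_bounded_bilinear[symmetric] bilinear_def
    by (auto intro!: linearI simp: inner_add_left inner_add_right algebra_simps)
  have d: "((\<lambda>x. \<psi> x - x0) has_derivative (\<lambda>v. fd \<psi> x v)) (at x)" if "x \<in> U" for x
    using smooth_on_has_derivative[OF assms(2) that] by (auto intro!: derivative_eq_intros)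
  have dq: "fd q x v = 2 * ((\<psi> x - x0) \<bullet> (H *v fd \<psi> x v))" if "x \<in> U" for x v
    using fd_eq[OF bounded_bilinear.FDERIV[OF bb d[OF that] d[OF that]], of v]
      sym[of "fd \<psi> x v" "\<psi> x - x0"] unfolding q_def by simp
  show "fd q x0 v = 0" using dq[OF assms(3)] assms(4) by simp
  have "((\<lambda>x. fd \<psi> x v) has_derivative (\<lambda>w. fd (\<lambda>x. fd \<psi> x v) x0 w)) (at x0)"
    by (rule smooth_on_has_derivative[OF smooth_on_fd[OF assms(2)] assms(3)])
  from has_derivative_mult_right[OF bounded_bilinear.FDERIV[OF bb d[OF assms(3)] this], of 2]
  have "((\<lambda>x. 2 * ((\<psi> x - x0) \<bullet> (H *v fd \<psi> x v))) has_derivative (\<lambda>w. 2 * (fd \<psi> x0 w \<bullet> (H *v fd \<psi> x0 v)))) (at x0)"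
    by (simp add: assms(4))
  then have "((\<lambda>x. fd q x v) has_derivative (\<lambda>w. 2 * (w \<bullet> (H *v v)))) (at x0)"
    unfolding J by (rule has_derivative_transform_within_open[OF _ assms(1,3)]) (simp add: dq)
  then show "fd (\<lambda>x. fd q x v) x0 w = 2 * (w \<bullet> (H *v v))" by (rule fd_eq)
qed

section \<open>Smooth functions on manifolds and invariant bump functions\<close>

abbreviation cinv :: "('m, 'e) chart \<Rightarrow> 'e \<Rightarrow> 'm" where
  "cinv c \<equiv> inv_into (fst c) (snd c)"

definition smooth_fun :: "('m, 'e::real_normed_vector) chart set \<Rightarrow> ('m \<Rightarrow> real) \<Rightarrow> bool" where
  "smooth_fun A q \<longleftrightarrow> (\<forall>c\<in>A. smooth_on (snd c ` fst c) (\<lambda>x. q (cinv c x)))"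

text \<open>No differentiability is assumed: the two functions have the same derivatives at
  \<open>x\<close>, and \<open>frechet_derivative\<close> is selected from these.\<close>

lemma fd_local_cong:
  assumes "open W" "x \<in> W" "\<And>y. y \<in> W \<Longrightarrow> f y = g y"
  shows "fd f x v = fd g x v"
proof -
  have "(f has_derivative f') (at x) \<longleftrightarrow> (g has_derivative f') (at x)" for f'
    using has_derivative_transform_within_open[OF _ assms(1,2), of f f' UNIV g]
      has_derivative_transform_within_open[OF _ assms(1,2), of g f' UNIV f] assms(3) by auto
  then show ?thesis by (simp add: frechet_derivative_def)
qed

lemma fd2_local_cong:
  assumes "open W" "x \<in> W" "\<And>y. y \<in> W \<Longrightarrow> f y = g y"
  shows "fd (\<lambda>y. fd f y v) x w = fd (\<lambda>y. fd g y v) x w"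
  by (rule fd_local_cong[OF assms(1,2)]) (rule fd_local_cong[OF assms(1) _ assms(3)])

context
  fixes X :: "'m topology" and c :: "('m, 'e::real_normed_vector) chart"
  assumes chart: "topological_chart X c"
begin

lemma chart_subset: "fst c \<subseteq> topspace X"
  using chart by (simp add: topological_chart_def openin_subset)

lemma chart_open: "openin X (fst c)" "open (snd c ` fst c)"
  using chart by (auto simp: topological_chart_def)

lemma chart_homeo: "homeomorphic_map (subtopology X (fst c)) (top_of_set (snd c ` fst c)) (snd c)"
  using chart by (simp add: topological_chart_def)

lemma chart_inj: "inj_on (snd c) (fst c)"
  using chart_homeo chart_subset by (simp add: homeomorphic_eq_everything_map Int_absorb1)

lemma cinv_chart [simp]: "m \<in> fst c \<Longrightarrow> cinv c (snd c m) = m"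
  using chart_inj by simp

lemma chart_preimage_open:
  assumes "open S" shows "openin X {m \<in> fst c. snd c m \<in> S}"
proof -
  have "continuous_map (subtopology X (fst c)) euclidean (snd c)"
    using homeomorphic_imp_continuous_map[OF chart_homeo] continuous_map_in_subtopology by blast
  then have "openin (subtopology X (fst c)) {m \<in> topspace (subtopology X (fst c)). snd c m \<in> S}"
    using assms by (intro openin_continuous_map_preimage) auto
  moreover have "{m \<in> topspace (subtopology X (fst c)). snd c m \<in> S} = {m \<in> fst c. snd c m \<in> S}"
    using chart_subset by auto
  ultimately show ?thesis
    using chart_open(1) by (simp only: openin_open_subtopology)
qed

lemma chart_image_open:
  assumes "openin X W" "W \<subseteq> fst c" shows "open (snd c ` W)"
proof -
  have "openin (subtopology X (fst c)) W"
    using assms chart_open(1) by (simp add: openin_open_subtopology)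
  then have "openin (top_of_set (snd c ` fst c)) (snd c ` W)"
    using homeomorphic_imp_open_map[OF chart_homeo] by (simp add: open_map_def)
  then show ?thesis using chart_open(2) openin_open_trans by blast
qed

lemma chart_cinv_continuous: "continuous_map (top_of_set (snd c ` fst c)) (subtopology X (fst c)) (cinv c)"
  unfolding continuous_map_def
proof (intro conjI allI impI)
  show "cinv c \<in> topspace (top_of_set (snd c ` fst c)) \<rightarrow> topspace (subtopology X (fst c))"
    using chart_subset by auto
  fix W assume "openin (subtopology X (fst c)) W"
  then have W: "openin X W" "W \<subseteq> fst c" using chart_open(1) by (auto simp: openin_open_subtopology)
  have "{x \<in> topspace (top_of_set (snd c ` fst c)). cinv c x \<in> W} = snd c ` W"
    using W(2) by force
  moreover have "snd c ` W \<subseteq> snd c ` fst c" using W(2) by blast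
  ultimately show "openin (top_of_set (snd c ` fst c)) {x \<in> topspace (top_of_set (snd c ` fst c)). cinv c x \<in> W}"
    using chart_image_open[OF W] by (simp add: openin_open_eq chart_open(2))
qed

end

lemma smooth_manifoldD:
  assumes "smooth_manifold X A"
  shows "Hausdorff_space X" "\<And>c. c \<in> A \<Longrightarrow> topological_chart X c" "(\<Union>c\<in>A. fst c) = topspace X"
    "\<And>c d. c \<in> A \<Longrightarrow> d \<in> A \<Longrightarrow> smooth_on (snd c ` (fst c \<inter> fst d)) (coord_rep c d (\<lambda>x. x))"
  using assms by (auto simp: smooth_manifold_def)

lemma coord_rep_id: "coord_rep c d (\<lambda>x. x) = (\<lambda>x. snd d (cinv c x))"
  by (simp add: coord_rep_def fun_eq_iff)

lemma smooth_fun_continuous: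
  assumes M: "smooth_manifold X A" and q: "smooth_fun A q"
  shows "continuous_map X euclideanreal q"
  unfolding continuous_map_def
proof (intro conjI allI impI)
  fix T :: "real set" assume "openin euclideanreal T"
  then have "open T" by simp
  show "openin X {m \<in> topspace X. q m \<in> T}"
  proof (subst openin_subopen, clarify)
    fix m assume m: "m \<in> topspace X" "q m \<in> T"
    then obtain c where c: "c \<in> A" "m \<in> fst c" using smooth_manifoldD(3)[OF M] by blast
    note ch = smooth_manifoldD(2)[OF M c(1)]
    have "continuous_on (snd c ` fst c) (\<lambda>x. q (cinv c x))"
      using q c(1) by (auto simp: smooth_fun_def intro: smooth_on_continuous)
    from continuous_open_preimage[OF this chart_open(2)[OF ch] \<open>open T\<close>]
    have "open {x \<in> snd c ` fst c. q (cinv c x) \<in> T}" by (simp add: Int_def vimage_def)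
    from chart_preimage_open[OF ch this]
    have "openin X {m \<in> fst c. snd c m \<in> {x \<in> snd c ` fst c. q (cinv c x) \<in> T}}" .
    moreover have "{m \<in> fst c. snd c m \<in> {x \<in> snd c ` fst c. q (cinv c x) \<in> T}} \<subseteq> {m \<in> topspace X. q m \<in> T}"
      using chart_subset[OF ch] cinv_chart[OF ch] by (auto dest: inj_onD[OF chart_inj[OF ch]])
    ultimately show "\<exists>U. openin X U \<and> m \<in> U \<and> U \<subseteq> {m \<in> topspace X. q m \<in> T}"
      using m c(2) cinv_chart[OF ch] by (intro exI[of _ "{m \<in> fst c. snd c m \<in> {x \<in> snd c ` fst c. q (cinv c x) \<in> T}}"]) auto
  qed
qed simp

text \<open>\<open>Q\<close> behaves like the squared distance from \<open>p\<close>: \<open>H\<close> will be the metric at \<open>p\<close>.\<close>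

definition squared_distance_like ::
  "'m topology \<Rightarrow> ('m, real^'n) chart set \<Rightarrow> ('m, real^'n) chart \<Rightarrow> 'm \<Rightarrow> real^'n^'n \<Rightarrow> ('m \<Rightarrow> real) \<Rightarrow> bool" where
  "squared_distance_like X A c p H Q \<longleftrightarrow> smooth_fun A Q \<and> Q p = 0 \<and>
     (\<forall>m\<in>topspace X. m \<noteq> p \<longrightarrow> Q m > 0) \<and>
     (\<forall>v. fd (\<lambda>x. Q (cinv c x)) (snd c p) v = 0) \<and>
     (\<forall>v w. fd (\<lambda>x. fd (\<lambda>x. Q (cinv c x)) x v) (snd c p) w = 2 * (w \<bullet> (H *v v)))"

section \<open>Construction of the squared-distance-like functions\<close>

lemma positive_form_lower_bound:
  fixes H :: "real^'n^'n"
  assumes "transpose H = H" "\<And>v. v \<noteq> 0 \<Longrightarrow> v \<bullet> (H *v v) > 0"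
  shows "\<exists>l>0. \<forall>v. l * (norm v)\<^sup>2 \<le> v \<bullet> (H *v v)"
proof -
  interpret coord_metric UNIV "\<lambda>_. H" by standard (use assms in auto)
  show ?thesis using mi_lower_bound[of 0] by (simp add: metric_inner_def)
qed

text \<open>In the chart the function is the quadratic form \<open>N\<close>, flattened to the
  constant 1 before the boundary of the chart by \<open>\<theta>\<close>, which is positive for
  positive arguments. The constant extends to the whole manifold.\<close>

lemma bump_exists:
  fixes X :: "'m topology" and A :: "('m, real^'n) chart set" and H :: "real^'n^'n"
  assumes M: "smooth_manifold X A" and c: "c \<in> A" "p \<in> fst c"
    and H: "transpose H = H" "\<And>v. v \<noteq> 0 \<Longrightarrow> v \<bullet> (H *v v) > 0"
  shows "\<exists>q W. smooth_fun A q \<and> q p = 0 \<and> (\<forall>m\<in>topspace X. m \<noteq> p \<longrightarrow> q m > 0) \<and>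
    open W \<and> snd c p \<in> W \<and> W \<subseteq> snd c ` fst c \<and>
    (\<forall>x\<in>W. q (cinv c x) = (x - snd c p) \<bullet> (H *v (x - snd c p)))"
proof -
  note ch = smooth_manifoldD(2)[OF M c(1)]
  define xp where "xp = snd c p"
  define N where "N x = (x - xp) \<bullet> (H *v (x - xp))" for x
  obtain l where l: "l > 0" "\<And>v. l * (norm v)\<^sup>2 \<le> v \<bullet> (H *v v)" using positive_form_lower_bound[OF H] by blast
  have smN: "smooth_on UNIV N"
    unfolding N_def[abs_def]
    by (intro smooth_on_inner smooth_on_matrix_vector_mult smooth_on_diff smooth_on_ident smooth_on_const open_UNIV)
  have Npos: "N x > 0" if "x \<noteq> xp" for x using H(2)[of "x - xp"] that by (simp add: N_def)
  have N0: "N xp = 0" by (simp add: N_def)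
  have "xp \<in> snd c ` fst c" using c(2) by (simp add: xp_def)
  then obtain r where r: "r > 0" "cball xp r \<subseteq> snd c ` fst c"
    using chart_open(2)[OF ch] open_contains_cball by blast
  \<comment> \<open>Outside the ball of radius \<open>r\<close>, \<open>N\<close> is at least
    \<open>l * r\<^sup>2\<close>, which exceeds \<open>2 * a\<close>, where \<open>\<theta>\<close>
    has become 1.\<close>
  define a where "a = l * r\<^sup>2 / 4"
  have "a > 0" using l r by (simp add: a_def)
  define \<sigma> where "\<sigma> s = smooth_step (s / a - 1)" for s
  define \<theta> where "\<theta> s = s * \<sigma> s + (1 - \<sigma> s)" for s
  have sm\<sigma>: "smooth_on UNIV \<sigma>"
    unfolding \<sigma>_def[abs_def]
    by (rule smooth_on_compose[OF open_UNIV open_UNIV _ smooth_on_smooth_step])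
      (use \<open>a > 0\<close> in \<open>auto intro!: smooth_on_diff smooth_on_divide\<close>)
  have sm\<theta>: "smooth_on UNIV \<theta>"
    unfolding \<theta>_def[abs_def] by (intro smooth_on_add smooth_on_mult smooth_on_diff smooth_on_ident smooth_on_const sm\<sigma> open_UNIV)
  have \<theta>_small: "\<theta> s = s" if "s \<le> a" for s
  proof -
    have "\<sigma> s = 1" using that \<open>a > 0\<close> by (simp add: \<sigma>_def smooth_step_left)
    then show ?thesis by (simp add: \<theta>_def)
  qed
  have \<theta>_large: "\<theta> s = 1" if "s \<ge> 2 * a" for s
  proof -
    have "s / a - 1 \<ge> 1" using that \<open>a > 0\<close> by (simp add: field_simps)
    then show ?thesis by (simp add: \<theta>_def \<sigma>_def smooth_step_right)
  qed
  have \<theta>_pos: "\<theta> s > 0" if "s > 0" for s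
  proof (cases "\<sigma> s = 0")
    case False
    then have "\<sigma> s > 0" "\<sigma> s \<le> 1" using smooth_step_bounds[of "s / a - 1"] by (auto simp: \<sigma>_def)
    then show ?thesis using that by (simp add: \<theta>_def add_pos_nonneg)
  qed (simp add: \<theta>_def)
  define q where "q m = (if m \<in> fst c then \<theta> (N (snd c m)) else 1)" for m
  have q_far: "q m = 1" if "m \<notin> cinv c ` cball xp r" for m
  proof (cases "m \<in> fst c")
    case True
    have "snd c m \<notin> cball xp r"
    proof
      assume "snd c m \<in> cball xp r"
      then have "cinv c (snd c m) \<in> cinv c ` cball xp r" by blast
      then show False using that cinv_chart[OF ch True] by simp
    qed
    then have "r < norm (snd c m - xp)" by (simp add: dist_norm norm_minus_commute)
    then have "r\<^sup>2 \<le> (norm (snd c m - xp))\<^sup>2" using r(1) by (intro power_mono) auto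
    then have "l * r\<^sup>2 \<le> l * (norm (snd c m - xp))\<^sup>2" using l(1) by simp
    also have "\<dots> \<le> N (snd c m)" unfolding N_def by (rule l(2))
    finally have "l * r\<^sup>2 \<le> N (snd c m)" .
    moreover have "0 \<le> l * r\<^sup>2" using l(1) by simp
    ultimately have "2 * a \<le> N (snd c m)" unfolding a_def by linarith
    then show ?thesis by (simp add: q_def True \<theta>_large)
  qed (simp add: q_def)
  \<comment> \<open>A compact subset of a Hausdorff space is closed; hence \<open>q = 1\<close> on
    an open set which together with the chart domain covers the manifold.\<close>
  have "compactin (top_of_set (snd c ` fst c)) (cball xp r)"
    using r(2) by (simp add: compactin_subtopology)
  from image_compactin[OF this chart_cinv_continuous[OF ch]]
  have "compactin X (cinv c ` cball xp r)" by (simp add: compactin_subtopology)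
  then have "closedin X (cinv c ` cball xp r)"
    using compactin_imp_closedin smooth_manifoldD(1)[OF M] by blast
  then have opV: "openin X (topspace X - cinv c ` cball xp r)" by (simp add: openin_diff)
  have "smooth_on (snd d ` fst d) (\<lambda>x. q (cinv d x))" if d: "d \<in> A" for d
  proof (rule smooth_on_local)
    note chd = smooth_manifoldD(2)[OF M d]
    fix x assume "x \<in> snd d ` fst d"
    then obtain m where m: "m \<in> fst d" "x = snd d m" by blast
    show "\<exists>T. open T \<and> x \<in> T \<and> smooth_on T (\<lambda>x. q (cinv d x))"
    proof (cases "m \<in> fst c")
      case True
      let ?T = "snd d ` (fst d \<inter> fst c)"
      have T: "open ?T" by (rule chart_image_open[OF chd]) (use chart_open(1)[OF ch] chart_open(1)[OF chd] in auto)
      have "smooth_on ?T (\<lambda>x. \<theta> (N (coord_rep d c (\<lambda>x. x) x)))"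
        by (intro smooth_on_compose[OF T open_UNIV _ sm\<theta>] smooth_on_compose[OF T open_UNIV _ smN]
            smooth_manifoldD(4)[OF M d c(1)]) auto
      then have "smooth_on ?T (\<lambda>x. q (cinv d x))"
        by (rule smooth_on_cong[OF T, rotated]) (auto simp: coord_rep_id q_def cinv_chart[OF chd])
      then show ?thesis using T m True by blast
    next
      case False
      let ?V = "fst d \<inter> (topspace X - cinv c ` cball xp r)"
      have T: "open (snd d ` ?V)"
        by (rule chart_image_open[OF chd]) (use opV chart_open(1)[OF chd] in auto)
      have "cinv c ` cball xp r \<subseteq> fst c" using r(2) by (auto intro: inv_into_into)
      then have "m \<in> ?V" using False m(1) chart_subset[OF chd] by blast
      moreover have "smooth_on (snd d ` ?V) (\<lambda>x. q (cinv d x))"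
        by (rule smooth_on_cong[OF T _ smooth_on_const[of _ 1]]) (auto simp: q_far cinv_chart[OF chd])
      ultimately show ?thesis using T m(2) by blast
    qed
  qed
  then have "smooth_fun A q" by (simp add: smooth_fun_def)
  moreover have "q p = 0" using c(2) \<open>a > 0\<close> by (simp add: q_def N0 \<theta>_small flip: xp_def)
  moreover have "q m > 0" if "m \<noteq> p" for m
  proof (cases "m \<in> fst c")
    case True
    then have "snd c m \<noteq> xp" using that c(2) chart_inj[OF ch] by (auto simp: xp_def inj_on_def)
    then show ?thesis using True by (simp add: q_def \<theta>_pos Npos)
  qed (simp add: q_def)
  moreover have "open {x \<in> snd c ` fst c. N x < a}"
    by (rule open_smaller[OF chart_open(2)[OF ch] continuous_on_subset[OF smooth_on_continuous[OF smN]]]) simp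
  moreover have "xp \<in> {x \<in> snd c ` fst c. N x < a}"
    using \<open>xp \<in> snd c ` fst c\<close> \<open>a > 0\<close> by (simp add: N0)
  moreover have "q (cinv c x) = N x" if "x \<in> {x \<in> snd c ` fst c. N x < a}" for x
    using that by (auto simp: q_def cinv_chart[OF ch] \<theta>_small)
  ultimately show ?thesis
    unfolding N_def xp_def by (intro exI[of _ q] exI[of _ "{x \<in> snd c ` fst c. (x - snd c p) \<bullet> (H *v (x - snd c p)) < a}"]) auto
qed

lemma squared_distance_like_exists:
  fixes X :: "'m topology" and A :: "('m, real^'n) chart set" and H :: "real^'n^'n"
  assumes M: "smooth_manifold X A" and c: "c \<in> A" "p \<in> fst c"
    and H: "transpose H = H" "\<And>v. v \<noteq> 0 \<Longrightarrow> v \<bullet> (H *v v) > 0"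
  shows "\<exists>Q. squared_distance_like X A c p H Q"
proof -
  obtain q W where q: "smooth_fun A q" "q p = 0" "\<forall>m\<in>topspace X. m \<noteq> p \<longrightarrow> q m > 0"
    "open W" "snd c p \<in> W" "\<forall>x\<in>W. q (cinv c x) = (x - snd c p) \<bullet> (H *v (x - snd c p))"
    using bump_exists[OF assms] by blast
  have "fd (\<lambda>x. x) (snd c p) v = v" for v :: "real^'n" by (simp add: frechet_derivative_ident)
  then have J: "fd (\<lambda>x. x) (snd c p) v \<bullet> (H *v fd (\<lambda>x. x) (snd c p) w) = v \<bullet> (H *v w)" for v w
    by simp
  note d = quadratic_form_second_derivative[OF open_UNIV smooth_on_ident UNIV_I refl H(1) J]
  have "fd (\<lambda>x. q (cinv c x)) (snd c p) v = 0" for v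
    using fd_local_cong[OF q(4,5), of "\<lambda>x. q (cinv c x)"] q(6) d(1) by simp
  moreover have "fd (\<lambda>x. fd (\<lambda>x. q (cinv c x)) x v) (snd c p) w = 2 * (w \<bullet> (H *v v))" for v w
    using fd2_local_cong[OF q(4,5), of "\<lambda>x. q (cinv c x)"] q(6) d(2) by simp
  ultimately show ?thesis using q(1-3) unfolding squared_distance_like_def by blast
qed

lemma action_in_charts:
  fixes \<phi> :: "'g \<Rightarrow> 'm \<Rightarrow> 'm" and X :: "'m topology" and Y :: "'g topology"
    and A :: "('m, 'f::real_normed_vector) chart set" and B :: "('g, 'e::real_normed_vector) chart set"
  assumes \<phi>: "smooth_map (prod_topology Y X) (prod_atlas B A) X A (\<lambda>(a, x). \<phi> a x)"
    and b: "b \<in> B" "topological_chart Y b" and c: "c \<in> A" "topological_chart X c"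
    and d: "d \<in> A" "topological_chart X d"
  defines "R \<equiv> {(e, x). e \<in> snd b ` fst b \<and> x \<in> snd c ` fst c \<and> \<phi> (cinv b e) (cinv c x) \<in> fst d}"
  shows "open R" "smooth_on R (\<lambda>(e, x). snd d (\<phi> (cinv b e) (cinv c x)))"
proof -
  let ?f = "\<lambda>(a, x). \<phi> a x"
  let ?bc = "(fst b \<times> fst c, map_prod (snd b) (snd c))"
  have "continuous_map (prod_topology Y X) X ?f" using \<phi> by (simp add: smooth_map_def)
  from openin_continuous_map_preimage[OF this chart_open(1)[OF d(2)]]
  have op: "openin (prod_topology Y X) {z \<in> topspace (prod_topology Y X). ?f z \<in> fst d}" .
  show "open R"
  proof (subst open_subopen, clarify)
    fix e x assume ex: "(e, x) \<in> R"
    then obtain a m where am: "a \<in> fst b" "e = snd b a" "m \<in> fst c" "x = snd c m" "\<phi> a m \<in> fst d"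
      by (auto simp: R_def cinv_chart[OF b(2)] cinv_chart[OF c(2)])
    have "(a, m) \<in> {z \<in> topspace (prod_topology Y X). ?f z \<in> fst d}"
      using am chart_subset[OF b(2)] chart_subset[OF c(2)] by auto
    with op obtain U V where UV: "openin Y U" "openin X V" "a \<in> U" "m \<in> V"
        "U \<times> V \<subseteq> {z \<in> topspace (prod_topology Y X). ?f z \<in> fst d}"
      unfolding openin_prod_topology_alt by meson
    have U: "open (snd b ` (U \<inter> fst b))"
      by (rule chart_image_open[OF b(2)]) (use UV chart_open(1)[OF b(2)] in auto)
    have V: "open (snd c ` (V \<inter> fst c))"
      by (rule chart_image_open[OF c(2)]) (use UV chart_open(1)[OF c(2)] in auto)
    have "snd b ` (U \<inter> fst b) \<times> snd c ` (V \<inter> fst c) \<subseteq> R"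
    proof clarify
      fix a' m' assume h: "a' \<in> U" "a' \<in> fst b" "m' \<in> V" "m' \<in> fst c"
      then have "(a', m') \<in> U \<times> V" by blast
      from subsetD[OF UV(5) this] have "\<phi> a' m' \<in> fst d" by simp
      then show "(snd b a', snd c m') \<in> R"
        using h by (simp add: R_def cinv_chart[OF b(2)] cinv_chart[OF c(2)])
    qed
    moreover have "(e, x) \<in> snd b ` (U \<inter> fst b) \<times> snd c ` (V \<inter> fst c)"
      unfolding am(2,4) using am(1,3) UV(3,4) by simp
    ultimately show "\<exists>T. open T \<and> (e, x) \<in> T \<and> T \<subseteq> R" using open_Times[OF U V] by blast
  qed
  have inj: "inj_on (map_prod (snd b) (snd c)) (fst b \<times> fst c)"
    by (rule map_prod_inj_on[OF chart_inj[OF b(2)] chart_inj[OF c(2)]])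
  have "?bc \<in> prod_atlas B A" using b(1) c(1) by (auto simp: prod_atlas_def)
  then have "smooth_on (snd ?bc ` {z \<in> fst ?bc. ?f z \<in> fst d}) (coord_rep ?bc d ?f)"
    using conjunct2[OF \<phi>[unfolded smooth_map_def]] d(1) by (elim ballE) auto
  moreover have "snd ?bc ` {z \<in> fst ?bc. ?f z \<in> fst d} = R"
  proof (intro equalityI subsetI)
    fix z assume "z \<in> R"
    then obtain a m where am: "a \<in> fst b" "m \<in> fst c" "z = (snd b a, snd c m)" "\<phi> a m \<in> fst d"
      by (auto simp: R_def cinv_chart[OF b(2)] cinv_chart[OF c(2)])
    then show "z \<in> snd ?bc ` {z \<in> fst ?bc. ?f z \<in> fst d}"
      by (intro image_eqI[of _ _ "(a, m)"]) auto
  qed (auto simp: R_def cinv_chart[OF b(2)] cinv_chart[OF c(2)])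
  ultimately have sm: "smooth_on R (coord_rep ?bc d ?f)" by simp
  show "smooth_on R (\<lambda>(e, x). snd d (\<phi> (cinv b e) (cinv c x)))"
  proof (rule smooth_on_cong[OF \<open>open R\<close> _ sm])
    fix z assume "z \<in> R"
    then obtain a m where am: "a \<in> fst b" "m \<in> fst c" "z = (snd b a, snd c m)"
      by (auto simp: R_def)
    have "inv_into (fst b \<times> fst c) (map_prod (snd b) (snd c)) z = (a, m)"
      using am by (intro inv_into_f_eq[OF inj]) auto
    then show "coord_rep ?bc d ?f z = (\<lambda>(e, x). snd d (\<phi> (cinv b e) (cinv c x))) z"
      using am by (simp add: coord_rep_def cinv_chart[OF b(2)] cinv_chart[OF c(2)])
  qed
qed

lemma invariant_squared_distance_like_exists:
  fixes X :: "'m topology" and A :: "('m, real^'n) chart set" and H :: "real^'n^'n"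
    and G :: "('g, 'z) monoid_scheme" and B :: "('g, 'e::real_normed_vector) chart set"
  assumes M: "smooth_manifold X A" and c: "c \<in> A" "p \<in> fst c"
    and g: "riemannian_metric A g"
    and G: "lie_group G Y B" "compact_space Y" and act: "smooth_action G Y B X A \<phi>"
    and fix_p: "\<And>a. a \<in> carrier G \<Longrightarrow> \<phi> a p = p" and inv: "invariant_metric G \<phi> A g"
  shows "\<exists>Q. squared_distance_like X A c p (g c (snd c p)) Q \<and>
    (\<forall>a\<in>carrier G. \<forall>m\<in>topspace X. Q (\<phi> a m) = Q m)"
proof -
  note ch = smooth_manifoldD(2)[OF M]
  have BM: "smooth_manifold Y B" using G(1) by (simp add: lie_group_def)
  note bch = smooth_manifoldD(2)[OF BM]
  define xp where "xp = snd c p"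
  define H where "H = g c xp"
  have "xp \<in> snd c ` fst c" using c(2) by (simp add: xp_def)
  then have H: "transpose H = H" "\<And>v. v \<noteq> 0 \<Longrightarrow> v \<bullet> (H *v v) > 0"
    using g c(1) by (auto simp: riemannian_metric_def H_def)
  have pX: "p \<in> topspace X" using c chart_subset[OF ch] by blast
  interpret compact_group G Y
    using G unfolding compact_group_def compact_group_axioms_def lie_group_def smooth_map_def by auto
  interpret act: group_action G "topspace X" \<phi> using act by (simp add: smooth_action_def)
  have sm: "smooth_map (prod_topology Y X) (prod_atlas B A) X A (\<lambda>(a, x). \<phi> a x)"
    using act by (simp add: smooth_action_def)
  obtain q W where q: "smooth_fun A q" "q p = 0" "\<forall>m\<in>topspace X. m \<noteq> p \<longrightarrow> q m > 0"
    "open W" "xp \<in> W" "\<forall>x\<in>W. q (cinv c x) = (x - xp) \<bullet> (H *v (x - xp))"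
    using bump_exists[OF M c H] unfolding xp_def by blast
  define Q where "Q m = mean (\<lambda>a. q (\<phi> a m))" for m
  have im: "\<phi> a m \<in> topspace X" if "a \<in> carrier G" "m \<in> topspace X" for a m
    using act.element_image[OF that refl] .
  \<comment> \<open>Near a given pair the function is smooth in coordinates of the group and the
    manifold jointly, which is what differentiation under the mean requires.\<close>
  have param: "param_Ck k Y (carrier G \<times> snd d ` fst d) (\<lambda>a x. q (\<phi> a (cinv d x)))" if d: "d \<in> A" for d k
  proof (rule param_Ck_local)
    fix a x assume "(a, x) \<in> carrier G \<times> snd d ` fst d"
    then obtain m where am: "a \<in> carrier G" "m \<in> fst d" "x = snd d m" by blast
    then have "m \<in> topspace X" using chart_subset[OF ch[OF d]] by blast
    obtain b where b: "b \<in> B" "a \<in> fst b" using am(1) smooth_manifoldD(3)[OF BM] topspace_Y by blast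
    obtain e where e: "e \<in> A" "\<phi> a m \<in> fst e"
      using im[OF am(1) \<open>m \<in> topspace X\<close>] smooth_manifoldD(3)[OF M] by blast
    define R where "R = {(e', x). e' \<in> snd b ` fst b \<and> x \<in> snd d ` fst d \<and> \<phi> (cinv b e') (cinv d x) \<in> fst e}"
    note R = action_in_charts[OF sm b(1) bch[OF b(1)] d ch[OF d] e(1) ch[OF e(1)], folded R_def]
    define w where "w = (\<lambda>z. q (cinv e ((\<lambda>(e', x). snd e (\<phi> (cinv b e') (cinv d x))) z)))"
    have "smooth_on R w"
      unfolding w_def
    proof (rule smooth_on_compose[OF R(1) chart_open(2)[OF ch[OF e(1)]] _ _ R(2)])
      show "smooth_on (snd e ` fst e) (\<lambda>x. q (cinv e x))" using q(1) e(1) by (simp add: smooth_fun_def)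
    qed (auto simp: R_def)
    then have "param_Ck k Y {(a, x). a \<in> fst b \<and> (snd b a, x) \<in> R} (\<lambda>a x. w (snd b a, x))"
      by (intro param_Ck_compose_chart[OF R(1)] chart_preimage_open[OF bch[OF b(1)]] smooth_onD)
    moreover have "box_open Y {(a, x). a \<in> fst b \<and> (snd b a, x) \<in> R}"
      unfolding box_open_def
    proof clarify
      fix a x assume ax: "a \<in> fst b" "(snd b a, x) \<in> R"
      obtain S V where SV: "open S" "open V" "(snd b a, x) \<in> S \<times> V" "S \<times> V \<subseteq> R"
        using open_prod_elim[OF R(1) ax(2)] by metis
      show "\<exists>A V. openin Y A \<and> open V \<and> a \<in> A \<and> x \<in> V \<and> A \<times> V \<subseteq> {(a, x). a \<in> fst b \<and> (snd b a, x) \<in> R}"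
        using chart_preimage_open[OF bch[OF b(1)] SV(1)] SV ax(1)
        by (intro exI[of _ "{a \<in> fst b. snd b a \<in> S}"] exI[of _ V]) auto
    qed
    ultimately have "param_Ck k Y {(a, x). a \<in> fst b \<and> (snd b a, x) \<in> R} (\<lambda>a x. q (\<phi> a (cinv d x)))"
      by (rule param_Ck_cong[rotated 2])
        (auto simp: w_def R_def cinv_chart[OF bch[OF b(1)]] cinv_chart[OF ch[OF e(1)]]
          dest: inj_onD[OF chart_inj[OF bch[OF b(1)]]])
    moreover have "(a, x) \<in> {(a, x). a \<in> fst b \<and> (snd b a, x) \<in> R}"
      using am b e by (auto simp: R_def cinv_chart[OF bch[OF b(1)]] cinv_chart[OF ch[OF d]])
    ultimately show "\<exists>\<Omega>'. (a, x) \<in> \<Omega>' \<and> param_Ck k Y \<Omega>' (\<lambda>a x. q (\<phi> a (cinv d x)))"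
      by (intro exI conjI)
  qed
  have smQ: "smooth_fun A Q"
    unfolding smooth_fun_def smooth_on_def Q_def
    by (intro ballI allI mean_Ck_on[OF chart_open(2)[OF ch]] param)
  have cq: "cont (\<lambda>a. q (\<phi> a m))" if m: "m \<in> topspace X" for m
  proof -
    obtain d where d: "d \<in> A" "m \<in> fst d" using m smooth_manifoldD(3)[OF M] by blast
    have "cont (\<lambda>a. q (\<phi> a (cinv d (snd d m))))"
      using param[OF d(1), of 0] d(2) by (intro param_cont_cont) auto
    then show ?thesis using cinv_chart[OF ch[OF d(1)] d(2)] by simp
  qed
  have inv_Q: "Q (\<phi> b m) = Q m" if "b \<in> carrier G" "m \<in> topspace X" for b m
  proof -
    \<comment> \<open>Composition of the action turns the argument \<open>\<phi> b m\<close> into a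
      right translation of the group variable, under which the mean is invariant.\<close>
    have "Q (\<phi> b m) = mean (\<lambda>a. q (\<phi> (a \<otimes>\<^bsub>G\<^esub> b) m))"
      unfolding Q_def using that by (intro mean_cong) (simp add: act.composition_rule)
    also have "\<dots> = Q m" unfolding Q_def by (rule mean_translate[OF cq[OF that(2)] that(1)])
    finally show ?thesis .
  qed
  have "Q p = mean (\<lambda>_. 0)" unfolding Q_def by (intro mean_cong) (simp add: fix_p q(2))
  then have Qp: "Q p = 0" by (simp add: mean_const)
  have Qpos: "Q m > 0" if m: "m \<in> topspace X" "m \<noteq> p" for m
  proof -
    have pos: "q (\<phi> a m) > 0" if a: "a \<in> carrier G" for a
    proof -
      have "\<phi> a m \<noteq> p"
        using inj_onD[OF act.inj_prop[OF a], of m p] fix_p[OF a] m pX by auto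
      then show ?thesis using q(3) im[OF a m(1)] by blast
    qed
    \<comment> \<open>The mean preserves only nonstrict bounds; compactness provides a positive
      minimum \<open>k\<close> over the group.\<close>
    have "compact ((\<lambda>a. q (\<phi> a m)) ` carrier G)"
      using image_compactin[of Y "topspace Y" euclideanreal, OF _ cq[OF m(1)]] compact_Y
      by (simp add: compact_space_def topspace_Y)
    then obtain k where k: "k \<in> (\<lambda>a. q (\<phi> a m)) ` carrier G" "\<forall>t\<in>(\<lambda>a. q (\<phi> a m)) ` carrier G. k \<le> t"
      using compact_attains_inf by (metis one_closed image_is_empty empty_iff)
    then have "k \<le> Q m" unfolding Q_def by (intro mean_ge[OF cq[OF m(1)]]) auto
    moreover have "k > 0" using k(1) pos by auto
    ultimately show ?thesis by linarith
  qed
  let ?U = "snd c ` fst c"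
  have oU: "open ?U" by (rule chart_open(2)[OF ch[OF c(1)]])
  let ?u = "\<lambda>a x. q (\<phi> a (cinv c x))"
  \<comment> \<open>First and second derivatives at \<open>p\<close> are the same for all
    translates, so that their means are means of constants.\<close>
  have derivs: "fd (?u a) xp v = 0 \<and> fd (\<lambda>x. fd (?u a) x v) xp w = 2 * (w \<bullet> (H *v v))"
    if a: "a \<in> carrier G" for a v w
  proof -
    obtain b where b: "b \<in> B" "a \<in> fst b" using a smooth_manifoldD(3)[OF BM] topspace_Y by blast
    define R where "R = {(e', x). e' \<in> snd b ` fst b \<and> x \<in> snd c ` fst c \<and> \<phi> (cinv b e') (cinv c x) \<in> fst c}"
    note R = action_in_charts[OF sm b(1) bch[OF b(1)] c(1) ch[OF c(1)] c(1) ch[OF c(1)], folded R_def]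
    define \<psi> where "\<psi> = coord_rep c c (\<phi> a)"
    have \<psi>: "\<psi> x = snd c (\<phi> a (cinv c x))" for x by (simp add: \<psi>_def coord_rep_def)
    define U1 where "U1 = {x. (snd b a, x) \<in> R}"
    have U1: "open U1"
      unfolding U1_def using open_vimage[OF R(1), of "\<lambda>x. (snd b a, x)"] by (simp add: vimage_def continuous_intros)
    have "smooth_on U1 (\<lambda>x. (\<lambda>(e', x). snd c (\<phi> (cinv b e') (cinv c x))) (snd b a, x))"
      unfolding smooth_on_def U1_def by (intro allI Ck_on_slice[OF R(1)] smooth_onD[OF R(2)])
    then have sm\<psi>: "smooth_on U1 \<psi>"
      using b(2) by (simp add: \<psi>[abs_def] cinv_chart[OF bch[OF b(1)]])
    have xpU1: "xp \<in> U1"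
      using c(2) b(2) fix_p[OF a] by (auto simp: U1_def R_def xp_def cinv_chart[OF bch[OF b(1)]] cinv_chart[OF ch[OF c(1)]])
    have \<psi>p: "\<psi> xp = xp" using c(2) fix_p[OF a] by (simp add: \<psi> xp_def cinv_chart[OF ch[OF c(1)]])
    have J: "fd \<psi> xp v \<bullet> (H *v fd \<psi> xp w) = v \<bullet> (H *v w)" for v w
    proof -
      let ?J = "jacobian \<psi> (at xp)"
      have Jz: "?J *v z = fd \<psi> xp z" for z
        using linear_fd[OF smooth_on_differentiable[OF sm\<psi> xpU1]] by (simp add: jacobian_def matrix_works)
      have "H = transpose ?J ** H ** ?J"
        using inv a c fix_p[OF a] unfolding invariant_metric_def preserves_tensor_def
        by (metis H_def \<psi>_def xp_def)
      then have "v \<bullet> (H *v w) = v \<bullet> (transpose ?J *v (H *v (?J *v w)))"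
        by (metis matrix_vector_mul_assoc)
      also have "\<dots> = (?J *v v) \<bullet> (H *v (?J *v w))"
        using dot_lmul_matrix[of v "transpose ?J"] vector_transpose_matrix[of v ?J] by simp
      finally show ?thesis by (simp add: Jz)
    qed
    note d = quadratic_form_second_derivative[OF U1 sm\<psi> xpU1 \<psi>p H(1) J]
    let ?T = "U1 \<inter> \<psi> -` W"
    have T: "open ?T" by (rule continuous_open_preimage[OF smooth_on_continuous[OF sm\<psi>] U1 q(4)])
    have xpT: "xp \<in> ?T" using xpU1 \<psi>p q(5) by simp
    have eq: "?u a x = (\<psi> x - xp) \<bullet> (H *v (\<psi> x - xp))" if x: "x \<in> ?T" for x
    proof -
      have "\<phi> a (cinv c x) \<in> fst c" using x b(2) by (auto simp: U1_def R_def cinv_chart[OF bch[OF b(1)]])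
      then have "?u a x = q (cinv c (\<psi> x))" by (simp add: \<psi> cinv_chart[OF ch[OF c(1)]])
      then show ?thesis using x q(6) by simp
    qed
    show ?thesis
      using fd_local_cong[OF T xpT eq] fd2_local_cong[OF T xpT eq] d by simp
  qed
  have dQ: "fd (\<lambda>x. Q (cinv c x)) x v = mean (\<lambda>a. fd (?u a) x v)" if "x \<in> ?U" for x v
    unfolding Q_def by (rule fd_eq[OF mean_has_derivative[OF oU param[OF c(1)] that]])
  have "fd (\<lambda>x. Q (cinv c x)) xp v = mean (\<lambda>_. 0)" for v
    unfolding dQ[OF \<open>xp \<in> ?U\<close>] by (rule mean_cong) (use derivs in blast)
  moreover have "fd (\<lambda>x. fd (\<lambda>x. Q (cinv c x)) x v) xp w = 2 * (w \<bullet> (H *v v))" for v w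
  proof -
    have "param_Ck 1 Y (carrier G \<times> ?U) (\<lambda>a x. fd (?u a) x v)"
      using param[OF c(1), of 2] by (simp add: numeral_2_eq_2)
    from fd_eq[OF mean_has_derivative[OF oU this \<open>xp \<in> ?U\<close>], of w]
    have "fd (\<lambda>x. mean (\<lambda>a. fd (?u a) x v)) xp w = mean (\<lambda>a. fd (\<lambda>x. fd (?u a) x v) xp w)" .
    also have "\<dots> = mean (\<lambda>_. 2 * (w \<bullet> (H *v v)))"
      by (rule mean_cong) (use derivs in blast)
    finally show ?thesis
      using fd_local_cong[OF oU \<open>xp \<in> ?U\<close> dQ] by (simp add: mean_const)
  qed
  ultimately show ?thesis
    using smQ Qp Qpos inv_Q unfolding squared_distance_like_def H_def xp_def by (auto simp: mean_const)
qed

section \<open>Conformal deformation of a Riemannian manifold\<close>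

lemma coord_metric_subset: "coord_metric U h \<Longrightarrow> open W \<Longrightarrow> W \<subseteq> U \<Longrightarrow> coord_metric W h"
  unfolding coord_metric_def by (meson smooth_on_subset subsetD)

lemma riemannian_coord_metric:
  assumes "smooth_manifold X A" "riemannian_metric A g" "c \<in> A"
  shows "coord_metric (snd c ` fst c) (g c)"
  using assms chart_open(2)[OF smooth_manifoldD(2)[OF assms(1,3)]]
  unfolding coord_metric_def riemannian_metric_def by blast

lemma chart_transition:
  assumes M: "smooth_manifold X A" and g: "riemannian_metric A g" and c: "c \<in> A" and d: "d \<in> A"
  shows "metric_transition (snd c ` (fst c \<inter> fst d)) (snd d ` fst d) (g c) (g d) (coord_rep c d (\<lambda>x. x))"
proof -
  note ch = smooth_manifoldD(2)[OF M]
  let ?U = "snd c ` (fst c \<inter> fst d)"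
  have U: "open ?U"
    by (rule chart_image_open[OF ch[OF c]]) (use chart_open(1)[OF ch[OF c]] chart_open(1)[OF ch[OF d]] in auto)
  interpret C: coord_metric ?U "g c"
    by (rule coord_metric_subset[OF riemannian_coord_metric[OF M g c] U]) auto
  interpret D: coord_metric "snd d ` fst d" "g d" by (rule riemannian_coord_metric[OF M g d])
  show ?thesis
  proof
    show sm: "smooth_on ?U (coord_rep c d (\<lambda>x. x))" by (rule smooth_manifoldD(4)[OF M c d])
    fix x assume x: "x \<in> ?U"
    then obtain m where m: "m \<in> fst c" "m \<in> fst d" "x = snd c m" by blast
    have \<tau>: "coord_rep c d (\<lambda>x. x) x = snd d m"
      using m cinv_chart[OF ch[OF c]] by (simp add: coord_rep_id)
    then show "coord_rep c d (\<lambda>x. x) x \<in> snd d ` fst d" using m(2) by simp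
    fix v w
    let ?J = "jacobian (coord_rep c d (\<lambda>x. x)) (at x)"
    have J: "?J *v z = fd (coord_rep c d (\<lambda>x. x)) x z" for z
      using linear_fd[OF smooth_on_differentiable[OF sm x]] by (simp add: jacobian_def matrix_works)
    have "preserves_tensor A g (\<lambda>x. x)" using g by (simp add: riemannian_metric_def)
    then have "g c x = transpose ?J ** g d (snd d m) ** ?J"
      using c d m unfolding preserves_tensor_def by (metis)
    then have "v \<bullet> (g c x *v w) = v \<bullet> (transpose ?J *v (g d (snd d m) *v (?J *v w)))"
      by (metis matrix_vector_mul_assoc)
    also have "\<dots> = (?J *v v) \<bullet> (g d (snd d m) *v (?J *v w))"
      using dot_lmul_matrix[of v "transpose ?J"] vector_transpose_matrix[of v ?J] by simp
    finally show "metric_inner (g c) x v w = metric_inner (g d) (coord_rep c d (\<lambda>x. x) x)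
        (fd (coord_rep c d (\<lambda>x. x)) x v) (fd (coord_rep c d (\<lambda>x. x)) x w)"
      by (simp add: metric_inner_def \<tau> J)
  qed
qed

text \<open>\<open>sec_at_ge\<close> speaks of all charts around \<open>m\<close>. One suffices,
  since sectional curvature is natural and the derivative of a transition maps independent pairs to
  independent pairs.\<close>

lemma sec_at_geI:
  fixes A :: "('m, real^'n) chart set"
  assumes M: "smooth_manifold X A" and g: "riemannian_metric A g" and c: "c \<in> A" "m \<in> fst c"
    and k: "\<And>v w. v \<noteq> w \<Longrightarrow> independent {v, w} \<Longrightarrow> k \<le> sectional_curvature (g c) (snd c m) v w"
  shows "sec_at_ge A g m k"
  unfolding sec_at_ge_def
proof (intro ballI impI allI, elim conjE)
  fix d and v w :: "real^'n" assume d: "d \<in> A" "m \<in> fst d" and vw: "v \<noteq> w" "independent {v, w}"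
  interpret T: metric_transition "snd d ` (fst d \<inter> fst c)" "snd c ` fst c" "g d" "g c" "coord_rep d c (\<lambda>x. x)"
    by (rule chart_transition[OF M g d(1) c(1)])
  have x: "snd d m \<in> snd d ` (fst d \<inter> fst c)" using c d by blast
  have \<tau>: "coord_rep d c (\<lambda>x. x) (snd d m) = snd c m"
    using d cinv_chart[OF smooth_manifoldD(2)[OF M d(1)]] by (simp add: coord_rep_id)
  let ?J = "\<lambda>v. fd (coord_rep d c (\<lambda>x. x)) (snd d m) v"
  have lin: "linear ?J" using T.linear_J[OF x] by simp
  have inj: "inj ?J" unfolding linear_injective_0[OF lin] using T.inj_J[OF x] by blast
  have "independent (?J ` {v, w})"
    by (rule linear_independent_injective_image[OF lin vw(2)]) (use inj in \<open>auto intro: inj_on_subset\<close>)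
  then have "independent {?J v, ?J w}" by simp
  moreover have "?J v \<noteq> ?J w" using inj vw(1) by (auto dest: injD)
  ultimately show "k \<le> sectional_curvature (g d) (snd d m) v w"
    unfolding T.sectional_curvature_pull[OF x] \<tau> by (intro k)
qed

text \<open>The pointwise form admits bounds that vary with the point, as the factor
  \<open>exp (- 2 * F (Q m))\<close> does.\<close>

definition ricci_at_ge :: "('m, real^'n) chart set \<Rightarrow> ('m, 'n) tensor2 \<Rightarrow> 'm \<Rightarrow> real \<Rightarrow> bool" where
  "ricci_at_ge A g m k \<longleftrightarrow> (\<forall>c\<in>A. m \<in> fst c \<longrightarrow>
     (\<forall>v. k * metric_inner (g c) (snd c m) v v \<le> ricci (g c) (snd c m) v v))"

lemma ricci_ge_iff: "ricci_ge A g k \<longleftrightarrow> (\<forall>m. ricci_at_ge A g m k)"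
  unfolding ricci_ge_def ricci_at_ge_def by blast

lemma ricci_at_geI:
  fixes A :: "('m, real^'n) chart set"
  assumes M: "smooth_manifold X A" and g: "riemannian_metric A g" and c: "c \<in> A" "m \<in> fst c"
    and k: "\<And>v. k * metric_inner (g c) (snd c m) v v \<le> ricci (g c) (snd c m) v v"
  shows "ricci_at_ge A g m k"
  unfolding ricci_at_ge_def
proof (intro ballI impI allI)
  fix d and v :: "real^'n" assume d: "d \<in> A" "m \<in> fst d"
  interpret T: metric_transition "snd d ` (fst d \<inter> fst c)" "snd c ` fst c" "g d" "g c" "coord_rep d c (\<lambda>x. x)"
    by (rule chart_transition[OF M g d(1) c(1)])
  have x: "snd d m \<in> snd d ` (fst d \<inter> fst c)" using c d by blast
  have \<tau>: "coord_rep d c (\<lambda>x. x) (snd d m) = snd c m"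
    using d cinv_chart[OF smooth_manifoldD(2)[OF M d(1)]] by (simp add: coord_rep_id)
  show "k * metric_inner (g d) (snd d m) v v \<le> ricci (g d) (snd d m) v v"
    unfolding T.ricci_pull[OF x] T.pull[OF x] \<tau> by (rule k)
qed

lemma curvature_local_cong:
  assumes W: "open W" "x \<in> W" and eq: "\<And>y. y \<in> W \<Longrightarrow> h y = h' y"
  shows "curvature h x u v w = curvature h' x u v w"
proof -
  have ch: "christoffel h k i j y = christoffel h' k i j y" if "y \<in> W" for k i j y
  proof -
    have "partial_deriv i (\<lambda>y. h y $ j $ l) y = partial_deriv i (\<lambda>y. h' y $ j $ l) y" for i j l
      unfolding partial_deriv_def by (rule fd_local_cong[OF W(1) that]) (simp add: eq)
    then show ?thesis unfolding christoffel_def by (simp add: eq[OF that])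
  qed
  have "partial_deriv i (christoffel h k j l) x = partial_deriv i (christoffel h' k j l) x" for i k j l
    unfolding partial_deriv_def by (rule fd_local_cong[OF W]) (rule ch)
  then show ?thesis
    unfolding curvature_def curvature_coeff_def by (simp add: ch[OF W(2)])
qed

lemma sectional_curvature_local_cong:
  assumes "open W" "x \<in> W" "\<And>y. y \<in> W \<Longrightarrow> h y = h' y"
  shows "sectional_curvature h x v w = sectional_curvature h' x v w"
proof -
  have "curvature h x u v w = curvature h' x u v w" for u v w
    by (rule curvature_local_cong[OF assms(1,2)]) (rule assms(3))
  then show ?thesis by (simp add: sectional_curvature_def metric_inner_def assms(3)[OF assms(2)])
qed

lemma ricci_local_cong:
  assumes "open W" "x \<in> W" "\<And>y. y \<in> W \<Longrightarrow> h y = h' y"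
  shows "ricci h x v w = ricci h' x v w"
proof -
  have "curvature h x u v w = curvature h' x u v w" for u v w
    by (rule curvature_local_cong[OF assms(1,2)]) (rule assms(3))
  then show ?thesis by (simp add: ricci_def)
qed

definition conf_metric :: "('m \<Rightarrow> real) \<Rightarrow> ('m, 'n) tensor2 \<Rightarrow> ('m, 'n::finite) tensor2" where
  "conf_metric f g = (\<lambda>c x. exp (2 * f (cinv c x)) *\<^sub>R g c x)"

lemma scaleR_matrix_conj:
  fixes J :: "real^'n^'m" and S :: "real^'m^'m"
  shows "transpose J ** (r *\<^sub>R S) ** J = r *\<^sub>R (transpose J ** S ** J)"
  by (simp add: matrix_matrix_mult_def vec_eq_iff sum_distrib_left mult_ac)

lemma preserves_conf_metric:
  assumes M: "smooth_manifold X A" and "preserves_tensor A g \<psi>"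
    and inv: "\<And>m. m \<in> topspace X \<Longrightarrow> f (\<psi> m) = f m"
  shows "preserves_tensor A (conf_metric f g) \<psi>"
  unfolding preserves_tensor_def
proof (intro ballI impI)
  fix c d m assume h: "c \<in> A" "d \<in> A" "m \<in> fst c" "\<psi> m \<in> fst d"
  note ch = smooth_manifoldD(2)[OF M]
  let ?J = "jacobian (coord_rep c d \<psi>) (at (snd c m))"
  have "g c (snd c m) = transpose ?J ** g d (snd d (\<psi> m)) ** ?J"
    using assms(2) h unfolding preserves_tensor_def by metis
  moreover have "m \<in> topspace X" using h chart_subset[OF ch[OF h(1)]] by blast
  ultimately show "let J = ?J in conf_metric f g c (snd c m)
      = transpose J ** conf_metric f g d (snd d (\<psi> m)) ** J"
    using inv h by (simp add: conf_metric_def cinv_chart[OF ch[OF h(1)]] cinv_chart[OF ch[OF h(2)]] scaleR_matrix_conj)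
qed

lemma riemannian_conf_metric:
  fixes A :: "('m, real^'n) chart set"
  assumes M: "smooth_manifold X A" and g: "riemannian_metric A g" and f: "smooth_fun A f"
  shows "riemannian_metric A (conf_metric f g)"
  unfolding riemannian_metric_def
proof (intro conjI ballI allI impI)
  fix c assume c: "c \<in> A"
  note o = chart_open(2)[OF smooth_manifoldD(2)[OF M c]]
  interpret conformal_metric "snd c ` fst c" "g c" "\<lambda>x. f (cinv c x)"
    using riemannian_coord_metric[OF M g c] f c
    by (simp add: conformal_metric_def conformal_metric_axioms_def smooth_fun_def)
  have e: "conf_metric f g c = ht" by (simp add: conf_metric_def ht_def fun_eq_iff)
  interpret T: coord_metric "snd c ` fst c" ht by (rule coord_metric_ht)
  show "smooth_on (snd c ` fst c) (conf_metric f g c)" unfolding e by (rule T.smooth_h)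
  show "transpose (conf_metric f g c x) = conf_metric f g c x" if "x \<in> snd c ` fst c" for x
    unfolding e by (rule T.transpose_h[OF that])
  show "0 < v \<bullet> (conf_metric f g c x *v v)" if "x \<in> snd c ` fst c" "v \<noteq> 0" for x v
    unfolding e by (rule T.pos[OF that])
next
  show "preserves_tensor A (conf_metric f g) (\<lambda>p. p)"
    using g by (intro preserves_conf_metric[OF M]) (auto simp: riemannian_metric_def)
qed

lemma metric_inner_conf_metric:
  "metric_inner (conf_metric f g c) x v w = exp (2 * f (cinv c x)) * metric_inner (g c) x v w"
  by (simp add: metric_inner_def conf_metric_def scaleR_matrix_vector_assoc[symmetric])

text \<open>\<open>curvature_deformation\<close> supplies \<open>W\<close>, and by compactness
  \<open>Q\<close> exceeds some \<open>s > 0\<close> outside the corresponding set \<open>N\<close>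
  in the manifold. A profile vanishing beyond \<open>s\<close> leaves the metric unchanged outside
  \<open>N\<close>, and on \<open>N\<close> a single chart suffices.\<close>

lemma conf_metric_deformation:
  fixes X :: "'m topology" and A :: "('m, real^'n) chart set"
  assumes n: "CARD('n) \<ge> 2" and M: "smooth_manifold X A" and cpt: "compact_space X"
    and g: "riemannian_metric A g" and c: "c \<in> A" "p \<in> fst c"
    and Q: "squared_distance_like X A c p (g c (snd c p)) Q" and epos: "\<eta> > 0" "\<kappa> > 0"
  shows "\<exists>F. smooth_fun A (\<lambda>m. F (Q m)) \<and> (\<forall>m\<in>topspace X. 0 \<le> F (Q m) \<and> F (Q m) \<le> \<eta>) \<and>
    (\<forall>m\<in>topspace X. \<forall>k. ricci_at_ge A g m k \<longrightarrow>
       ricci_at_ge A (conf_metric (\<lambda>m. F (Q m)) g) m (exp (- 2 * F (Q m)) * (k - \<eta>))) \<and>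
    (\<forall>m\<in>topspace X. \<forall>k. sec_at_ge A g m k \<longrightarrow>
       sec_at_ge A (conf_metric (\<lambda>m. F (Q m)) g) m (exp (- 2 * F (Q m)) * (k - \<eta>))) \<and>
    (\<forall>k. sec_at_ge A g p k \<longrightarrow>
       sec_at_ge A (conf_metric (\<lambda>m. F (Q m)) g) p (exp (- 2 * F (Q p)) * (k + \<kappa>)))"
proof -
  note ch = smooth_manifoldD(2)[OF M]
  let ?U = "snd c ` fst c"
  define xp where "xp = snd c p"
  define q where "q x = Q (cinv c x)" for x
  have smQ: "smooth_fun A Q" and Qp: "Q p = 0" and Qpos: "\<And>m. m \<in> topspace X \<Longrightarrow> m \<noteq> p \<Longrightarrow> Q m > 0"
    and dQ: "\<And>v. fd q xp v = 0" and ddQ: "\<And>v w. fd (\<lambda>x. fd q x v) xp w = 2 * (w \<bullet> (g c xp *v v))"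
    using Q unfolding squared_distance_like_def xp_def q_def[abs_def] by blast+
  have Q0: "Q m \<ge> 0" if "m \<in> topspace X" for m
    using Qpos[OF that] Qp by (cases "m = p") (auto intro: less_imp_le)
  interpret coord_metric ?U "g c" by (rule riemannian_coord_metric[OF M g c(1)])
  have xpU: "xp \<in> ?U" using c(2) by (simp add: xp_def)
  have qU: "q x \<ge> 0" if "x \<in> ?U" for x
    using that Q0 chart_subset[OF ch[OF c(1)]] cinv_chart[OF ch[OF c(1)]] by (auto simp: q_def)
  have qp: "q xp = 0" using c(2) Qp cinv_chart[OF ch[OF c(1)]] by (simp add: q_def xp_def)
  have smq: "smooth_on ?U q" using smQ c(1) by (simp add: smooth_fun_def q_def[abs_def])
  have ddq: "fd (\<lambda>x. fd q x v) xp u = 2 * mi xp u v" for u v using ddQ by (simp add: metric_inner_def)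
  obtain W where W: "open W" "xp \<in> W" "W \<subseteq> ?U"
    and est: "\<forall>\<eta>>0. \<forall>\<kappa>>0. \<forall>s>0. \<exists>F. good_profile q W xp \<eta> \<kappa> s F"
    by (rule curvature_deformation[OF n xpU smq qU dQ qp ddq])
  define N where "N = {m \<in> fst c. snd c m \<in> W}"
  have opN: "openin X N" unfolding N_def by (rule chart_preimage_open[OF ch[OF c(1)] W(1)])
  have pN: "p \<in> N" using c(2) W(2) by (simp add: N_def xp_def)
  have cQ: "continuous_map X euclideanreal Q" by (rule smooth_fun_continuous[OF M smQ])
  obtain s where s: "s > 0" "\<And>m. m \<in> topspace X \<Longrightarrow> m \<notin> N \<Longrightarrow> s < Q m"
  proof (cases "topspace X - N = {}")
    case True
    then show ?thesis using that[of 1] by auto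
  next
    case False
    have "closedin X (topspace X - N)" using opN by blast
    then have "compactin X (topspace X - N)" using cpt closedin_compact_space by blast
    from image_compactin[OF this cQ] have "compact (Q ` (topspace X - N))" by simp
    moreover have "Q ` (topspace X - N) \<noteq> {}" using False by simp
    ultimately obtain m0 where m0: "m0 \<in> topspace X - N" "\<And>m. m \<in> topspace X - N \<Longrightarrow> Q m0 \<le> Q m"
      using compact_attains_inf[of "Q ` (topspace X - N)"] by blast
    then have "Q m0 > 0" using Qpos pN by auto
    show ?thesis
    proof (rule that[of "Q m0 / 2"])
      fix m assume "m \<in> topspace X" "m \<notin> N"
      then have "Q m0 \<le> Q m" using m0(2) by simp
      then show "Q m0 / 2 < Q m" using \<open>Q m0 > 0\<close> by linarith
    qed (use \<open>Q m0 > 0\<close> in simp)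
  qed
  obtain F where F: "smooth_on UNIV F" "\<forall>t\<ge>0. 0 \<le> F t \<and> F t \<le> \<eta>" "\<forall>t\<ge>s. F t = 0"
    and ric: "\<forall>x\<in>W. \<forall>k. (\<forall>v. k * mi x v v \<le> ricci (g c) x v v) \<longrightarrow>
          (\<forall>v. (k - \<eta>) * mi x v v \<le> ricci (\<lambda>x. exp (2 * F (q x)) *\<^sub>R g c x) x v v)"
    and sec: "\<forall>x\<in>W. \<forall>k v w. v \<noteq> w \<and> independent {v, w} \<and> k \<le> sectional_curvature (g c) x v w \<longrightarrow>
          exp (- 2 * F (q x)) * (k - \<eta>) \<le> sectional_curvature (\<lambda>x. exp (2 * F (q x)) *\<^sub>R g c x) x v w"
    and secp: "\<forall>k v w. v \<noteq> w \<and> independent {v, w} \<and> k \<le> sectional_curvature (g c) xp v w \<longrightarrow>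
          exp (- 2 * F (q xp)) * (k + \<kappa>) \<le> sectional_curvature (\<lambda>x. exp (2 * F (q x)) *\<^sub>R g c x) xp v w"
    using est[rule_format, OF epos s(1)] unfolding good_profile_def by (elim exE conjE)
  define f where "f m = F (Q m)" for m
  have smf: "smooth_fun A f"
    unfolding smooth_fun_def f_def
  proof
    fix d assume d: "d \<in> A"
    show "smooth_on (snd d ` fst d) (\<lambda>x. F (Q (cinv d x)))"
      using smQ d by (intro smooth_on_compose[OF chart_open(2)[OF ch[OF d]] open_UNIV _ F(1)])
        (auto simp: smooth_fun_def)
  qed
  have g': "riemannian_metric A (conf_metric f g)" by (rule riemannian_conf_metric[OF M g smf])
  have gc: "conf_metric f g c = (\<lambda>x. exp (2 * F (q x)) *\<^sub>R g c x)"
    by (simp add: conf_metric_def f_def q_def fun_eq_iff)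
  have far: "\<exists>V. open V \<and> snd d m \<in> V \<and> (\<forall>y\<in>V. conf_metric f g d y = g d y)" "F (Q m) = 0"
    if m: "m \<in> topspace X" "m \<notin> N" and d: "d \<in> A" "m \<in> fst d" for m d
  proof -
    have "openin X {m \<in> topspace X. Q m \<in> {s<..}}"
      by (rule openin_continuous_map_preimage[OF cQ]) auto
    then have "openin X (fst d \<inter> {m \<in> topspace X. Q m \<in> {s<..}})"
      using chart_open(1)[OF ch[OF d(1)]] by (rule openin_Int[rotated])
    then have V: "open (snd d ` (fst d \<inter> {m \<in> topspace X. Q m \<in> {s<..}}))" (is "open ?V")
      by (rule chart_image_open[OF ch[OF d(1)]]) auto
    have "snd d m \<in> ?V" using d m s(2)[OF m] by auto
    moreover have "conf_metric f g d y = g d y" if "y \<in> ?V" for y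
      using that F(3) cinv_chart[OF ch[OF d(1)]] by (auto simp: conf_metric_def f_def)
    ultimately show "\<exists>V. open V \<and> snd d m \<in> V \<and> (\<forall>y\<in>V. conf_metric f g d y = g d y)" using V by blast
    show "F (Q m) = 0" using F(3) s(2)[OF m] by simp
  qed
  have near: "snd c m \<in> W" "q (snd c m) = Q m" "m \<in> fst c" if "m \<in> N" for m
    using that cinv_chart[OF ch[OF c(1)]] by (auto simp: N_def q_def)
  have R1: "ricci_at_ge A (conf_metric f g) m (exp (- 2 * F (Q m)) * (k - \<eta>))"
    if m: "m \<in> topspace X" and k: "ricci_at_ge A g m k" for m k
  proof (cases "m \<in> N")
    case True
    note nr = near[OF True]
    show ?thesis
    proof (rule ricci_at_geI[OF M g' c(1) nr(3)])
      fix v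
      have "\<forall>v. k * mi (snd c m) v v \<le> ricci (g c) (snd c m) v v"
        using k c(1) nr(3) by (simp add: ricci_at_ge_def)
      then have "(k - \<eta>) * mi (snd c m) v v \<le> ricci (conf_metric f g c) (snd c m) v v"
        using ric nr(1) unfolding gc by blast
      moreover have "metric_inner (conf_metric f g c) (snd c m) v v = exp (2 * F (Q m)) * mi (snd c m) v v"
        using nr(2) by (simp add: metric_inner_conf_metric f_def q_def)
      \<comment> \<open>The factor \<open>exp (- 2 * F (Q m))\<close> in the bound exactly
        compensates the factor of the new metric.\<close>
      moreover have "exp (- 2 * F (Q m)) * (k - \<eta>) * (exp (2 * F (Q m)) * r) = (k - \<eta>) * r" for r
      proof -
        have "exp (- 2 * F (Q m)) * (k - \<eta>) * (exp (2 * F (Q m)) * r)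
            = (exp (- 2 * F (Q m)) * exp (2 * F (Q m))) * ((k - \<eta>) * r)" by (simp only: mult_ac)
        then show ?thesis by (simp add: mult_exp_exp)
      qed
      ultimately show "exp (- 2 * F (Q m)) * (k - \<eta>) * metric_inner (conf_metric f g c) (snd c m) v v
          \<le> ricci (conf_metric f g c) (snd c m) v v"
        by presburger
    qed
  next
    case False
    obtain d where d: "d \<in> A" "m \<in> fst d" using m smooth_manifoldD(3)[OF M] by blast
    obtain V where V: "open V" "snd d m \<in> V" "\<And>y. y \<in> V \<Longrightarrow> conf_metric f g d y = g d y"
      using far(1)[OF m False d] by blast
    show ?thesis
    proof (rule ricci_at_geI[OF M g' d])
      fix v
      interpret D: coord_metric "snd d ` fst d" "g d" by (rule riemannian_coord_metric[OF M g d(1)])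
      have "k * D.mi (snd d m) v v \<le> ricci (g d) (snd d m) v v"
        using k d by (simp add: ricci_at_ge_def)
      moreover have "0 \<le> \<eta> * D.mi (snd d m) v v" using epos(1) D.mi_nonneg d(2) by simp
      moreover have "ricci (conf_metric f g d) (snd d m) v v = ricci (g d) (snd d m) v v"
        by (rule ricci_local_cong[OF V])
      moreover have "metric_inner (conf_metric f g d) (snd d m) v v = D.mi (snd d m) v v"
        using V(3)[OF V(2)] by (simp add: metric_inner_def)
      ultimately show "exp (- 2 * F (Q m)) * (k - \<eta>) * metric_inner (conf_metric f g d) (snd d m) v v
          \<le> ricci (conf_metric f g d) (snd d m) v v"
        using far(2)[OF m False d] by (simp add: algebra_simps)
    qed
  qed
  have S1: "sec_at_ge A (conf_metric f g) m (exp (- 2 * F (Q m)) * (k - \<eta>))"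
    if m: "m \<in> topspace X" and k: "sec_at_ge A g m k" for m k
  proof (cases "m \<in> N")
    case True
    note nr = near[OF True]
    show ?thesis
    proof (rule sec_at_geI[OF M g' c(1) nr(3)])
      fix v w :: "real^'n" assume vw: "v \<noteq> w" "independent {v, w}"
      then have "k \<le> sectional_curvature (g c) (snd c m) v w"
        using k c(1) nr(3) by (simp add: sec_at_ge_def)
      then show "exp (- 2 * F (Q m)) * (k - \<eta>) \<le> sectional_curvature (conf_metric f g c) (snd c m) v w"
        using sec nr(1) vw unfolding gc nr(2)[symmetric] by blast
    qed
  next
    case False
    obtain d where d: "d \<in> A" "m \<in> fst d" using m smooth_manifoldD(3)[OF M] by blast
    obtain V where V: "open V" "snd d m \<in> V" "\<And>y. y \<in> V \<Longrightarrow> conf_metric f g d y = g d y"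
      using far(1)[OF m False d] by blast
    show ?thesis
    proof (rule sec_at_geI[OF M g' d])
      fix v w :: "real^'n" assume vw: "v \<noteq> w" "independent {v, w}"
      then have "k \<le> sectional_curvature (g d) (snd d m) v w"
        using k d by (simp add: sec_at_ge_def)
      then show "exp (- 2 * F (Q m)) * (k - \<eta>) \<le> sectional_curvature (conf_metric f g d) (snd d m) v w"
        using far(2)[OF m False d] epos(1) by (simp add: sectional_curvature_local_cong[OF V])
    qed
  qed
  have P1: "sec_at_ge A (conf_metric f g) p (exp (- 2 * F (Q p)) * (k + \<kappa>))"
    if k: "sec_at_ge A g p k" for k
  proof (rule sec_at_geI[OF M g' c])
    fix v w :: "real^'n" assume vw: "v \<noteq> w" "independent {v, w}"
    then have "k \<le> sectional_curvature (g c) xp v w"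
      using k c by (simp add: sec_at_ge_def xp_def)
    then have "exp (- 2 * F (q xp)) * (k + \<kappa>) \<le> sectional_curvature (\<lambda>x. exp (2 * F (q x)) *\<^sub>R g c x) xp v w"
      using secp vw by blast
    then show "exp (- 2 * F (Q p)) * (k + \<kappa>) \<le> sectional_curvature (conf_metric f g c) (snd c p) v w"
      by (simp only: gc qp Qp flip: xp_def)
  qed
  have "\<forall>m\<in>topspace X. 0 \<le> F (Q m) \<and> F (Q m) \<le> \<eta>" using F(2) Q0 by blast
  moreover have "smooth_fun A (\<lambda>m. F (Q m))" "conf_metric f g = conf_metric (\<lambda>m. F (Q m)) g"
    using smf by (simp_all only: f_def[abs_def])
  ultimately show ?thesis
    using R1 S1 P1 by (intro exI[of _ F] conjI) auto
qed

section \<open>The diameter under a conformal change\<close>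

lemma nn_integral_cmult_le:
  fixes f :: "'a \<Rightarrow> ennreal"
  assumes "c > 0"
  shows "(\<integral>\<^sup>+ x. ennreal c * f x \<partial>M) \<le> ennreal c * (\<integral>\<^sup>+ x. f x \<partial>M)"
  unfolding nn_integral_def[of M "\<lambda>x. ennreal c * f x"]
proof (rule SUP_least, clarify)
  fix s assume s: "simple_function M s" "s \<le> (\<lambda>x. ennreal c * f x)"
  have cc: "ennreal (1 / c) * (ennreal c * z) = z" "ennreal c * (ennreal (1 / c) * z) = z" for z
    using assms by (simp_all add: mult.assoc[symmetric] ennreal_mult'[symmetric])
  \<comment> \<open>The simple functions below the integrand are rescaled directly, which avoids
    measurability of \<open>f\<close>; none is established for \<open>speed\<close>.\<close>
  define t where "t x = ennreal (1 / c) * s x" for x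
  have "simple_function M t"
    unfolding t_def[abs_def] using s(1) by (intro simple_function_mult simple_function_const)
  moreover have "t x \<le> f x" for x
  proof -
    have "t x \<le> ennreal (1 / c) * (ennreal c * f x)"
      unfolding t_def using s(2) by (intro mult_left_mono) (auto simp: le_fun_def)
    then show ?thesis by (simp add: cc)
  qed
  ultimately have "integral\<^sup>S M t \<le> (\<integral>\<^sup>+ x. f x \<partial>M)"
    unfolding nn_integral_def by (intro SUP_upper) (auto simp: le_fun_def)
  then have "ennreal c * integral\<^sup>S M t \<le> ennreal c * (\<integral>\<^sup>+ x. f x \<partial>M)" by (intro mult_left_mono) auto
  moreover have "integral\<^sup>S M s = ennreal c * integral\<^sup>S M t"
    using simple_integral_mult[OF \<open>simple_function M t\<close>, of "ennreal c"] by (simp add: t_def cc)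
  ultimately show "integral\<^sup>S M s \<le> ennreal c * (\<integral>\<^sup>+ x. f x \<partial>M)" by simp
qed

text \<open>The metric is multiplied by at most 4, hence speeds by at most 2; lengths, distances and
  the diameter follow.\<close>

lemma riemannian_diam_conf_metric_le:
  fixes A :: "('m, real^'n) chart set"
  assumes M: "smooth_manifold X A" and g: "riemannian_metric A g"
    and f: "\<And>m. m \<in> topspace X \<Longrightarrow> f m \<le> ln 2"
  shows "riemannian_diam X A (conf_metric f g) \<le> 2 * riemannian_diam X A g"
proof -
  have speed: "speed A (conf_metric f g) \<gamma> t \<le> 2 * speed A g \<gamma> t" if m: "\<gamma> t \<in> topspace X" for \<gamma> :: "real \<Rightarrow> 'm" and t
  proof -
    define c where "c = (SOME c. c \<in> A \<and> \<gamma> t \<in> fst c)"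
    have "\<exists>c. c \<in> A \<and> \<gamma> t \<in> fst c" using m smooth_manifoldD(3)[OF M] by blast
    then have c: "c \<in> A" "\<gamma> t \<in> fst c" unfolding c_def by (metis (mono_tags, lifting) someI_ex)+
    define v where "v = vector_derivative (snd c \<circ> \<gamma>) (at t)"
    interpret coord_metric "snd c ` fst c" "g c" by (rule riemannian_coord_metric[OF M g c(1)])
    have "mi (snd c (\<gamma> t)) v v \<ge> 0" using c(2) by (intro mi_nonneg) blast
    have "exp (2 * f (\<gamma> t)) \<le> exp (2 * ln 2)" using f[OF m] by simp
    also have "\<dots> = 4" by (simp add: exp_double)
    finally have "exp (2 * f (\<gamma> t)) * mi (snd c (\<gamma> t)) v v \<le> 4 * mi (snd c (\<gamma> t)) v v"
      using \<open>mi (snd c (\<gamma> t)) v v \<ge> 0\<close> by (rule mult_right_mono)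
    then have "sqrt (exp (2 * f (\<gamma> t)) * mi (snd c (\<gamma> t)) v v) \<le> sqrt (4 * mi (snd c (\<gamma> t)) v v)"
      by (rule real_sqrt_le_mono)
    also have "\<dots> = 2 * sqrt (mi (snd c (\<gamma> t)) v v)" by (simp add: real_sqrt_mult)
    finally show ?thesis
      using cinv_chart[OF smooth_manifoldD(2)[OF M c(1)] c(2)]
      by (simp add: speed_def Let_def metric_inner_conf_metric flip: c_def v_def)
  qed
  have len: "curve_length A (conf_metric f g) \<gamma> \<le> 2 * curve_length A g \<gamma>" if \<gamma>: "piecewise_C1_curve X A \<gamma>" for \<gamma>
  proof -
    have cont: "continuous_map (top_of_set {0..1}) X \<gamma>" using \<gamma> by (simp add: piecewise_C1_curve_def)
    have mX: "\<gamma> t \<in> topspace X" if "t \<in> {0..1}" for t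
      using continuous_map_image_subset_topspace[OF cont] that by auto
    have "curve_length A (conf_metric f g) \<gamma>
        \<le> (\<integral>\<^sup>+ t. ennreal 2 * (ennreal (speed A g \<gamma> t) * indicator {0..1} t) \<partial>lborel)"
      unfolding curve_length_def
    proof (rule nn_integral_mono)
      fix t
      show "ennreal (speed A (conf_metric f g) \<gamma> t) * indicator {0..1} t
          \<le> ennreal 2 * (ennreal (speed A g \<gamma> t) * indicator {0..1} t)"
      proof (cases "t \<in> {0..1}")
        case True
        have "ennreal (speed A (conf_metric f g) \<gamma> t) \<le> ennreal (2 * speed A g \<gamma> t)"
          by (intro ennreal_leI speed mX True)
        then show ?thesis using True by (simp add: ennreal_mult')
      qed simp
    qed
    also have "\<dots> \<le> ennreal 2 * curve_length A g \<gamma>"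
      unfolding curve_length_def by (rule nn_integral_cmult_le) simp
    finally show ?thesis by simp
  qed
  \<comment> \<open>Halving moves the factor 2 to the left-hand side, so that the infimum on the
    right can be treated curve by curve, infinite values included.\<close>
  define h where "h = ennreal (1 / 2)"
  have "h * ennreal 2 = ennreal 1" unfolding h_def by (subst ennreal_mult[symmetric]) auto
  then have h2: "h * 2 = 1" by simp
  have half: "h * (2 * z) = z" "2 * (h * z) = z" for z :: ennreal
  proof -
    have "h * (2 * z) = (h * 2) * z" "2 * (h * z) = (h * 2) * z" by (simp_all only: ac_simps)
    then show "h * (2 * z) = z" "2 * (h * z) = z" by (simp_all only: h2 mult_1)
  qed
  have dist: "riemannian_dist X A (conf_metric f g) p q \<le> 2 * riemannian_dist X A g p q" for p q
  proof -
    have "h * riemannian_dist X A (conf_metric f g) p q \<le> riemannian_dist X A g p q"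
      unfolding riemannian_dist_def[of X A g]
    proof (rule INF_greatest)
      fix \<gamma> assume "\<gamma> \<in> {\<gamma>. piecewise_C1_curve X A \<gamma> \<and> \<gamma> 0 = p \<and> \<gamma> 1 = q}"
      then have "riemannian_dist X A (conf_metric f g) p q \<le> curve_length A (conf_metric f g) \<gamma>"
        "curve_length A (conf_metric f g) \<gamma> \<le> 2 * curve_length A g \<gamma>"
        unfolding riemannian_dist_def by (auto intro!: INF_lower len)
      then have "h * riemannian_dist X A (conf_metric f g) p q \<le> h * (2 * curve_length A g \<gamma>)"
        by (intro mult_left_mono) auto
      then show "h * riemannian_dist X A (conf_metric f g) p q \<le> curve_length A g \<gamma>"
        by (simp only: half)
    qed
    then have "2 * (h * riemannian_dist X A (conf_metric f g) p q) \<le> 2 * riemannian_dist X A g p q"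
      by (rule mult_left_mono) simp
    then show ?thesis by (simp only: half)
  qed
  show ?thesis
    unfolding riemannian_diam_def[of X A "conf_metric f g"]
  proof (intro SUP_least)
    fix p q assume pq: "p \<in> topspace X" "q \<in> topspace X"
    have "riemannian_dist X A g p q \<le> riemannian_diam X A g"
      unfolding riemannian_diam_def using pq by (intro SUP_upper2[of p] SUP_upper2[of q]) auto
    then show "riemannian_dist X A (conf_metric f g) p q \<le> 2 * riemannian_diam X A g"
      using dist[of p q] by (meson mult_left_mono order_trans zero_le)
  qed
qed

section \<open>Deformation of a single metric and of families\<close>

definition deformation_of ::
  "'m topology \<Rightarrow> ('m, real^'n) chart set \<Rightarrow> 'm \<Rightarrow> real \<Rightarrow> real \<Rightarrow> ('m, 'n) tensor2 \<Rightarrow> ('m, 'n) tensor2 \<Rightarrow> bool" where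
  "deformation_of X A p K \<epsilon> g g' \<longleftrightarrow> riemannian_metric A g' \<and>
     riemannian_diam X A g' \<le> 2 * riemannian_diam X A g \<and>
     (\<forall>m\<in>topspace X. \<forall>k\<le>0. sec_at_ge A g m k \<longrightarrow> sec_at_ge A g' m (k - \<epsilon>)) \<and>
     (ricci_ge A g (real CARD('n) - 1) \<longrightarrow> ricci_ge A g' (real CARD('n) - 1 - \<epsilon>)) \<and>
     sec_at_gt A g' p K"

lemma not_independent_pair_if_dim_1:
  fixes v w :: "real^'n"
  assumes "\<not> CARD('n) \<ge> 2" "v \<noteq> w" shows "\<not> independent {v, w}"
proof
  assume "independent {v, w}"
  then have "card {v, w} \<le> CARD('n)" using independent_bound by fastforce
  then show False using assms by simp
qed

lemma sec_at_ge_mono: "sec_at_ge A g m k \<Longrightarrow> k' \<le> k \<Longrightarrow> sec_at_ge A g m k'"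
  unfolding sec_at_ge_def by (meson order_trans)

lemma deformation_exists:
  fixes X :: "'m topology" and A :: "('m, real^'n) chart set"
  assumes M: "smooth_manifold X A" and cpt: "compact_space X" and g: "riemannian_metric A g"
    and c: "c \<in> A" "p \<in> fst c" and Q: "squared_distance_like X A c p (g c (snd c p)) Q"
    and K: "K > 0" and \<epsilon>: "\<epsilon> > 0"
  shows "\<exists>g'. deformation_of X A p K \<epsilon> g g' \<and>
    (\<forall>\<psi>. preserves_tensor A g \<psi> \<and> (\<forall>m\<in>topspace X. Q (\<psi> m) = Q m) \<longrightarrow> preserves_tensor A g' \<psi>)"
proof (cases "CARD('n) \<ge> 2")
  \<comment> \<open>In dimension 1 there are no planes, so the sectional conditions are vacuous and
    \<open>g\<close> itself serves.\<close>
  case False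
  have "ricci_ge A g (real CARD('n) - 1 - \<epsilon>)" if r: "ricci_ge A g (real CARD('n) - 1)"
    unfolding ricci_ge_def
  proof (intro ballI allI)
    fix d x and v :: "real^'n" assume d: "d \<in> A" "x \<in> snd d ` fst d"
    interpret coord_metric "snd d ` fst d" "g d" by (rule riemannian_coord_metric[OF M g d(1)])
    have "(real CARD('n) - 1 - \<epsilon>) * mi x v v \<le> (real CARD('n) - 1) * mi x v v"
      using \<epsilon> mi_nonneg[OF d(2)] by (intro mult_right_mono) auto
    also have "\<dots> \<le> ricci (g d) x v v" using r d unfolding ricci_ge_def by blast
    finally show "(real CARD('n) - 1 - \<epsilon>) * mi x v v \<le> ricci (g d) x v v" .
  qed
  moreover have "riemannian_diam X A g \<le> 2 * riemannian_diam X A g"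
    using mult_right_mono[of 1 2 "riemannian_diam X A g"] by simp
  moreover have "sec_at_ge A g m (k - \<epsilon>)" "sec_at_gt A g p K" for m k
    using not_independent_pair_if_dim_1[OF False] by (auto simp: sec_at_ge_def sec_at_gt_def)
  ultimately show ?thesis using g unfolding deformation_of_def by blast
next
  case True
  interpret coord_metric "snd c ` fst c" "g c" by (rule riemannian_coord_metric[OF M g c(1)])
  obtain C where "\<And>v w. v \<noteq> w \<and> independent {v, w} \<longrightarrow> C \<le> sectional_curvature (g c) (snd c p) v w"
    using sectional_curvature_bounded_below[of "snd c p"] c(2) by blast
  then have Cp: "sec_at_ge A g p C" by (intro sec_at_geI[OF M g c]) blast
  define n where "n = real CARD('n)"
  have "n \<ge> 2" using True by (simp add: n_def)
  \<comment> \<open>\<open>ln 2\<close> is for the diameter and for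
    \<open>exp (- 2 * F (Q m)) \<ge> 1 / 4\<close>, \<open>1 / 2\<close> makes
    \<open>n - 1 - \<eta>\<close> nonnegative, and \<open>\<epsilon> / (2 * n)\<close> is for the
    Ricci bound, because \<open>(1 - 2 * \<eta>) * (n - 1 - \<eta>) \<ge> n - 1 - 2 * n *
    \<eta>\<close>.\<close>
  define \<eta> where "\<eta> = min (ln 2) (min (1 / 2) (\<epsilon> / (2 * n)))"
  have \<eta>: "\<eta> > 0" "\<eta> \<le> ln 2" "\<eta> \<le> 1 / 2" "2 * n * \<eta> \<le> \<epsilon>"
  proof -
    show "\<eta> > 0" "\<eta> \<le> ln 2" "\<eta> \<le> 1 / 2" using \<epsilon> \<open>n \<ge> 2\<close> by (auto simp: \<eta>_def)
    have "2 * n * \<eta> \<le> 2 * n * (\<epsilon> / (2 * n))" using \<open>n \<ge> 2\<close> by (intro mult_left_mono) (auto simp: \<eta>_def)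
    then show "2 * n * \<eta> \<le> \<epsilon>" using \<open>n \<ge> 2\<close> by simp
  qed
  have "\<eta> \<le> \<epsilon>"
  proof -
    have "1 * \<eta> \<le> 2 * n * \<eta>" using \<open>n \<ge> 2\<close> \<eta>(1) by (intro mult_right_mono) auto
    then show ?thesis using \<eta>(4) by simp
  qed
  \<comment> \<open>The summand \<open>\<bar>C\<bar>\<close> makes up for the curvature already
    present at \<open>p\<close>, the factor 4 for the rescaling by at least \<open>1 / 4\<close>,
    and \<open>K + 1\<close> yields the strict inequality.\<close>
  define \<kappa> where "\<kappa> = 4 * (K + 1) + \<bar>C\<bar>"
  have "\<kappa> > 0" using K by (simp add: \<kappa>_def add_pos_nonneg)
  obtain F where smF: "smooth_fun A (\<lambda>m. F (Q m))"
    and F: "\<And>m. m \<in> topspace X \<Longrightarrow> 0 \<le> F (Q m)" "\<And>m. m \<in> topspace X \<Longrightarrow> F (Q m) \<le> \<eta>"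
    and ric: "\<And>m k. m \<in> topspace X \<Longrightarrow> ricci_at_ge A g m k \<Longrightarrow>
       ricci_at_ge A (conf_metric (\<lambda>m. F (Q m)) g) m (exp (- 2 * F (Q m)) * (k - \<eta>))"
    and sec: "\<And>m k. m \<in> topspace X \<Longrightarrow> sec_at_ge A g m k \<Longrightarrow>
       sec_at_ge A (conf_metric (\<lambda>m. F (Q m)) g) m (exp (- 2 * F (Q m)) * (k - \<eta>))"
    and secp: "\<And>k. sec_at_ge A g p k \<Longrightarrow>
       sec_at_ge A (conf_metric (\<lambda>m. F (Q m)) g) p (exp (- 2 * F (Q p)) * (k + \<kappa>))"
    using conf_metric_deformation[OF True M cpt g c Q \<eta>(1) \<open>\<kappa> > 0\<close>] by blast
  define g' where "g' = conf_metric (\<lambda>m. F (Q m)) g"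
  have g': "riemannian_metric A g'" unfolding g'_def by (rule riemannian_conf_metric[OF M g smF])
  have diam: "riemannian_diam X A g' \<le> 2 * riemannian_diam X A g"
    unfolding g'_def by (rule riemannian_diam_conf_metric_le[OF M g]) (use F(2) \<eta>(2) in force)
  have e: "1 - 2 * \<eta> \<le> exp (- 2 * F (Q m))" "exp (- 2 * F (Q m)) \<le> 1" "1 / 4 \<le> exp (- 2 * F (Q m))"
    if "m \<in> topspace X" for m
  proof -
    show "1 - 2 * \<eta> \<le> exp (- 2 * F (Q m))"
      using exp_ge_add_one_self[of "- 2 * F (Q m)"] F(2)[OF that] by linarith
    show "exp (- 2 * F (Q m)) \<le> 1" using F(1)[OF that] by simp
    have "exp (- (2 * ln 2)) \<le> exp (- 2 * F (Q m))" using F(2)[OF that] \<eta>(2) by simp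
    then show "1 / 4 \<le> exp (- 2 * F (Q m))" by (simp add: exp_minus exp_double)
  qed
  have pX: "p \<in> topspace X" using c chart_subset[OF smooth_manifoldD(2)[OF M c(1)]] by blast
  have "sec_at_ge A g' m (k - \<epsilon>)" if "m \<in> topspace X" "k \<le> 0" "sec_at_ge A g m k" for m k
  proof -
    \<comment> \<open>For \<open>k \<le> 0\<close> the number \<open>k - \<eta>\<close> is negative,
      so a factor of at most 1 does not lower it.\<close>
    have "1 * (k - \<eta>) \<le> exp (- 2 * F (Q m)) * (k - \<eta>)"
      using e(2)[OF that(1)] that(2) \<eta>(1) by (intro mult_right_mono_neg) auto
    then have "k - \<epsilon> \<le> exp (- 2 * F (Q m)) * (k - \<eta>)" using \<open>\<eta> \<le> \<epsilon>\<close> by simp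
    then show ?thesis unfolding g'_def by (rule sec_at_ge_mono[OF sec[OF that(1,3)]])
  qed
  moreover have "ricci_ge A g' (real CARD('n) - 1 - \<epsilon>)" if r: "ricci_ge A g (real CARD('n) - 1)"
    unfolding ricci_ge_def
  proof (intro ballI allI)
    fix d x and v :: "real^'n" assume d: "d \<in> A" "x \<in> snd d ` fst d"
    then obtain m where m: "m \<in> fst d" "x = snd d m" by blast
    have mX: "m \<in> topspace X" using d m chart_subset[OF smooth_manifoldD(2)[OF M d(1)]] by blast
    interpret T: coord_metric "snd d ` fst d" "g' d" by (rule riemannian_coord_metric[OF M g' d(1)])
    have "n - 1 - \<eta> \<ge> 0" using \<open>n \<ge> 2\<close> \<eta>(3) by simp
    have "n - 1 - \<epsilon> \<le> n - 1 - 2 * n * \<eta>" using \<eta>(4) by simp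
    also have "\<dots> \<le> (1 - 2 * \<eta>) * (n - 1 - \<eta>)" using \<eta>(1) by (simp add: algebra_simps)
    also have "\<dots> \<le> exp (- 2 * F (Q m)) * (n - 1 - \<eta>)"
      using e(1)[OF mX] \<open>n - 1 - \<eta> \<ge> 0\<close> by (rule mult_right_mono)
    finally have "(n - 1 - \<epsilon>) * T.mi x v v \<le> exp (- 2 * F (Q m)) * (n - 1 - \<eta>) * T.mi x v v"
      using T.mi_nonneg[OF d(2)] by (rule mult_right_mono)
    also have "ricci_at_ge A g m (n - 1)" using r by (simp add: ricci_ge_iff n_def)
    then have "ricci_at_ge A g' m (exp (- 2 * F (Q m)) * (n - 1 - \<eta>))"
      unfolding g'_def by (rule ric[OF mX])
    then have "exp (- 2 * F (Q m)) * (n - 1 - \<eta>) * T.mi x v v \<le> ricci (g' d) x v v"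
      using d(1) m by (simp add: ricci_at_ge_def)
    finally show "(real CARD('n) - 1 - \<epsilon>) * T.mi x v v \<le> ricci (g' d) x v v" by (simp add: n_def)
  qed
  moreover have "sec_at_gt A g' p K"
  proof -
    have "K < 1 / 4 * (4 * (K + 1))" by simp
    also have "\<dots> \<le> exp (- 2 * F (Q p)) * (C + \<kappa>)"
      using e(3)[OF pX] K by (intro mult_mono) (auto simp: \<kappa>_def)
    finally show ?thesis
      using secp[OF Cp] unfolding g'_def[symmetric] sec_at_gt_def sec_at_ge_def by (meson less_le_trans)
  qed
  moreover have "preserves_tensor A g' \<psi>" if "preserves_tensor A g \<psi>" "\<forall>m\<in>topspace X. Q (\<psi> m) = Q m" for \<psi>
    unfolding g'_def using that by (intro preserves_conf_metric[OF M]) auto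
  ultimately show ?thesis using g' diam unfolding deformation_of_def by blast
qed

text \<open>The deformed families are built from \<open>g (2 * \<alpha>)\<close>: its curvature bound leaves room for the
  loss of \<open>1 / (2 * \<alpha>)\<close> caused by the deformation.\<close>

lemma deformed_families:
  fixes A :: "('m, real^'n) chart set"
  assumes def: "\<And>g K \<epsilon>. riemannian_metric A g \<Longrightarrow> I g \<Longrightarrow> K > 0 \<Longrightarrow> \<epsilon> > 0 \<Longrightarrow>
      \<exists>g'. deformation_of X A p K \<epsilon> g g' \<and> I g'"
  shows "(\<forall>K>0. \<forall>\<epsilon>>0. \<forall>g.
        riemannian_metric A g \<and> ricci_ge A g (real CARD('n) - 1) \<and> I g \<longrightarrow>
        (\<exists>g'. riemannian_metric A g' \<and> I g' \<and>
           ricci_ge A g' (real CARD('n) - 1 - \<epsilon>) \<and> sec_at_ge A g' p K))"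
    and "(\<forall>K>0. \<forall>g.
        almost_nonneg_curved X A g \<and> (\<forall>\<alpha>\<ge>1. I (g \<alpha>)) \<longrightarrow>
        (\<exists>g'. almost_nonneg_curved X A g' \<and> (\<forall>\<alpha>\<ge>1. I (g' \<alpha>) \<and> sec_at_gt A (g' \<alpha>) p K)))"
    and "(\<forall>K>0. \<forall>\<epsilon>>0. \<forall>g.
        almost_nonneg_curved X A g \<and> (\<forall>\<alpha>\<ge>1. ricci_ge A (g \<alpha>) (real CARD('n) - 1)) \<and>
        (\<forall>\<alpha>\<ge>1. I (g \<alpha>)) \<longrightarrow>
        (\<exists>g'. almost_nonneg_curved X A g' \<and>
           (\<forall>\<alpha>\<ge>1. I (g' \<alpha>) \<and> ricci_ge A (g' \<alpha>) (real CARD('n) - 1 - \<epsilon>) \<and> sec_at_gt A (g' \<alpha>) p K)))"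
proof -
  have gt_ge: "sec_at_ge A g p K" if "sec_at_gt A g p K" for g :: "('m, 'n) tensor2" and K
    using that unfolding sec_at_gt_def sec_at_ge_def by (meson less_imp_le)
  show "(\<forall>K>0. \<forall>\<epsilon>>0. \<forall>g.
        riemannian_metric A g \<and> ricci_ge A g (real CARD('n) - 1) \<and> I g \<longrightarrow>
        (\<exists>g'. riemannian_metric A g' \<and> I g' \<and>
           ricci_ge A g' (real CARD('n) - 1 - \<epsilon>) \<and> sec_at_ge A g' p K))"
    using def gt_ge unfolding deformation_of_def by meson
  \<comment> \<open>One construction serves families with and without a Ricci bound: that bound is
    carried along as an implication.\<close>
  have family: "\<exists>g'. almost_nonneg_curved X A g' \<and> (\<forall>\<alpha>\<ge>1. I (g' \<alpha>) \<and> sec_at_gt A (g' \<alpha>) p K \<and>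
      ((\<forall>\<alpha>\<ge>1. ricci_ge A (g \<alpha>) (real CARD('n) - 1)) \<longrightarrow> ricci_ge A (g' \<alpha>) (real CARD('n) - 1 - \<epsilon>)))"
    if K: "K > 0" and \<epsilon>: "\<epsilon> > 0" and g: "almost_nonneg_curved X A g" and I: "\<forall>\<alpha>\<ge>1. I (g \<alpha>)" for K \<epsilon> g
  proof -
    obtain D where D: "D > 0" "\<And>\<alpha>. \<alpha> \<ge> 1 \<Longrightarrow> riemannian_diam X A (g \<alpha>) \<le> ennreal D"
      "\<And>\<alpha> m. \<alpha> \<ge> 1 \<Longrightarrow> m \<in> topspace X \<Longrightarrow> sec_at_ge A (g \<alpha>) m (- 1 / real \<alpha>)"
      and rm: "\<And>\<alpha>. \<alpha> \<ge> 1 \<Longrightarrow> riemannian_metric A (g \<alpha>)"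
      using g unfolding almost_nonneg_curved_def by blast
    \<comment> \<open>The minimum meets both requirements: \<open>\<epsilon>\<close> for the Ricci
      bound and \<open>1 / (2 * real \<alpha>)\<close> for the sectional one.\<close>
    define e where "e \<alpha> = min \<epsilon> (1 / (2 * real \<alpha>))" for \<alpha> :: nat
    have "\<exists>g'. deformation_of X A p K (e \<alpha>) (g (2 * \<alpha>)) g' \<and> I g'" if "\<alpha> \<ge> 1" for \<alpha>
      using that I K \<epsilon> by (intro def rm) (auto simp: e_def)
    then obtain g' where g': "\<And>\<alpha>. \<alpha> \<ge> 1 \<Longrightarrow> deformation_of X A p K (e \<alpha>) (g (2 * \<alpha>)) (g' \<alpha>) \<and> I (g' \<alpha>)"
      by metis
    have "almost_nonneg_curved X A g'"
      unfolding almost_nonneg_curved_def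
    proof (intro conjI exI[of _ "2 * D"] allI impI ballI)
      fix \<alpha> :: nat assume \<alpha>: "1 \<le> \<alpha>"
      note d = g'[OF \<alpha>, THEN conjunct1, unfolded deformation_of_def]
      show "riemannian_metric A (g' \<alpha>)" using d by blast
      have "riemannian_diam X A (g' \<alpha>) \<le> 2 * riemannian_diam X A (g (2 * \<alpha>))" using d by blast
      also have "\<dots> \<le> 2 * ennreal D" using D(2)[of "2 * \<alpha>"] \<alpha> by (intro mult_left_mono) auto
      also have "\<dots> = ennreal (2 * D)" using D(1) by (simp add: ennreal_mult')
      finally show "riemannian_diam X A (g' \<alpha>) \<le> ennreal (2 * D)" .
      fix m assume m: "m \<in> topspace X"
      have "sec_at_ge A (g (2 * \<alpha>)) m (- 1 / real (2 * \<alpha>))" using D(3)[of "2 * \<alpha>"] \<alpha> m by simp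
      moreover have "- 1 / real (2 * \<alpha>) \<le> 0" by simp
      ultimately have "sec_at_ge A (g' \<alpha>) m (- 1 / real (2 * \<alpha>) - e \<alpha>)" using d m by blast
      moreover have "- 1 / real \<alpha> \<le> - 1 / real (2 * \<alpha>) - e \<alpha>"
      proof -
        have "e \<alpha> \<le> 1 / (2 * real \<alpha>)" by (simp add: e_def)
        moreover have "- 1 / real \<alpha> = - 1 / real (2 * \<alpha>) - 1 / (2 * real \<alpha>)" using \<alpha> by (simp add: field_simps)
        ultimately show ?thesis by linarith
      qed
      ultimately show "sec_at_ge A (g' \<alpha>) m (- 1 / real \<alpha>)" by (rule sec_at_ge_mono)
    qed (use D(1) in simp)
    moreover have "ricci_ge A (g' \<alpha>) (real CARD('n) - 1 - \<epsilon>)"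
      if \<alpha>: "\<alpha> \<ge> 1" and r: "\<forall>\<alpha>\<ge>1. ricci_ge A (g \<alpha>) (real CARD('n) - 1)" for \<alpha>
      unfolding ricci_ge_def
    proof (intro ballI allI)
      fix d x and v :: "real^'n" assume d: "d \<in> A" "x \<in> snd d ` fst d"
      note df = g'[OF \<alpha>, THEN conjunct1, unfolded deformation_of_def]
      have "ricci_ge A (g' \<alpha>) (real CARD('n) - 1 - e \<alpha>)" using df r \<alpha> by simp
      then have "(real CARD('n) - 1 - e \<alpha>) * metric_inner (g' \<alpha> d) x v v \<le> ricci (g' \<alpha> d) x v v"
        using d unfolding ricci_ge_def by blast
      moreover have "0 \<le> metric_inner (g' \<alpha> d) x v v"
      proof (cases "v = 0")
        case False
        then show ?thesis using df d unfolding riemannian_metric_def metric_inner_def by (meson less_imp_le)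
      qed simp
      then have "(real CARD('n) - 1 - \<epsilon>) * metric_inner (g' \<alpha> d) x v v
          \<le> (real CARD('n) - 1 - e \<alpha>) * metric_inner (g' \<alpha> d) x v v"
        by (rule mult_right_mono[rotated]) (simp add: e_def)
      ultimately show "(real CARD('n) - 1 - \<epsilon>) * metric_inner (g' \<alpha> d) x v v \<le> ricci (g' \<alpha> d) x v v"
        by linarith
    qed
    moreover have "I (g' \<alpha>) \<and> sec_at_gt A (g' \<alpha>) p K" if "\<alpha> \<ge> 1" for \<alpha>
      using g'[OF that] by (simp add: deformation_of_def)
    ultimately show ?thesis by blast
  qed
  show "(\<forall>K>0. \<forall>g.
        almost_nonneg_curved X A g \<and> (\<forall>\<alpha>\<ge>1. I (g \<alpha>)) \<longrightarrow>
        (\<exists>g'. almost_nonneg_curved X A g' \<and> (\<forall>\<alpha>\<ge>1. I (g' \<alpha>) \<and> sec_at_gt A (g' \<alpha>) p K)))"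
  proof (intro allI impI, elim conjE)
    fix K :: real and g assume "K > 0" "almost_nonneg_curved X A g" "\<forall>\<alpha>\<ge>1. I (g \<alpha>)"
    \<comment> \<open>The value 1 for \<open>\<epsilon>\<close> is arbitrary, as no Ricci bound is
      claimed here.\<close>
    from family[OF this(1) zero_less_one this(2,3)]
    show "\<exists>g'. almost_nonneg_curved X A g' \<and> (\<forall>\<alpha>\<ge>1. I (g' \<alpha>) \<and> sec_at_gt A (g' \<alpha>) p K)" by blast
  qed
  show "(\<forall>K>0. \<forall>\<epsilon>>0. \<forall>g.
        almost_nonneg_curved X A g \<and> (\<forall>\<alpha>\<ge>1. ricci_ge A (g \<alpha>) (real CARD('n) - 1)) \<and>
        (\<forall>\<alpha>\<ge>1. I (g \<alpha>)) \<longrightarrow>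
        (\<exists>g'. almost_nonneg_curved X A g' \<and>
           (\<forall>\<alpha>\<ge>1. I (g' \<alpha>) \<and> ricci_ge A (g' \<alpha>) (real CARD('n) - 1 - \<epsilon>) \<and> sec_at_gt A (g' \<alpha>) p K)))"
  proof (intro allI impI, elim conjE)
    fix K \<epsilon> :: real and g assume "K > 0" "\<epsilon> > 0" "almost_nonneg_curved X A g"
      and r: "\<forall>\<alpha>\<ge>1. ricci_ge A (g \<alpha>) (real CARD('n) - 1)" and "\<forall>\<alpha>\<ge>1. I (g \<alpha>)"
    from family[OF this(1-3,5)] obtain g' where "almost_nonneg_curved X A g'"
      "\<forall>\<alpha>\<ge>1. I (g' \<alpha>) \<and> sec_at_gt A (g' \<alpha>) p K \<and>
        ((\<forall>\<alpha>\<ge>1. ricci_ge A (g \<alpha>) (real CARD('n) - 1)) \<longrightarrow> ricci_ge A (g' \<alpha>) (real CARD('n) - 1 - \<epsilon>))"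
      by (elim exE conjE)
    then show "\<exists>g'. almost_nonneg_curved X A g' \<and>
           (\<forall>\<alpha>\<ge>1. I (g' \<alpha>) \<and> ricci_ge A (g' \<alpha>) (real CARD('n) - 1 - \<epsilon>) \<and> sec_at_gt A (g' \<alpha>) p K)"
      using r by (intro exI[of _ g']) simp
  qed
qed

theorem theorem5:
  fixes X :: "'m topology" and A :: "('m, real^'n) chart set" and p :: 'm
  assumes "smooth_manifold X A" and "compact_space X" and "p \<in> topspace X"
  shows
    "(\<forall>K>0. \<forall>\<epsilon>>0. \<forall>g.
        riemannian_metric A g \<and> ricci_ge A g (real CARD('n) - 1) \<longrightarrow>
        (\<exists>g'. riemannian_metric A g' \<and>
           ricci_ge A g' (real CARD('n) - 1 - \<epsilon>) \<and> sec_at_ge A g' p K))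
   \<and> (\<forall>K>0. \<forall>g.
        almost_nonneg_curved X A g \<longrightarrow>
        (\<exists>g'. almost_nonneg_curved X A g' \<and> (\<forall>\<alpha>\<ge>1. sec_at_gt A (g' \<alpha>) p K)))
   \<and> (\<forall>K>0. \<forall>\<epsilon>>0. \<forall>g.
        almost_nonneg_curved X A g \<and> (\<forall>\<alpha>\<ge>1. ricci_ge A (g \<alpha>) (real CARD('n) - 1)) \<longrightarrow>
        (\<exists>g'. almost_nonneg_curved X A g' \<and>
           (\<forall>\<alpha>\<ge>1. ricci_ge A (g' \<alpha>) (real CARD('n) - 1 - \<epsilon>) \<and> sec_at_gt A (g' \<alpha>) p K)))
   \<and> (\<forall>(G :: 'g monoid) Y (B :: ('g, 'e::real_normed_vector) chart set) \<phi>.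
        lie_group G Y B \<and> compact_space Y \<and> connected_space Y \<and>
        smooth_action G Y B X A \<phi> \<and> (\<forall>a\<in>carrier G. \<phi> a p = p) \<longrightarrow>
        (\<forall>K>0. \<forall>\<epsilon>>0. \<forall>g.
           riemannian_metric A g \<and> ricci_ge A g (real CARD('n) - 1) \<and>
           invariant_metric G \<phi> A g \<longrightarrow>
           (\<exists>g'. riemannian_metric A g' \<and> invariant_metric G \<phi> A g' \<and>
              ricci_ge A g' (real CARD('n) - 1 - \<epsilon>) \<and> sec_at_ge A g' p K))
      \<and> (\<forall>K>0. \<forall>g.
           almost_nonneg_curved X A g \<and> (\<forall>\<alpha>\<ge>1. invariant_metric G \<phi> A (g \<alpha>)) \<longrightarrow>
           (\<exists>g'. almost_nonneg_curved X A g' \<and>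
              (\<forall>\<alpha>\<ge>1. invariant_metric G \<phi> A (g' \<alpha>) \<and> sec_at_gt A (g' \<alpha>) p K)))
      \<and> (\<forall>K>0. \<forall>\<epsilon>>0. \<forall>g.
           almost_nonneg_curved X A g \<and> (\<forall>\<alpha>\<ge>1. ricci_ge A (g \<alpha>) (real CARD('n) - 1)) \<and>
           (\<forall>\<alpha>\<ge>1. invariant_metric G \<phi> A (g \<alpha>)) \<longrightarrow>
           (\<exists>g'. almost_nonneg_curved X A g' \<and>
              (\<forall>\<alpha>\<ge>1. invariant_metric G \<phi> A (g' \<alpha>) \<and>
                 ricci_ge A (g' \<alpha>) (real CARD('n) - 1 - \<epsilon>) \<and> sec_at_gt A (g' \<alpha>) p K))))"
proof -
  obtain c where c: "c \<in> A" "p \<in> fst c" using assms(3) smooth_manifoldD(3)[OF assms(1)] by blast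
  have xp: "snd c p \<in> snd c ` fst c" using c(2) by blast
  have plain: "\<exists>g'. deformation_of X A p K \<epsilon> g g' \<and> True"
    if g: "riemannian_metric A g" and "True" "K > 0" "\<epsilon> > 0" for g K \<epsilon>
  proof -
    obtain Q where Q: "squared_distance_like X A c p (g c (snd c p)) Q"
      using squared_distance_like_exists[OF assms(1) c, of "g c (snd c p)"] g c(1) xp
      unfolding riemannian_metric_def by blast
    show ?thesis using deformation_exists[OF assms(1,2) g c Q that(3,4)] by blast
  qed
  have equivariant: "\<exists>g'. deformation_of X A p K \<epsilon> g g' \<and> invariant_metric G \<phi> A g'"
    if G: "lie_group G Y B" "compact_space Y" and act: "smooth_action G Y B X A \<phi>"
      and fp: "\<forall>a\<in>carrier G. \<phi> a p = p"
      and g: "riemannian_metric A g" and inv: "invariant_metric G \<phi> A g" and "K > 0" "\<epsilon> > 0"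
    for G :: "'g monoid" and Y and B :: "('g, 'e::real_normed_vector) chart set" and \<phi> g K \<epsilon>
  proof -
    obtain Q where Q: "squared_distance_like X A c p (g c (snd c p)) Q"
        "\<forall>a\<in>carrier G. \<forall>m\<in>topspace X. Q (\<phi> a m) = Q m"
      using invariant_squared_distance_like_exists[OF assms(1) c g G act _ inv] fp by blast
    obtain g' where "deformation_of X A p K \<epsilon> g g'"
      "\<forall>\<psi>. preserves_tensor A g \<psi> \<and> (\<forall>m\<in>topspace X. Q (\<psi> m) = Q m) \<longrightarrow> preserves_tensor A g' \<psi>"
      using deformation_exists[OF assms(1,2) g c Q(1) \<open>K > 0\<close> \<open>\<epsilon> > 0\<close>] by (elim exE conjE)
    then show ?thesis using inv Q(2) unfolding invariant_metric_def by (intro exI[of _ g']) simp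
  qed
  \<comment> \<open>The predicate \<open>I\<close> stands for invariance of the metric; the
    constantly true one gives the statements without a group action.\<close>
  note plain' = deformed_families[where I="\<lambda>_. True", OF plain, simplified simp_thms]
  show ?thesis
  proof (intro conjI)
    show "\<forall>K>0. \<forall>\<epsilon>>0. \<forall>g.
        riemannian_metric A g \<and> ricci_ge A g (real CARD('n) - 1) \<longrightarrow>
        (\<exists>g'. riemannian_metric A g' \<and>
           ricci_ge A g' (real CARD('n) - 1 - \<epsilon>) \<and> sec_at_ge A g' p K)"
      by (rule plain'(1))
    show "\<forall>K>0. \<forall>g.
        almost_nonneg_curved X A g \<longrightarrow>
        (\<exists>g'. almost_nonneg_curved X A g' \<and> (\<forall>\<alpha>\<ge>1. sec_at_gt A (g' \<alpha>) p K))"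
      by (rule plain'(2))
    show "\<forall>K>0. \<forall>\<epsilon>>0. \<forall>g.
        almost_nonneg_curved X A g \<and> (\<forall>\<alpha>\<ge>1. ricci_ge A (g \<alpha>) (real CARD('n) - 1)) \<longrightarrow>
        (\<exists>g'. almost_nonneg_curved X A g' \<and>
           (\<forall>\<alpha>\<ge>1. ricci_ge A (g' \<alpha>) (real CARD('n) - 1 - \<epsilon>) \<and> sec_at_gt A (g' \<alpha>) p K))"
      by (rule plain'(3))
  next
    show "\<forall>(G :: 'g monoid) Y (B :: ('g, 'e::real_normed_vector) chart set) \<phi>.
        lie_group G Y B \<and> compact_space Y \<and> connected_space Y \<and>
        smooth_action G Y B X A \<phi> \<and> (\<forall>a\<in>carrier G. \<phi> a p = p) \<longrightarrow>
        (\<forall>K>0. \<forall>\<epsilon>>0. \<forall>g.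
           riemannian_metric A g \<and> ricci_ge A g (real CARD('n) - 1) \<and>
           invariant_metric G \<phi> A g \<longrightarrow>
           (\<exists>g'. riemannian_metric A g' \<and> invariant_metric G \<phi> A g' \<and>
              ricci_ge A g' (real CARD('n) - 1 - \<epsilon>) \<and> sec_at_ge A g' p K))
      \<and> (\<forall>K>0. \<forall>g.
           almost_nonneg_curved X A g \<and> (\<forall>\<alpha>\<ge>1. invariant_metric G \<phi> A (g \<alpha>)) \<longrightarrow>
           (\<exists>g'. almost_nonneg_curved X A g' \<and>
              (\<forall>\<alpha>\<ge>1. invariant_metric G \<phi> A (g' \<alpha>) \<and> sec_at_gt A (g' \<alpha>) p K)))
      \<and> (\<forall>K>0. \<forall>\<epsilon>>0. \<forall>g.
           almost_nonneg_curved X A g \<and> (\<forall>\<alpha>\<ge>1. ricci_ge A (g \<alpha>) (real CARD('n) - 1)) \<and>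
           (\<forall>\<alpha>\<ge>1. invariant_metric G \<phi> A (g \<alpha>)) \<longrightarrow>
           (\<exists>g'. almost_nonneg_curved X A g' \<and>
              (\<forall>\<alpha>\<ge>1. invariant_metric G \<phi> A (g' \<alpha>) \<and>
                 ricci_ge A (g' \<alpha>) (real CARD('n) - 1 - \<epsilon>) \<and> sec_at_gt A (g' \<alpha>) p K)))"
    proof (intro allI impI, elim conjE)
      fix G :: "'g monoid" and Y and B :: "('g, 'e) chart set" and \<phi>
      assume h: "lie_group G Y B" "compact_space Y" "smooth_action G Y B X A \<phi>" "\<forall>a\<in>carrier G. \<phi> a p = p"
      note r = deformed_families[where I="invariant_metric G \<phi> A", OF equivariant[OF h]]
      show "(\<forall>K>0. \<forall>\<epsilon>>0. \<forall>g.
           riemannian_metric A g \<and> ricci_ge A g (real CARD('n) - 1) \<and>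
           invariant_metric G \<phi> A g \<longrightarrow>
           (\<exists>g'. riemannian_metric A g' \<and> invariant_metric G \<phi> A g' \<and>
              ricci_ge A g' (real CARD('n) - 1 - \<epsilon>) \<and> sec_at_ge A g' p K))
      \<and> (\<forall>K>0. \<forall>g.
           almost_nonneg_curved X A g \<and> (\<forall>\<alpha>\<ge>1. invariant_metric G \<phi> A (g \<alpha>)) \<longrightarrow>
           (\<exists>g'. almost_nonneg_curved X A g' \<and>
              (\<forall>\<alpha>\<ge>1. invariant_metric G \<phi> A (g' \<alpha>) \<and> sec_at_gt A (g' \<alpha>) p K)))
      \<and> (\<forall>K>0. \<forall>\<epsilon>>0. \<forall>g.
           almost_nonneg_curved X A g \<and> (\<forall>\<alpha>\<ge>1. ricci_ge A (g \<alpha>) (real CARD('n) - 1)) \<and>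
           (\<forall>\<alpha>\<ge>1. invariant_metric G \<phi> A (g \<alpha>)) \<longrightarrow>
           (\<exists>g'. almost_nonneg_curved X A g' \<and>
              (\<forall>\<alpha>\<ge>1. invariant_metric G \<phi> A (g' \<alpha>) \<and>
                 ricci_ge A (g' \<alpha>) (real CARD('n) - 1 - \<epsilon>) \<and> sec_at_gt A (g' \<alpha>) p K)))"
        by (intro conjI r)
    qed
  qed
qed

end
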